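(* Let $s,t\in\mathbb{R}^2$ be two distinct fixed points, let $X_n$ be a homogeneous Poisson point process of intensity $n$ in $\mathbb{R}^2$, and let $X:=X_n\cup\{s,t\}$. Let $\ell(UP_X)$ be the length of the upper path $UP_X$ from $s$ to $t$ in the Delaunay triangulation $\operatorname{Del}(X)$. Then, as $n\to\infty$, $$\mathbb{E}\left[\frac{\ell(UP_X)}{\|s-t\|}\right]=\frac{35}{3\pi^2}+O\left(n^{-1/2}\right)\ (\simeq 1.182).$$
   Context: $\|\cdot\|$ is the Euclidean norm. For a locally finite set $\chi\subset\mathbb{R}^2$ in general position (no three points on a line, no four points on a circle), the Delaunay triangulation $\operatorname{Del}(\chi)$ consists of the triangles with vertices $x_1,x_2,x_3\in\chi$ whose circumscribed disk contains no point of $\chi$ in its interior, together with the edges of these triangles. Upper path: choose orthonormal coordinates in which $s=(0,0)$ and $t=(\|s-t\|,0)$. The upper path $UP_X$ from $s$ to $t$ is made of all the edges contained in $\mathbb{R}\times\mathbb{R}_+$ that belong to Delaunay triangles of $\operatorname{Del}(X)$ whose interior intersects $[s,t]$, traversed from $s$ to $t$ following the left-to-right order of these triangles along $[s,t]$. An edge that belongs to two such triangles is traversed in both directions and its length is counted twice in $\ell(UP_X)$. If $[s,t]$ is itself a Delaunay edge, $UP_X$ is the segment $[s,t]$. The points $s,t$ are fixed (independent of $n$). *)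

theory Defs
  imports "HOL-Probability.Probability" "HOL-Library.Landau_Symbols"
begin

text \<open>
  A homogeneous Poisson point process of intensity \<open>n\<close> in the plane, as a random locally finite
  set. The probabilities are spelled out because the library's Poisson distribution requires a
  strictly positive rate, whereas null sets have rate 0 (with \<open>0 ^ 0 = 1\<close> the formula is right
  there too).
\<close>

definition poisson_point_process :: "'w measure \<Rightarrow> real \<Rightarrow> ('w \<Rightarrow> (real^2) set) \<Rightarrow> bool" where
  "poisson_point_process M n X \<longleftrightarrow>
     prob_space M \<and>
     (\<forall>\<omega>\<in>space M. \<forall>B. bounded B \<longrightarrow> finite (X \<omega> \<inter> B)) \<and>
     (\<forall>B\<in>sets borel. bounded B \<longrightarrow>
        (\<lambda>\<omega>. card (X \<omega> \<inter> B)) \<in> measurable M (count_space UNIV) \<and>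
        (\<forall>k. measure M {\<omega> \<in> space M. card (X \<omega> \<inter> B) = k} =
               (n * measure lborel B) ^ k / fact k * exp (- (n * measure lborel B)))) \<and>
     (\<forall>m B. (\<forall>i<m. B i \<in> sets borel \<and> bounded (B i)) \<and> disjoint_family_on B {..<m::nat} \<longrightarrow>
        prob_space.indep_vars M (\<lambda>_. count_space UNIV) (\<lambda>i \<omega>. card (X \<omega> \<inter> B i)) {..<m})"

text \<open>
  A triangle is represented by the set of its three vertices, an edge by the closed segment it
  occupies. For sets that are not in general position these definitions still make sense; a
  Poisson process together with two fixed points is almost surely in general position, so the
  degenerate configurations play no role.
\<close>

definition delaunay_triangles :: "(real^2) set \<Rightarrow> (real^2) set set" where
  "delaunay_triangles P =
     {T. T \<subseteq> P \<and> card T = 3 \<and> \<not> collinear T \<and> (\<exists>c r. T \<subseteq> sphere c r \<and> ball c r \<inter> P = {})}"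

definition triangle_edges :: "(real^2) set \<Rightarrow> (real^2) set set" where
  "triangle_edges T = {closed_segment p q | p q. p \<in> T \<and> q \<in> T \<and> p \<noteq> q}"

definition delaunay_edges :: "(real^2) set \<Rightarrow> (real^2) set set" where
  "delaunay_edges P = (\<Union>T\<in>delaunay_triangles P. triangle_edges T)"

definition crossed_triangles :: "(real^2) set \<Rightarrow> real^2 \<Rightarrow> real^2 \<Rightarrow> (real^2) set set" where
  "crossed_triangles X s t =
     {T \<in> delaunay_triangles X. interior (convex hull T) \<inter> closed_segment s t \<noteq> {}}"

text \<open>
  Orthonormal coordinates with origin \<open>s\<close> and with \<open>t\<close> on the positive first axis are determined
  by the second basis vector \<open>u\<close>, a unit vector orthogonal to \<open>t - s\<close>. The next set is the closed
  upper half plane in these coordinates.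
\<close>

definition upper_half_plane :: "real^2 \<Rightarrow> real^2 \<Rightarrow> (real^2) set" where
  "upper_half_plane s u = {p. 0 \<le> (p - s) \<bullet> u}"

text \<open>
  The position at which the segment from \<open>s\<close> to \<open>t\<close> enters the interior of \<open>T\<close>. In general
  position the interiors of the crossed triangles meet the segment in disjoint intervals, so
  ordering the triangles by this number is the left-to-right order along the segment.
\<close>

definition entry_position :: "real^2 \<Rightarrow> real^2 \<Rightarrow> (real^2) set \<Rightarrow> real" where
  "entry_position s t T =
     Inf ((\<lambda>p. (p - s) \<bullet> (t - s)) ` (interior (convex hull T) \<inter> closed_segment s t))"

text \<open>
  The pairs of a crossed triangle and one of its edges in the upper half plane. Working with
  pairs makes an edge of two crossed triangles occur twice in the path.
\<close>

definition upper_incidences ::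
    "(real^2) set \<Rightarrow> real^2 \<Rightarrow> real^2 \<Rightarrow> real^2 \<Rightarrow> ((real^2) set \<times> (real^2) set) set" where
  "upper_incidences X s t u =
     {(T, e). T \<in> crossed_triangles X s t \<and> e \<in> triangle_edges T \<and> e \<subseteq> upper_half_plane s u}"

text \<open>
  The upper path, as the list of its edges in the order of traversal. In general position
  a crossed triangle has at most one edge in the upper half plane, so that the list to be chosen
  is unique. The segment meets infinitely many triangles only with probability 0; the empty list
  is a dummy value for this case.
\<close>

definition upper_path ::
    "(real^2) set \<Rightarrow> real^2 \<Rightarrow> real^2 \<Rightarrow> real^2 \<Rightarrow> (real^2) set list" where
  "upper_path X s t u =
     (if closed_segment s t \<in> delaunay_edges X then [closed_segment s t]
      else if finite (upper_incidences X s t u) then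
        map snd (SOME es. distinct es \<and> set es = upper_incidences X s t u \<and>
                          sorted (map (entry_position s t \<circ> fst) es))
      else [])"

text \<open>The diameter of a segment is its length.\<close>

definition path_length :: "(real^2) set list \<Rightarrow> real" where
  "path_length es = sum_list (map diameter es)"

text \<open>The length does not depend on the choice made in the definition of the path.\<close>

lemma path_length_upper_path:
  assumes "closed_segment s t \<notin> delaunay_edges X"
  shows "path_length (upper_path X s t u) = (\<Sum>(T, e)\<in>upper_incidences X s t u. diameter e)"
proof (cases "finite (upper_incidences X s t u)")
  case True
  let ?P = "\<lambda>es. distinct es \<and> set es = upper_incidences X s t u \<and>
                 sorted (map (entry_position s t \<circ> fst) es)"
  obtain xs where xs: "set xs = upper_incidences X s t u" "distinct xs"
    using finite_distinct_list[OF True] by blast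
  have "?P (sort_key (entry_position s t \<circ> fst) xs)"
    using xs by simp
  then have "?P (SOME es. ?P es)"
    by (rule someI)
  then obtain es where es: "es = (SOME es. ?P es)" "distinct es" "set es = upper_incidences X s t u"
    by blast
  have "path_length (upper_path X s t u) = sum_list (map (diameter \<circ> snd) es)"
    using True assms by (simp add: upper_path_def path_length_def es(1))
  also have "\<dots> = sum (diameter \<circ> snd) (upper_incidences X s t u)"
    using sum_list_distinct_conv_sum_set[OF es(2), of "diameter \<circ> snd"] unfolding es(3) .
  finally show ?thesis
    by (simp add: case_prod_unfold comp_def)
next
  case False
  with assms show ?thesis
    by (simp add: upper_path_def path_length_def)
qed

end

(*
  An edge [x, y] of the upper path belongs to a Delaunay triangle x y z with x, y above the line and
  z below it. Hence, up to triangles whose circumscribed disk comes close to s or t, twice the length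
  of the path is the sum of |x - y| over the ordered triples x, y, z of the Poisson process with an
  empty circumscribed disk, with x, y above and z below the line, and with the projection of x on
  [s, t]. By the Mecke formula its expectation is n^3 times the integral of
  |x - y| exp(- n pi R(x, y, z)^2). In the coordinates x, v = y - x and w = z - x = v * shape the
  integration over x and v is elementary, and the integral over the shapes of triangles is 70 pi / 3;
  this gives 70 |s - t| / (3 pi^2), twice the main term. The exceptional triangles contribute
  O(n^(-1/2)): their number is bounded in expectation and their diameter is of order n^(-1/2).
*)
theory Submission
  imports Defs
begin

section \<open>Sums over Poisson configurations and the Mecke formula\<close>

text \<open>The hypothesis on \<open>X n\<close> speaks only of counts in bounded Borel sets, so
  both the Mecke formula and the measurability of the path length have to be derived. One device
  serves both: a countable base enumerates the points of a locally finite set measurably.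
  Measurability matters, since \<open>expectation\<close> of a non-integrable function is 0 by
  convention.

  The Mecke formula is applied to the Poisson points alone; \<open>s\<close> and \<open>t\<close>
  enter only in a pathwise, two-sided comparison of the path in \<open>X \<union> {s, t}\<close>
  with the sum over triples. The two can disagree only on triples that are \<open>near_end\<close>
  or have \<open>s\<close> or \<open>t\<close> as a vertex. The delicate case is that of [s, t]
  being a Delaunay edge: the path collapses to one segment, and the main sum must be shown to be
  small as well. This is done by comparing the powers of points with respect to two circles.

  The value 70 pi / 3 results from an explicit integration over the angles of a triangle. The rate
  n^(-1/2) results from bounding an exceptional edge by the circumdiameter, whose weight against
  exp(- n pi R^2) is of that order.\<close>

definition loc_finite :: "'a::metric_space set \<Rightarrow> bool" where
  "loc_finite \<phi> \<longleftrightarrow> (\<forall>B. bounded B \<longrightarrow> finite (\<phi> \<inter> B))"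

lemma loc_finite_subset: "loc_finite \<phi> \<Longrightarrow> \<psi> \<subseteq> \<phi> \<Longrightarrow> loc_finite \<psi>"
  unfolding loc_finite_def by (blast intro: finite_subset[of "\<psi> \<inter> _" "\<phi> \<inter> _"])

lemma loc_finite_Diff: "loc_finite \<phi> \<Longrightarrow> loc_finite (\<phi> - A)"
  by (erule loc_finite_subset) simp

lemma loc_finite_Un: "loc_finite \<phi> \<Longrightarrow> finite A \<Longrightarrow> loc_finite (\<phi> \<union> A)"
  unfolding loc_finite_def by (simp add: Int_Un_distrib2)

section \<open>The sigma-algebra of void events\<close>

definition void_sets :: "'a::euclidean_space set set set" where
  "void_sets = {{\<phi>. loc_finite \<phi> \<and> \<phi> \<inter> B = {}} | B. B \<in> sets borel \<and> bounded B}"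

text \<open>Void events suffice as generators: for sets without multiplicities they determine all
  counts. They are also stable under intersection, which the uniqueness argument for the Mecke
  formula exploits.\<close>

definition config_space :: "'a::euclidean_space set measure" where
  "config_space = sigma {\<phi>. loc_finite \<phi>} void_sets"

lemma space_config [simp]: "space config_space = {\<phi>. loc_finite \<phi>}"
  unfolding config_space_def by (rule space_measure_of) (auto simp: void_sets_def)

lemma sets_config: "sets config_space = sigma_sets {\<phi>. loc_finite \<phi>} void_sets"
  unfolding config_space_def by (rule sets_measure_of) (auto simp: void_sets_def)

lemma pred_void_bounded:
  "B \<in> sets borel \<Longrightarrow> bounded B \<Longrightarrow> Measurable.pred config_space (\<lambda>\<phi>. \<phi> \<inter> B = {})"
  unfolding pred_def sets_config space_config
  by (rule sigma_sets.Basic) (auto simp: void_sets_def)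

text \<open>Here \<open>B\<close> may be unbounded: missing it means missing its countably many
  bounded pieces.\<close>

lemma pred_void:
  assumes [measurable]: "B \<in> sets borel"
  shows "Measurable.pred config_space (\<lambda>\<phi>. \<phi> \<inter> (B :: 'a::euclidean_space set) = {})"
proof -
  have eq: "\<phi> \<inter> B = {} \<longleftrightarrow> (\<forall>k::nat. \<phi> \<inter> (B \<inter> ball 0 k) = {})" for \<phi>
  proof -
    have "\<exists>k::nat. x \<in> ball 0 k" for x :: 'a
      using reals_Archimedean2[of "norm x"] by simp
    then show ?thesis by blast
  qed
  show ?thesis
    unfolding eq
    by (intro pred_intros_countable pred_void_bounded) (auto intro: bounded_Int)
qed

lemma measurable_into_config:
  assumes "\<And>\<omega>. \<omega> \<in> space N \<Longrightarrow> loc_finite (f \<omega>)"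
    and "\<And>B. B \<in> sets borel \<Longrightarrow> bounded B \<Longrightarrow> Measurable.pred N (\<lambda>\<omega>. f \<omega> \<inter> B = {})"
  shows "f \<in> measurable N config_space"
  unfolding config_space_def
proof (rule measurable_measure_of)
  show "void_sets \<subseteq> Pow {\<phi>. loc_finite \<phi>}"
    by (auto simp: void_sets_def)
  show "f \<in> space N \<rightarrow> {\<phi>. loc_finite \<phi>}"
    using assms(1) by auto
  fix V :: "'b set set" assume "V \<in> void_sets"
  then obtain B where B: "B \<in> sets borel" "bounded B" "V = {\<phi>. loc_finite \<phi> \<and> \<phi> \<inter> B = {}}"
    by (auto simp: void_sets_def)
  have "f -` V \<inter> space N = {\<omega> \<in> space N. f \<omega> \<inter> B = {}}"
    using assms(1) B(3) by auto
  then show "f -` V \<inter> space N \<in> sets N"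
    using assms(2)[OF B(1,2)] by (simp add: pred_def)
qed

text \<open>
  A point of a locally finite set is selected by the first basic open set that contains it and no
  other point. This turns a sum over the points into a series of measurable functions.
\<close>

definition sep_base :: "nat \<Rightarrow> 'a::euclidean_space set" where
  "sep_base = (SOME B. (\<forall>n. open (B n)) \<and> (\<forall>x e. e > 0 \<longrightarrow> (\<exists>n. x \<in> B n \<and> B n \<subseteq> ball x e)))"

lemma sep_base:
  "open (sep_base n :: 'a::euclidean_space set)"
  "e > 0 \<Longrightarrow> \<exists>n. (x::'a) \<in> sep_base n \<and> sep_base n \<subseteq> ball x e"
proof -
  obtain D :: "'a set set" where D: "countable D" "topological_basis D"
    using ex_countable_basis by blast
  have ne: "D \<noteq> {}"
    using topological_basisE[OF D(2) open_UNIV UNIV_I] by blast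
  have "(\<forall>n. open (from_nat_into D n)) \<and>
      (\<forall>x e. e > 0 \<longrightarrow> (\<exists>n. x \<in> from_nat_into D n \<and> from_nat_into D n \<subseteq> ball x e))"
  proof (intro conjI allI impI)
    show "open (from_nat_into D n)" for n
      using D(2) from_nat_into[OF ne] topological_basis_open by blast
    show "\<exists>n. x \<in> from_nat_into D n \<and> from_nat_into D n \<subseteq> ball x e" if "e > 0" for x e
    proof -
      obtain U where "U \<in> D" "x \<in> U" "U \<subseteq> ball x e"
        using topological_basisE[OF D(2), of "ball x e" x] \<open>e > 0\<close> by auto
      then show ?thesis
        using from_nat_into_surj[OF D(1)] by metis
    qed
  qed
  then have "\<exists>B::nat \<Rightarrow> 'a set. (\<forall>n. open (B n)) \<and> (\<forall>x e. e > 0 \<longrightarrow> (\<exists>n. x \<in> B n \<and> B n \<subseteq> ball x e))"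
    by (intro exI[where x = "from_nat_into D"])
  from someI_ex[OF this, folded sep_base_def]
  show "open (sep_base n :: 'a set)"
    "e > 0 \<Longrightarrow> \<exists>n. (x::'a) \<in> sep_base n \<and> sep_base n \<subseteq> ball x e"
    by blast+
qed

lemma sep_base_borel [measurable]: "sep_base n \<in> sets borel"
  by (rule borel_open[OF sep_base(1)])

lemma sep_base_disjoint:
  fixes x y :: "'a::euclidean_space"
  assumes "x \<noteq> y"
  shows "\<exists>i j. x \<in> sep_base i \<and> y \<in> sep_base j \<and> sep_base i \<inter> (sep_base j :: 'a set) = {}"
proof -
  let ?e = "dist x y / 2"
  have e: "?e > 0" using assms by simp
  obtain i j where ij: "x \<in> sep_base i" "sep_base i \<subseteq> ball x ?e" "y \<in> sep_base j" "sep_base j \<subseteq> ball y ?e"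
    using sep_base(2)[OF e, of x] sep_base(2)[OF e, of y] by blast
  have "ball x ?e \<inter> ball y ?e = {}"
    by (rule disjoint_ballI) simp
  then show ?thesis using ij by blast
qed

definition singled :: "nat \<Rightarrow> 'a::euclidean_space set \<Rightarrow> bool" where
  "singled i \<phi> \<longleftrightarrow> (\<exists>y. \<phi> \<inter> sep_base i = {y})"

text \<open>The value 0 for an index that isolates no point is a dummy; \<open>fresh\<close> filters
  it out.\<close>

definition single_pt :: "nat \<Rightarrow> 'a::euclidean_space set \<Rightarrow> 'a" where
  "single_pt i \<phi> = (if singled i \<phi> then the_elem (\<phi> \<inter> sep_base i) else 0)"

lemma singledD: "singled i \<phi> \<Longrightarrow> \<phi> \<inter> sep_base i = {single_pt i \<phi>}"
proof -
  assume s: "singled i \<phi>"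
  then obtain y where "\<phi> \<inter> sep_base i = {y}" unfolding singled_def by blast
  then show ?thesis by (simp only: single_pt_def s if_True the_elem_eq)
qed

text \<open>A point is isolated by many base sets. Keeping only the least index makes every point
  occur exactly once in the enumeration.\<close>

definition fresh :: "nat \<Rightarrow> 'a::euclidean_space set \<Rightarrow> bool" where
  "fresh i \<phi> \<longleftrightarrow> singled i \<phi> \<and> (\<forall>j<i. \<not> (singled j \<phi> \<and> single_pt j \<phi> = single_pt i \<phi>))"

text \<open>Uniqueness of the point is rephrased by void events: two different points of
  \<open>sep_base i\<close> would lie in two disjoint base sets. Only countably many void events are
  involved, so \<open>singled\<close> is measurable.\<close>

lemma singled_iff:
  fixes \<phi> :: "'a::euclidean_space set"
  shows
  "singled i \<phi> \<longleftrightarrow> \<phi> \<inter> sep_base i \<noteq> {} \<and>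
    (\<forall>j k. (sep_base j \<inter> sep_base k :: 'a::euclidean_space set) = {} \<longrightarrow>
       \<phi> \<inter> (sep_base i \<inter> sep_base j) = {} \<or> \<phi> \<inter> (sep_base i \<inter> sep_base k) = {})"
  (is "_ \<longleftrightarrow> ?N \<and> ?S")
proof
  assume "singled i \<phi>"
  then obtain y where y: "\<phi> \<inter> sep_base i = {y}" unfolding singled_def by blast
  have *: "\<phi> \<inter> (sep_base i \<inter> C) = {y} \<inter> C" for C
    using y by (simp only: Int_assoc[symmetric])
  show "?N \<and> ?S" unfolding * unfolding y by blast
next
  assume *: "?N \<and> ?S"
  then obtain y where y: "y \<in> \<phi> \<inter> sep_base i" by blast
  have "x = y" if "x \<in> \<phi> \<inter> sep_base i" for x
  proof (rule ccontr)
    assume "x \<noteq> y"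
    from sep_base_disjoint[OF this] obtain j k
      where jk: "x \<in> sep_base j" "y \<in> sep_base k" "sep_base j \<inter> (sep_base k :: 'a set) = {}"
      by blast
    then have "\<phi> \<inter> (sep_base i \<inter> sep_base j) \<noteq> {}" "\<phi> \<inter> (sep_base i \<inter> sep_base k) \<noteq> {}"
      using that y by blast+
    with * jk(3) show False by blast
  qed
  with y have "\<phi> \<inter> sep_base i = {y}" by blast
  then show "singled i \<phi>" unfolding singled_def by blast
qed

lemma pred_singled [measurable]: "Measurable.pred config_space (singled i :: 'a::euclidean_space set \<Rightarrow> bool)"
proof (rule measurable_cong[THEN iffD2, OF singled_iff])
  show "Measurable.pred config_space (\<lambda>\<phi>::'a set. \<phi> \<inter> sep_base i \<noteq> {} \<and>
    (\<forall>j k. sep_base j \<inter> sep_base k = ({} :: 'a set) \<longrightarrow>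
       \<phi> \<inter> (sep_base i \<inter> sep_base j) = {} \<or> \<phi> \<inter> (sep_base i \<inter> sep_base k) = {}))"
    by (intro pred_intros_logic pred_intros_countable pred_void measurable_const) auto
qed

lemma single_pt_measurable [measurable]:
  "single_pt i \<in> measurable config_space (borel :: 'a::euclidean_space measure)"
proof (rule measurableI)
  fix A :: "'a set" assume [measurable]: "A \<in> sets borel"
  \<comment> \<open>The selected point lies in \<open>A\<close> iff the part of
    \<open>sep_base i\<close> inside \<open>A\<close> is hit; the second disjunct accounts for the
    dummy value 0.\<close>
  have "single_pt i -` A \<inter> space config_space =
    {\<phi> \<in> space config_space. (singled i \<phi> \<and> \<not> (\<phi> \<inter> (sep_base i \<inter> A) = {})) \<or> (\<not> singled i \<phi> \<and> 0 \<in> A)}"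
  proof -
    have "single_pt i \<phi> \<in> A \<longleftrightarrow> (singled i \<phi> \<and> \<phi> \<inter> (sep_base i \<inter> A) \<noteq> {}) \<or> (\<not> singled i \<phi> \<and> 0 \<in> A)" for \<phi>
    proof (cases "singled i \<phi>")
      case True
      from singledD[OF this] have "\<phi> \<inter> (sep_base i \<inter> A) = {single_pt i \<phi>} \<inter> A" by blast
      with True show ?thesis by auto
    qed (simp add: single_pt_def)
    then show ?thesis by blast
  qed
  also have "\<dots> \<in> sets config_space"
  proof -
    have "Measurable.pred config_space (\<lambda>\<phi>. (singled i \<phi> \<and> \<not> (\<phi> \<inter> (sep_base i \<inter> A) = {})) \<or> (\<not> singled i \<phi> \<and> 0 \<in> A))"
      by (intro pred_intros_logic pred_singled pred_void measurable_const sets.Int) auto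
    then show ?thesis unfolding pred_def .
  qed
  finally show "single_pt i -` A \<inter> space config_space \<in> sets config_space" .
qed simp

lemma pred_fresh [measurable]: "Measurable.pred config_space (fresh i :: 'a::euclidean_space set \<Rightarrow> bool)"
proof -
  have [measurable]: "Measurable.pred config_space (\<lambda>\<phi>. single_pt j \<phi> = (single_pt i \<phi> :: 'a))" for j
  proof -
    have eq: "single_pt j \<phi> = (single_pt i \<phi> :: 'a) \<longleftrightarrow> dist (single_pt j \<phi>) (single_pt i \<phi>) = 0" for \<phi>
      by simp
    show ?thesis unfolding eq by measurable
  qed
  have "Measurable.pred config_space (\<lambda>\<phi>::'a set. singled i \<phi> \<and>
      (\<forall>j. j < i \<longrightarrow> \<not> (singled j \<phi> \<and> single_pt j \<phi> = single_pt i \<phi>)))"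
    by (intro pred_intros_logic pred_intros_countable pred_singled measurable_const) simp_all
  then show ?thesis unfolding fresh_def[abs_def] .
qed

text \<open>Local finiteness isolates each point by a sufficiently small base set; the least index
  that does so is fresh.\<close>

lemma bij_betw_single_pt:
  assumes "loc_finite (\<phi> :: 'a::euclidean_space set)"
  shows "bij_betw (\<lambda>i. single_pt i \<phi>) {i. fresh i \<phi>} \<phi>"
  unfolding bij_betw_def
proof
  show "inj_on (\<lambda>i. single_pt i \<phi>) {i. fresh i \<phi>}"
  proof (rule inj_onI)
    fix i j assume "i \<in> {i. fresh i \<phi>}" "j \<in> {i. fresh i \<phi>}" "single_pt i \<phi> = single_pt j \<phi>"
    then have "\<not> i < j" "\<not> j < i" by (auto simp: fresh_def)
    then show "i = j" by simp
  qed
  have "x \<in> (\<lambda>i. single_pt i \<phi>) ` {i. fresh i \<phi>}" if x: "x \<in> \<phi>" for x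
  proof -
    have "finite (\<phi> \<inter> ball x 1 - {x})"
      using assms unfolding loc_finite_def by blast
    from finite_set_avoid[OF this, of x]
    obtain e where e: "e > 0" "\<forall>y\<in>\<phi> \<inter> ball x 1 - {x}. e \<le> dist x y"
      by blast
    \<comment> \<open>The bound 1 keeps the base set inside the unit ball, the only region in which
      \<open>e\<close> controls the other points.\<close>
    obtain n where n: "x \<in> sep_base n" "sep_base n \<subseteq> ball x (min e 1)"
      using sep_base(2)[of "min e 1" x] e(1) by auto
    have "y = x" if "y \<in> \<phi> \<inter> sep_base n" for y
    proof (rule ccontr)
      assume yx: "y \<noteq> x"
      from that n have yb: "y \<in> ball x (min e 1)" by blast
      from yx this that have "y \<in> \<phi> \<inter> ball x 1 - {x}" by simp
      with yb show False using e(2)[rule_format, of y] by simp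
    qed
    then have "\<phi> \<inter> sep_base n = {x}" using n x by blast
    then have n: "singled n \<phi> \<and> single_pt n \<phi> = x"
      by (simp add: singled_def single_pt_def)
    then obtain m where m: "singled m \<phi>" "single_pt m \<phi> = x"
        "\<forall>j<m. \<not> (singled j \<phi> \<and> single_pt j \<phi> = x)"
      using exists_least_iff[of "\<lambda>n. singled n \<phi> \<and> single_pt n \<phi> = x"] by blast
    then have "fresh m \<phi>"
      unfolding fresh_def by simp
    with m(2) show ?thesis by (intro image_eqI[of _ _ m]) simp_all
  qed
  then have sub: "\<phi> \<subseteq> (\<lambda>i. single_pt i \<phi>) ` {i. fresh i \<phi>}" by (rule subsetI)
  have sup: "single_pt i \<phi> \<in> \<phi>" if "fresh i \<phi>" for i
  proof -
    have "\<phi> \<inter> sep_base i = {single_pt i \<phi>}"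
      using that by (intro singledD) (simp add: fresh_def)
    then show ?thesis by blast
  qed
  have "(\<lambda>i. single_pt i \<phi>) ` {i. fresh i \<phi>} \<subseteq> \<phi>"
  proof
    fix y assume "y \<in> (\<lambda>i. single_pt i \<phi>) ` {i. fresh i \<phi>}"
    then obtain i where "fresh i \<phi>" "y = single_pt i \<phi>" by blast
    then show "y \<in> \<phi>" using sup[of i] by (simp only:)
  qed
  then show "(\<lambda>i. single_pt i \<phi>) ` {i. fresh i \<phi>} = \<phi>"
    using sub by (rule equalityI)
qed

lemma nn_sum_config:
  assumes "loc_finite (\<phi> :: 'a::euclidean_space set)"
  shows "(\<integral>\<^sup>+y. f y \<partial>count_space \<phi>) = (\<Sum>i. if fresh i \<phi> then f (single_pt i \<phi>) else 0)"
proof -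
  have "(\<integral>\<^sup>+y. f y \<partial>count_space \<phi>) = (\<integral>\<^sup>+i. f (single_pt i \<phi>) \<partial>count_space {i. fresh i \<phi>})"
    by (rule nn_integral_bij_count_space[OF bij_betw_single_pt[OF assms], symmetric])
  also have "\<dots> = (\<integral>\<^sup>+i. (if fresh i \<phi> then f (single_pt i \<phi>) else 0) \<partial>count_space UNIV)"
    by (subst nn_integral_count_space_indicator)
       (auto intro!: nn_integral_cong simp del: mult_cancel_left mult_cancel_right simp: indicator_def)
  finally show ?thesis unfolding nn_integral_count_space_nat .
qed

lemma Diff_sep_base_measurable [measurable]:
  "(\<lambda>\<phi>. \<phi> - sep_base i) \<in> measurable config_space (config_space :: 'a::euclidean_space set measure)"
proof (rule measurable_into_config)
  show "Measurable.pred config_space (\<lambda>\<phi>. (\<phi> - sep_base i) \<inter> B = {})"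
    if [measurable]: "B \<in> sets borel" for B :: "'a set"
  proof -
    have eq: "(\<phi> - sep_base i) \<inter> B = \<phi> \<inter> (B - sep_base i)" for \<phi> by blast
    show ?thesis unfolding eq by (rule pred_void) measurable
  qed
qed (auto intro: loc_finite_Diff)

lemma fresh_Diff: "fresh i \<phi> \<Longrightarrow> \<phi> - sep_base i = \<phi> - {single_pt i \<phi>}"
  using singledD[of i \<phi>] unfolding fresh_def by blast

text \<open>The removed point varies with the configuration, but for a fresh index its removal
  equals the removal of the fixed set \<open>sep_base i\<close>, which is a measurable map. The
  parameter \<open>p\<close> allows iteration to pairs and triples.\<close>

lemma measurable_nn_sum_config:
  fixes g :: "'p \<times> 'a::euclidean_space \<times> 'a set \<Rightarrow> ennreal"
  assumes [measurable]: "g \<in> borel_measurable (P \<Otimes>\<^sub>M borel \<Otimes>\<^sub>M config_space)"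
  shows "(\<lambda>(p, \<phi>). \<integral>\<^sup>+y. g (p, y, \<phi> - {y}) \<partial>count_space \<phi>) \<in> borel_measurable (P \<Otimes>\<^sub>M config_space)"
proof -
  have m: "(\<lambda>z. \<Sum>i. if fresh i (snd z) then g (fst z, single_pt i (snd z), snd z - sep_base i) else 0)
     \<in> borel_measurable (P \<Otimes>\<^sub>M (config_space :: 'a set measure))"
    by measurable
  have eq: "(case z of (p, \<phi>) \<Rightarrow> \<integral>\<^sup>+y. g (p, y, \<phi> - {y}) \<partial>count_space \<phi>) =
      (\<Sum>i. if fresh i (snd z) then g (fst z, single_pt i (snd z), snd z - sep_base i) else 0)"
    if "z \<in> space (P \<Otimes>\<^sub>M config_space)" for z
  proof -
    obtain p \<phi> where z: "z = (p, \<phi>)" by force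
    have lf: "loc_finite \<phi>" using that z by (auto simp: space_pair_measure)
    show ?thesis
      unfolding z prod.case fst_conv snd_conv nn_sum_config[OF lf]
      by (intro suminf_cong if_cong refl) (simp only: fresh_Diff)
  qed
  show ?thesis
    by (rule measurable_cong[THEN iffD2, OF eq m])
qed


section \<open>Counts of a Poisson process\<close>

locale poisson_process = prob_space M for M :: "'w measure" +
  fixes n :: real and X :: "'w \<Rightarrow> (real^2) set"
  assumes poisson: "poisson_point_process M n X" and intensity_pos: "n > 0"
begin

lemma loc_finite_X: "\<omega> \<in> space M \<Longrightarrow> loc_finite (X \<omega>)"
  using poisson by (simp add: poisson_point_process_def loc_finite_def)

lemma finite_X_Int: "\<omega> \<in> space M \<Longrightarrow> bounded B \<Longrightarrow> finite (X \<omega> \<inter> B)"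
  using loc_finite_X by (simp add: loc_finite_def)

lemma count_measurable:
  "B \<in> sets borel \<Longrightarrow> bounded B \<Longrightarrow> (\<lambda>\<omega>. card (X \<omega> \<inter> B)) \<in> measurable M (count_space UNIV)"
  using poisson by (simp add: poisson_point_process_def)

lemma prob_count:
  "B \<in> sets borel \<Longrightarrow> bounded B \<Longrightarrow> prob {\<omega> \<in> space M. card (X \<omega> \<inter> B) = k} =
     (n * measure lborel B) ^ k / fact k * exp (- (n * measure lborel B))"
  using poisson by (simp add: poisson_point_process_def)

lemma X_measurable [measurable]: "X \<in> measurable M config_space"
proof (rule measurable_into_config)
  fix B :: "(real^2) set" assume B: "B \<in> sets borel" "bounded B"
  note [measurable] = count_measurable[OF B]
  have "Measurable.pred M (\<lambda>\<omega>. card (X \<omega> \<inter> B) = 0)"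
    by measurable
  moreover have "X \<omega> \<inter> B = {} \<longleftrightarrow> card (X \<omega> \<inter> B) = 0" if "\<omega> \<in> space M" for \<omega>
    using finite_X_Int[OF that B(2)] by simp
  ultimately show "Measurable.pred M (\<lambda>\<omega>. X \<omega> \<inter> B = {})"
    by (rule measurable_cong[THEN iffD2, rotated])
qed (rule loc_finite_X)

lemma emeasure_void:
  assumes B: "B \<in> sets borel" "bounded B"
  shows "emeasure M {\<omega> \<in> space M. X \<omega> \<inter> B = {}} = ennreal (exp (- (n * measure lborel B)))"
proof -
  have "{\<omega> \<in> space M. X \<omega> \<inter> B = {}} = {\<omega> \<in> space M. card (X \<omega> \<inter> B) = 0}"
    using finite_X_Int[OF _ B(2)] by auto
  then show ?thesis
    by (simp add: emeasure_eq_measure prob_count[OF B])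
qed

lemma nn_integral_counts_indep:
  fixes f g :: "nat \<Rightarrow> ennreal"
  assumes C: "C \<in> sets borel" "bounded C" and D: "D \<in> sets borel" "bounded D" and "C \<inter> D = {}"
  shows "(\<integral>\<^sup>+\<omega>. f (card (X \<omega> \<inter> C)) * g (card (X \<omega> \<inter> D)) \<partial>M) =
    (\<integral>\<^sup>+\<omega>. f (card (X \<omega> \<inter> C)) \<partial>M) * (\<integral>\<^sup>+\<omega>. g (card (X \<omega> \<inter> D)) \<partial>M)"
proof -
  \<comment> \<open>The two sets are packed into a family indexed by 0 and 1, the form in which
    independence is given.\<close>
  define B where "B = (\<lambda>i::nat. if i = 0 then C else D)"
  define h where "h = (\<lambda>i::nat. if i = 0 then f else g)"
  have "disjoint_family_on B {..<2}"
    using \<open>C \<inter> D = {}\<close> by (auto simp: disjoint_family_on_def B_def)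
  moreover have "\<forall>i<2. B i \<in> sets borel \<and> bounded (B i)"
    using C D by (simp add: B_def)
  ultimately have "indep_vars (\<lambda>_. count_space UNIV) (\<lambda>i \<omega>. card (X \<omega> \<inter> B i)) {..<2}"
    using poisson unfolding poisson_point_process_def by blast
  then have "indep_vars (\<lambda>_. borel) (\<lambda>i \<omega>. h i (card (X \<omega> \<inter> B i))) {..<2}"
    by (rule indep_vars_compose2) simp
  then have "(\<integral>\<^sup>+\<omega>. (\<Prod>i<2. h i (card (X \<omega> \<inter> B i))) \<partial>M) = (\<Prod>i<2. \<integral>\<^sup>+\<omega>. h i (card (X \<omega> \<inter> B i)) \<partial>M)"
    by (intro indep_vars_nn_integral) simp_all
  then show ?thesis
    by (simp add: numeral_2_eq_2 B_def h_def)
qed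

lemma poisson_mean_sums:
  fixes a :: real
  shows "(\<lambda>k. real k * (a ^ k / fact k * exp (- a))) sums a"
proof -
  \<comment> \<open>The mean is the exponential series shifted by one index and multiplied by a; the
    term at 0 vanishes.\<close>
  have "(\<lambda>k. a ^ k /\<^sub>R fact k * (a * exp (- a))) sums (exp a * (a * exp (- a)))"
    by (intro sums_mult2 exp_converges)
  moreover have "exp a * (a * exp (- a)) = a"
    by (simp add: exp_minus)
  moreover have "a ^ k /\<^sub>R fact k * (a * exp (- a)) = real (Suc k) * (a ^ Suc k / fact (Suc k) * exp (- a))" for k
    by (simp add: divide_simps del: of_nat_Suc)
  ultimately have "(\<lambda>k. real (Suc k) * (a ^ Suc k / fact (Suc k) * exp (- a))) sums a"
    by simp
  then show ?thesis
    by (subst (asm) sums_Suc_iff) simp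
qed

lemma expected_count:
  assumes B: "B \<in> sets borel" "bounded B"
  shows "(\<integral>\<^sup>+\<omega>. of_nat (card (X \<omega> \<inter> B)) \<partial>M) = ennreal (n * measure lborel B)"
proof -
  note [measurable] = count_measurable[OF B]
  let ?a = "n * measure lborel B"
  have "(\<integral>\<^sup>+\<omega>. of_nat (card (X \<omega> \<inter> B)) \<partial>M) =
      (\<integral>\<^sup>+\<omega>. (\<Sum>k. of_nat k * indicator {\<omega> \<in> space M. card (X \<omega> \<inter> B) = k} \<omega>) \<partial>M)"
  proof (rule nn_integral_cong)
    fix \<omega> assume w: "\<omega> \<in> space M"
    have "(\<Sum>k. of_nat k * indicator {\<omega> \<in> space M. card (X \<omega> \<inter> B) = k} \<omega> :: ennreal) =
       (\<Sum>k\<in>{card (X \<omega> \<inter> B)}. of_nat k * indicator {\<omega> \<in> space M. card (X \<omega> \<inter> B) = k} \<omega>)"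
      by (rule suminf_finite) auto
    then show "of_nat (card (X \<omega> \<inter> B)) = (\<Sum>k. of_nat k * indicator {\<omega> \<in> space M. card (X \<omega> \<inter> B) = k} \<omega> :: ennreal)"
      using w by simp
  qed
  also have "\<dots> = (\<Sum>k. of_nat k * emeasure M {\<omega> \<in> space M. card (X \<omega> \<inter> B) = k})"
    by (subst nn_integral_suminf) (simp_all add: nn_integral_cmult_indicator)
  also have "\<dots> = (\<Sum>k. ennreal (real k * (?a ^ k / fact k * exp (- ?a))))"
    unfolding emeasure_eq_measure prob_count[OF B] ennreal_of_nat_eq_real_of_nat
    by (intro suminf_cong ennreal_mult'[symmetric]) simp
  also have "\<dots> = ennreal ?a"
    using intensity_pos by (intro suminf_ennreal_eq poisson_mean_sums) simp
  finally show ?thesis .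
qed

end

text \<open>Three cases: if \<open>B\<close> contains no point, every point of \<open>A\<close>
  counts; if the only point in \<open>B\<close> lies in \<open>A\<close>, exactly this point counts;
  otherwise no deletion of a point of \<open>A\<close> empties \<open>B\<close>. Each summand is a
  product of functions of counts in disjoint sets, so that independence applies to it.\<close>

lemma nn_count_Diff_void:
  assumes fin: "finite (\<phi> \<inter> A)" "finite (\<phi> \<inter> B)"
  shows "(\<integral>\<^sup>+x. indicator A x * indicator {\<psi>. \<psi> \<inter> B = {}} (\<phi> - {x}) \<partial>count_space \<phi>) =
    of_nat (card (\<phi> \<inter> (A - B))) * indicator {0} (card (\<phi> \<inter> B))
    + indicator {1} (card (\<phi> \<inter> (A \<inter> B))) * indicator {0} (card (\<phi> \<inter> (B - A)))"
proof -
  let ?S = "{x \<in> \<phi>. x \<in> A \<and> (\<phi> - {x}) \<inter> B = {}}"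
  have finS: "finite ?S" by (rule finite_subset[OF _ fin(1)]) auto
  have fin3: "finite (\<phi> \<inter> (A \<inter> B))" "finite (\<phi> \<inter> (B - A))"
    by (rule finite_subset[OF _ fin(2)]; blast)+
  have "(\<integral>\<^sup>+x. indicator A x * indicator {\<psi>. \<psi> \<inter> B = {}} (\<phi> - {x}) \<partial>count_space \<phi>) =
      (\<integral>\<^sup>+x. indicator ?S x \<partial>count_space \<phi>)"
    by (rule nn_integral_cong) (simp add: indicator_def)
  also have "\<dots> = of_nat (card ?S)"
    using finS by (subst nn_integral_indicator) (auto simp: emeasure_count_space)
  finally have eq: "(\<integral>\<^sup>+x. indicator A x * indicator {\<psi>. \<psi> \<inter> B = {}} (\<phi> - {x}) \<partial>count_space \<phi>) = of_nat (card ?S)" .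
  show ?thesis
  proof (cases "\<phi> \<inter> B = {}")
    case True
    have "?S = \<phi> \<inter> (A - B)" using True by blast
    moreover have "\<phi> \<inter> (A \<inter> B) = {}" using True by blast
    ultimately show ?thesis unfolding eq using True by simp
  next
    case False
    then have b: "card (\<phi> \<inter> B) \<noteq> 0" using fin(2) by simp
    show ?thesis
    proof (cases "\<exists>y\<in>A. \<phi> \<inter> B = {y}")
      case True
      then obtain y where y: "y \<in> A" "\<phi> \<inter> B = {y}" by blast
      have "?S = {y}" using y by blast
      moreover have "\<phi> \<inter> (A \<inter> B) = {y}" "\<phi> \<inter> (B - A) = {}" using y by auto
      ultimately show ?thesis unfolding eq using b by simp
    next
      case no: False
      have "?S = {}"
      proof (rule ccontr)
        assume "?S \<noteq> {}"
        then obtain x where "x \<in> \<phi>" "x \<in> A" "(\<phi> - {x}) \<inter> B = {}" by blast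
        then have "\<phi> \<inter> B = {x}" using False by blast
        then show False using no \<open>x \<in> A\<close> by blast
      qed
      moreover have "\<not> (card (\<phi> \<inter> (A \<inter> B)) = 1 \<and> card (\<phi> \<inter> (B - A)) = 0)"
      proof
        assume *: "card (\<phi> \<inter> (A \<inter> B)) = 1 \<and> card (\<phi> \<inter> (B - A)) = 0"
        then obtain y where "\<phi> \<inter> (A \<inter> B) = {y}" by (auto simp: card_1_singleton_iff)
        moreover have "\<phi> \<inter> (B - A) = {}" using * fin3 by simp
        ultimately have "y \<in> A" "\<phi> \<inter> B = {y}" by blast+
        then show False using no by blast
      qed
      ultimately show ?thesis unfolding eq using b
        by (simp only: card.empty indicator_def of_nat_0) auto
    qed
  qed
qed

lemma measurable_nn_sum_config':
  fixes g :: "'a::euclidean_space \<times> 'a set \<Rightarrow> ennreal"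
  assumes [measurable]: "g \<in> borel_measurable (borel \<Otimes>\<^sub>M config_space)"
  shows "(\<lambda>\<phi>. \<integral>\<^sup>+y. g (y, \<phi> - {y}) \<partial>count_space \<phi>) \<in> borel_measurable config_space"
proof -
  have "(\<lambda>(p, \<phi>). \<integral>\<^sup>+y. (\<lambda>q. g (snd q)) (p, y, \<phi> - {y}) \<partial>count_space \<phi>)
      \<in> borel_measurable (count_space (UNIV :: unit set) \<Otimes>\<^sub>M config_space)"
    by (rule measurable_nn_sum_config) measurable
  from measurable_Pair_compose_split[OF this measurable_const[of "()"] measurable_ident_sets[OF refl]]
  show ?thesis by simp
qed

section \<open>Generating rectangles for the product sigma-algebra\<close>

lemma Int_stable_void: "Int_stable (void_sets :: 'a::euclidean_space set set set)"
proof (rule Int_stableI)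
  fix V W :: "'a set set" assume "V \<in> void_sets" "W \<in> void_sets"
  then obtain B C where "B \<in> sets borel" "bounded B" "V = {\<phi>. loc_finite \<phi> \<and> \<phi> \<inter> B = {}}"
    "C \<in> sets borel" "bounded C" "W = {\<phi>. loc_finite \<phi> \<and> \<phi> \<inter> C = {}}"
    by (auto simp: void_sets_def)
  then have "B \<union> C \<in> sets borel" "bounded (B \<union> C)" "V \<inter> W = {\<phi>. loc_finite \<phi> \<and> \<phi> \<inter> (B \<union> C) = {}}"
    by auto
  then show "V \<inter> W \<in> void_sets"
    unfolding void_sets_def by blast
qed

definition mecke_rectangles :: "('a::euclidean_space \<times> 'a set) set set" where
  "mecke_rectangles = {A \<times> V | A V. A \<in> {A. A \<in> sets borel \<and> bounded A} \<and> V \<in> void_sets}"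

lemma Int_stable_mecke_rectangles: "Int_stable (mecke_rectangles :: ('a::euclidean_space \<times> 'a set) set set)"
proof (rule Int_stableI)
  fix P Q :: "('a \<times> 'a set) set" assume "P \<in> mecke_rectangles" "Q \<in> mecke_rectangles"
  then obtain A V B W where *: "P = A \<times> V" "A \<in> sets borel" "bounded A" "V \<in> void_sets"
    "Q = B \<times> W" "B \<in> sets borel" "bounded B" "W \<in> void_sets"
    by (auto simp: mecke_rectangles_def)
  then have "V \<inter> W \<in> void_sets" using Int_stable_void by (auto simp: Int_stable_def)
  moreover have "P \<inter> Q = (A \<inter> B) \<times> (V \<inter> W)" using * by auto
  moreover have "A \<inter> B \<in> sets borel" "bounded (A \<inter> B)" using * by (auto intro: bounded_Int)
  ultimately show "P \<inter> Q \<in> mecke_rectangles"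
    unfolding mecke_rectangles_def by blast
qed

lemma bounded_borel_generates:
  "sets (borel :: 'a::euclidean_space measure) = sigma_sets UNIV {A. A \<in> sets borel \<and> bounded A}"
proof
  show "sigma_sets UNIV {A. A \<in> sets borel \<and> bounded A} \<subseteq> sets (borel :: 'a measure)"
    using sets.sigma_sets_subset[of "{A. A \<in> sets borel \<and> bounded A}" "borel :: 'a measure"] by auto
  show "sets (borel :: 'a measure) \<subseteq> sigma_sets UNIV {A. A \<in> sets borel \<and> bounded A}"
  proof
    fix A :: "'a set" assume A: "A \<in> sets borel"
    have "(\<Union>k::nat. A \<inter> ball 0 (real k)) = A"
    proof -
      have "\<exists>k::nat. x \<in> ball 0 k" for x :: 'a
        using reals_Archimedean2[of "norm x"] by simp
      then show ?thesis by blast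
    qed
    moreover have "A \<inter> ball 0 (real k) \<in> sigma_sets UNIV {A. A \<in> sets borel \<and> bounded A}" for k
      using A by (intro sigma_sets.Basic) (auto intro: bounded_Int)
    ultimately show "A \<in> sigma_sets UNIV {A. A \<in> sets borel \<and> bounded A}"
      using sigma_sets.Union[of "\<lambda>k::nat. A \<inter> ball 0 (real k)"] by metis
  qed
qed

lemma UNION_ball_nat: "(\<Union>k::nat. ball (0 :: 'a::real_normed_vector) (real k)) = UNIV"
proof -
  have "\<exists>k::nat. x \<in> ball 0 (real k)" for x :: 'a
    using reals_Archimedean2[of "norm x"] by simp
  then show ?thesis by blast
qed

lemma Sigma_UN_image: "(\<Union>i. A i \<times> B) = (\<Union>i. A i) \<times> B"
  by auto

lemma whole_in_void_sets: "{\<phi>. loc_finite \<phi>} \<in> void_sets"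
  unfolding void_sets_def by (intro CollectI exI[of _ "{}"]) simp

text \<open>Both factors have generators that contain a countable cover of the space (balls, and the
  whole space as the void event of the empty set), so the rectangles of generators generate the
  product.\<close>

lemma sets_mecke:
  "sets ((borel :: 'a::euclidean_space measure) \<Otimes>\<^sub>M config_space) =
    sigma_sets (UNIV \<times> {\<phi>. loc_finite \<phi>}) mecke_rectangles"
proof -
  have "sets ((borel :: 'a measure) \<Otimes>\<^sub>M config_space) =
    sets (sigma (space borel \<times> space config_space)
      {a \<times> b | a b. a \<in> {A. A \<in> sets borel \<and> bounded A} \<and> b \<in> void_sets})"
    using UNION_ball_nat[where 'a = 'a]
    by (intro sets_pair_eq[where Ca = "range (\<lambda>k::nat. ball (0::'a) (real k))" and Cb = "{{\<phi>. loc_finite \<phi>}}"])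
      (auto simp: sets_config whole_in_void_sets bounded_borel_generates[symmetric], auto simp: void_sets_def)
  also have "\<dots> = sigma_sets (UNIV \<times> {\<phi>. loc_finite \<phi>}) mecke_rectangles"
    unfolding mecke_rectangles_def[symmetric]
    by (subst sets_measure_of) (auto simp: mecke_rectangles_def void_sets_def)
  finally show ?thesis .
qed

context poisson_process
begin

text \<open>With a, c, d the areas of \<open>A - B\<close>, \<open>A \<inter> B\<close>,
  \<open>B - A\<close>, independence yields n a exp(- n (c + d)) + n c exp(- n c) exp(- n d). This
  is n (a + c) exp(- n (c + d)), and a + c and c + d are the areas of \<open>A\<close> and
  \<open>B\<close>.\<close>

lemma mecke_rectangle:
  assumes A: "A \<in> sets borel" "bounded A" and B: "B \<in> sets borel" "bounded B"
  shows "(\<integral>\<^sup>+\<omega>. (\<integral>\<^sup>+x. indicator A x * indicator {\<psi>. \<psi> \<inter> B = {}} (X \<omega> - {x}) \<partial>count_space (X \<omega>)) \<partial>M) =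
    ennreal n * emeasure lborel A * emeasure M {\<omega> \<in> space M. X \<omega> \<inter> B = {}}"
proof -
  have bor: "A - B \<in> sets borel" "A \<inter> B \<in> sets borel" "B - A \<in> sets borel"
    using A B by auto
  have bnd: "bounded (A - B)" "bounded (A \<inter> B)" "bounded (B - A)"
    using A B by (auto intro: bounded_subset)
  have cm: "(\<lambda>\<omega>. h (card (X \<omega> \<inter> C))) \<in> borel_measurable M"
    if "C \<in> sets borel" "bounded C" for C and h :: "nat \<Rightarrow> ennreal"
    by (rule measurable_compose[OF count_measurable[OF that]]) simp
  have fin: "emeasure lborel C < \<infinity>" if "bounded C" for C :: "(real^2) set"
    using that by (rule emeasure_bounded_finite)
  have ind: "(\<integral>\<^sup>+\<omega>. indicator {k} (card (X \<omega> \<inter> C)) \<partial>M) =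
      ennreal ((n * measure lborel C) ^ k / fact k * exp (- (n * measure lborel C)))"
    if C: "C \<in> sets borel" "bounded C" for C k
  proof -
    note [measurable] = count_measurable[OF C]
    have "(\<integral>\<^sup>+\<omega>. indicator {k} (card (X \<omega> \<inter> C)) \<partial>M) =
        (\<integral>\<^sup>+\<omega>. indicator {\<omega> \<in> space M. card (X \<omega> \<inter> C) = k} \<omega> \<partial>M)"
      by (intro nn_integral_cong) (simp add: indicator_def)
    then show ?thesis
      by (simp add: emeasure_eq_measure prob_count[OF C])
  qed
  let ?a = "measure lborel (A - B)" and ?b = "measure lborel B"
    and ?c = "measure lborel (A \<inter> B)" and ?d = "measure lborel (B - A)"
  have meas: "measure lborel A = ?a + ?c" "?b = ?c + ?d"
  proof -
    have "measure lborel ((A - B) \<union> A \<inter> B) = ?a + ?c" "measure lborel (A \<inter> B \<union> (B - A)) = ?c + ?d"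
      by (rule measure_Union; use bor fin[OF bnd(1)] fin[OF bnd(2)] fin[OF bnd(3)] in \<open>simp add: less_top[symmetric]\<close>; blast)+
    moreover have "(A - B) \<union> A \<inter> B = A" "A \<inter> B \<union> (B - A) = B" by blast+
    ultimately show "measure lborel A = ?a + ?c" "?b = ?c + ?d" by simp_all
  qed
  have "(\<integral>\<^sup>+\<omega>. (\<integral>\<^sup>+x. indicator A x * indicator {\<psi>. \<psi> \<inter> B = {}} (X \<omega> - {x}) \<partial>count_space (X \<omega>)) \<partial>M) =
    (\<integral>\<^sup>+\<omega>. of_nat (card (X \<omega> \<inter> (A - B))) * indicator {0} (card (X \<omega> \<inter> B))
      + indicator {1} (card (X \<omega> \<inter> (A \<inter> B))) * indicator {0} (card (X \<omega> \<inter> (B - A))) \<partial>M)"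
    by (intro nn_integral_cong nn_count_Diff_void finite_X_Int A B)
  also have "\<dots> = (\<integral>\<^sup>+\<omega>. of_nat (card (X \<omega> \<inter> (A - B))) * indicator {0} (card (X \<omega> \<inter> B)) \<partial>M)
      + (\<integral>\<^sup>+\<omega>. indicator {1} (card (X \<omega> \<inter> (A \<inter> B))) * indicator {0} (card (X \<omega> \<inter> (B - A))) \<partial>M)"
    by (intro nn_integral_add borel_measurable_times_ennreal cm bor bnd B)
  also have "(\<integral>\<^sup>+\<omega>. of_nat (card (X \<omega> \<inter> (A - B))) * indicator {0} (card (X \<omega> \<inter> B)) \<partial>M) =
      ennreal (n * ?a) * ennreal (exp (- (n * ?b)))"
  proof -
    have "(A - B) \<inter> B = {}" by blast
    from nn_integral_counts_indep[OF bor(1) bnd(1) B this, of of_nat "indicator {0}"]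
    show ?thesis
      unfolding expected_count[OF bor(1) bnd(1)] ind[OF B] by simp
  qed
  also have "(\<integral>\<^sup>+\<omega>. indicator {1} (card (X \<omega> \<inter> (A \<inter> B))) * indicator {0} (card (X \<omega> \<inter> (B - A))) \<partial>M) =
      ennreal (n * ?c * exp (- (n * ?c))) * ennreal (exp (- (n * ?d)))"
  proof -
    have "A \<inter> B \<inter> (B - A) = {}" by blast
    from nn_integral_counts_indep[OF bor(2) bnd(2) bor(3) bnd(3) this, of "indicator {1}" "indicator {0}"]
    show ?thesis
      by (simp add: ind[OF bor(2) bnd(2)] ind[OF bor(3) bnd(3)])
  qed
  also have "ennreal (n * ?a) * ennreal (exp (- (n * ?b))) + ennreal (n * ?c * exp (- (n * ?c))) * ennreal (exp (- (n * ?d)))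
     = ennreal (n * measure lborel A * exp (- (n * ?b)))"
  proof -
    have "- (n * ?b) = - (n * ?c) + - (n * ?d)"
      by (simp only: meas(2) distrib_left minus_add_distrib)
    then have e: "exp (- (n * ?b)) = exp (- (n * ?c)) * exp (- (n * ?d))"
      by (simp only: exp_add)
    have "n * measure lborel A * exp (- (n * ?b)) = n * ?a * exp (- (n * ?b)) + n * ?c * exp (- (n * ?c)) * exp (- (n * ?d))"
      unfolding e meas(1) by (simp only: distrib_left distrib_right mult.assoc)
    moreover have "ennreal (n * ?a) * ennreal (exp (- (n * ?b))) + ennreal (n * ?c * exp (- (n * ?c))) * ennreal (exp (- (n * ?d)))
      = ennreal (n * ?a * exp (- (n * ?b)) + n * ?c * exp (- (n * ?c)) * exp (- (n * ?d)))"
      using intensity_pos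
      by (subst ennreal_plus) (simp_all only: ennreal_mult' [symmetric] exp_ge_zero mult_nonneg_nonneg less_imp_le measure_nonneg)
    ultimately show ?thesis by simp
  qed
  also have "\<dots> = ennreal n * emeasure lborel A * emeasure M {\<omega> \<in> space M. X \<omega> \<inter> B = {}}"
  proof -
    have "emeasure lborel A = ennreal (measure lborel A)"
      using fin[OF A(2)] by (intro emeasure_eq_ennreal_measure) simp
    then show ?thesis
      using intensity_pos by (simp only: emeasure_void[OF B]) (simp add: ennreal_mult)
  qed
  finally show ?thesis .
qed

text \<open>\<open>\<mu>\<close> is the reduced Campbell measure, \<open>\<nu>\<close> the product
  of the intensity measure and the law of \<open>X\<close>. They agree on the rectangles, a
  pi-system with an exhausting sequence of finite measure, hence everywhere.\<close>

theorem mecke: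
  assumes [measurable]: "g \<in> borel_measurable (borel \<Otimes>\<^sub>M config_space)"
  shows "(\<integral>\<^sup>+\<omega>. (\<integral>\<^sup>+x. g (x, X \<omega> - {x}) \<partial>count_space (X \<omega>)) \<partial>M) =
    ennreal n * (\<integral>\<^sup>+x. (\<integral>\<^sup>+\<omega>. g (x, X \<omega>) \<partial>M) \<partial>lborel)"
proof -
  let ?P = "borel \<Otimes>\<^sub>M config_space :: ((real^2) \<times> (real^2) set) measure"
  \<comment> \<open>The sum over the points is an integral over indices: counting measure on the
    naturals, restricted to fresh indices, is pushed forward by the map to the pair of selected
    point and remaining configuration.\<close>
  define \<mu> where "\<mu> = distr (density (M \<Otimes>\<^sub>M count_space UNIV) (\<lambda>z. if fresh (snd z) (X (fst z)) then 1 else 0))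
    ?P (\<lambda>z. (single_pt (snd z) (X (fst z)), X (fst z) - sep_base (snd z)))"
  define \<nu> where "\<nu> = density ((lborel :: (real^2) measure) \<Otimes>\<^sub>M distr M config_space X) (\<lambda>_. ennreal n)"
  interpret D: prob_space "distr M config_space X"
    by (rule prob_space_distr) measurable
  interpret C: sigma_finite_measure "count_space (UNIV :: nat set)"
    by (rule sigma_finite_measure_count_space)
  have m1 [measurable]: "(\<lambda>z. single_pt (snd z) (X (fst z))) \<in> borel_measurable (M \<Otimes>\<^sub>M count_space UNIV)"
    by (rule measurable_compose_countable'[where g = snd and I = UNIV]) auto
  have m2 [measurable]: "(\<lambda>z. X (fst z) - sep_base (snd z)) \<in> measurable (M \<Otimes>\<^sub>M count_space UNIV) config_space"
    by (rule measurable_compose_countable'[where g = snd and I = UNIV]) auto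
  have m3 [measurable]: "(\<lambda>z. if fresh (snd z) (X (fst z)) then 1 else 0 :: ennreal) \<in> borel_measurable (M \<Otimes>\<^sub>M count_space UNIV)"
    by (rule measurable_compose_countable'[where g = snd and I = UNIV]) auto
  have int_mu: "(\<integral>\<^sup>+z. f z \<partial>\<mu>) = (\<integral>\<^sup>+\<omega>. (\<integral>\<^sup>+x. f (x, X \<omega> - {x}) \<partial>count_space (X \<omega>)) \<partial>M)"
    if [measurable]: "f \<in> borel_measurable ?P" for f
  proof -
    have "(\<integral>\<^sup>+z. f z \<partial>\<mu>) = (\<integral>\<^sup>+z. (if fresh (snd z) (X (fst z)) then 1 else 0) *
        f (single_pt (snd z) (X (fst z)), X (fst z) - sep_base (snd z)) \<partial>(M \<Otimes>\<^sub>M count_space UNIV))"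
      unfolding \<mu>_def by (subst nn_integral_distr, measurable, subst nn_integral_density) simp_all
    also have "\<dots> = (\<integral>\<^sup>+\<omega>. \<integral>\<^sup>+i. (if fresh i (X \<omega>) then 1 else 0) *
        f (single_pt i (X \<omega>), X \<omega> - sep_base i) \<partial>count_space UNIV \<partial>M)"
      by (subst C.nn_integral_fst[symmetric]) (simp_all, measurable)
    also have "\<dots> = (\<integral>\<^sup>+\<omega>. (\<integral>\<^sup>+x. f (x, X \<omega> - {x}) \<partial>count_space (X \<omega>)) \<partial>M)"
    proof (rule nn_integral_cong)
      fix \<omega> assume "\<omega> \<in> space M"
      show "(\<integral>\<^sup>+i. (if fresh i (X \<omega>) then 1 else 0) * f (single_pt i (X \<omega>), X \<omega> - sep_base i) \<partial>count_space UNIV) =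
          (\<integral>\<^sup>+x. f (x, X \<omega> - {x}) \<partial>count_space (X \<omega>))"
        unfolding nn_sum_config[OF loc_finite_X[OF \<open>\<omega> \<in> space M\<close>]] nn_integral_count_space_nat
        by (rule suminf_cong) (simp add: fresh_Diff)
    qed
    finally show ?thesis .
  qed
  have int_nu: "(\<integral>\<^sup>+z. f z \<partial>\<nu>) = ennreal n * (\<integral>\<^sup>+x. (\<integral>\<^sup>+\<omega>. f (x, X \<omega>) \<partial>M) \<partial>lborel)"
    if [measurable]: "f \<in> borel_measurable ?P" for f
  proof -
    have "(\<integral>\<^sup>+z. f z \<partial>\<nu>) = ennreal n * (\<integral>\<^sup>+z. f z \<partial>(lborel \<Otimes>\<^sub>M distr M config_space X))"
      unfolding \<nu>_def by (subst nn_integral_density) (simp_all add: nn_integral_cmult)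
    also have "(\<integral>\<^sup>+z. f z \<partial>(lborel \<Otimes>\<^sub>M distr M config_space X)) =
        (\<integral>\<^sup>+x. (\<integral>\<^sup>+\<phi>. f (x, \<phi>) \<partial>distr M config_space X) \<partial>lborel)"
      by (rule D.nn_integral_fst[symmetric]) simp
    also have "\<dots> = (\<integral>\<^sup>+x. (\<integral>\<^sup>+\<omega>. f (x, X \<omega>) \<partial>M) \<partial>lborel)"
      by (intro nn_integral_cong nn_integral_distr) simp_all
    finally show ?thesis .
  qed
  have rect: "emeasure \<mu> (A \<times> {\<phi>. loc_finite \<phi> \<and> \<phi> \<inter> B = {}}) =
      ennreal n * emeasure lborel A * emeasure M {\<omega> \<in> space M. X \<omega> \<inter> B = {}}"
    "emeasure \<nu> (A \<times> {\<phi>. loc_finite \<phi> \<and> \<phi> \<inter> B = {}}) =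
      ennreal n * emeasure lborel A * emeasure M {\<omega> \<in> space M. X \<omega> \<inter> B = {}}"
    if A: "A \<in> sets borel" "bounded A" and B: "B \<in> sets borel" "bounded B" for A B :: "(real^2) set"
  proof -
    let ?R = "A \<times> {\<phi>. loc_finite \<phi> \<and> \<phi> \<inter> B = {}}"
    have R: "?R \<in> sets ?P"
      using A pred_void[OF B(1)] by (intro pair_measureI) (simp_all add: pred_def)
    have ind: "indicator ?R (x, \<phi>) = (indicator A x * indicator {\<psi>. \<psi> \<inter> B = {}} \<phi> :: ennreal)"
      if "loc_finite \<phi>" for x \<phi>
      using that by (simp add: indicator_def)
    have "emeasure \<mu> ?R = (\<integral>\<^sup>+z. indicator ?R z \<partial>\<mu>)"
      using R by (subst nn_integral_indicator) (simp_all add: \<mu>_def)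
    also have "\<dots> = (\<integral>\<^sup>+\<omega>. (\<integral>\<^sup>+x. indicator ?R (x, X \<omega> - {x}) \<partial>count_space (X \<omega>)) \<partial>M)"
      using R by (intro int_mu) simp
    also have "\<dots> = (\<integral>\<^sup>+\<omega>. (\<integral>\<^sup>+x. indicator A x * indicator {\<psi>. \<psi> \<inter> B = {}} (X \<omega> - {x}) \<partial>count_space (X \<omega>)) \<partial>M)"
      by (intro nn_integral_cong ind loc_finite_Diff loc_finite_X)
    finally show "emeasure \<mu> ?R = ennreal n * emeasure lborel A * emeasure M {\<omega> \<in> space M. X \<omega> \<inter> B = {}}"
      unfolding mecke_rectangle[OF A B] .
    have "emeasure \<nu> ?R = (\<integral>\<^sup>+z. indicator ?R z \<partial>\<nu>)"
      using R by (subst nn_integral_indicator) (simp_all add: \<nu>_def)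
    also have "\<dots> = ennreal n * (\<integral>\<^sup>+x. (\<integral>\<^sup>+\<omega>. indicator ?R (x, X \<omega>) \<partial>M) \<partial>lborel)"
      using R by (intro int_nu) simp
    also have "\<dots> = ennreal n * (\<integral>\<^sup>+x. indicator A x * emeasure M {\<omega> \<in> space M. X \<omega> \<inter> B = {}} \<partial>lborel)"
    proof -
      have void: "{\<omega> \<in> space M. X \<omega> \<inter> B = {}} \<in> sets M"
        using measurable_compose[OF X_measurable pred_void[OF B(1)]] by (simp add: pred_def)
      have "(\<integral>\<^sup>+\<omega>. indicator ?R (x, X \<omega>) \<partial>M) = indicator A x * emeasure M {\<omega> \<in> space M. X \<omega> \<inter> B = {}}" for x
      proof -
        have "(\<integral>\<^sup>+\<omega>. indicator ?R (x, X \<omega>) \<partial>M) =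
            (\<integral>\<^sup>+\<omega>. indicator A x * indicator {\<omega> \<in> space M. X \<omega> \<inter> B = {}} \<omega> \<partial>M)"
          by (rule nn_integral_cong) (simp add: ind loc_finite_X indicator_def)
        then show ?thesis
          using void by (simp add: nn_integral_cmult_indicator)
      qed
      then show ?thesis by simp
    qed
    finally show "emeasure \<nu> ?R = ennreal n * emeasure lborel A * emeasure M {\<omega> \<in> space M. X \<omega> \<inter> B = {}}"
      using A by (simp add: nn_integral_multc mult.assoc)
  qed
  have "\<mu> = \<nu>"
  proof (rule measure_eqI_generator_eq[OF Int_stable_mecke_rectangles])
    show "mecke_rectangles \<subseteq> Pow (UNIV \<times> {\<phi> :: (real^2) set. loc_finite \<phi>})"
      by (auto simp: mecke_rectangles_def void_sets_def)
    show "emeasure \<mu> R = emeasure \<nu> R" if "R \<in> mecke_rectangles" for R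
    proof -
      from that obtain A V where A: "R = A \<times> V" "A \<in> sets borel" "bounded A" and V: "V \<in> void_sets"
        by (auto simp: mecke_rectangles_def)
      obtain B where "V = {\<phi>. loc_finite \<phi> \<and> \<phi> \<inter> B = {}}" "B \<in> sets borel" "bounded B"
        using V by (auto simp: void_sets_def)
      with A show ?thesis by (simp only: rect)
    qed
    show "sets \<mu> = sigma_sets (UNIV \<times> {\<phi>. loc_finite \<phi>}) mecke_rectangles"
      by (simp add: \<mu>_def sets_mecke)
    have "sets \<nu> = sets ?P"
      unfolding \<nu>_def sets_density by (rule sets_pair_measure_cong) simp_all
    then show "sets \<nu> = sigma_sets (UNIV \<times> {\<phi>. loc_finite \<phi>}) mecke_rectangles"
      by (simp add: sets_mecke)
    let ?Q = "\<lambda>k::nat. ball (0::real^2) (real k) \<times> {\<phi>. loc_finite \<phi>}"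
    show "range ?Q \<subseteq> mecke_rectangles"
    proof (rule image_subsetI)
      have "ball (0::real^2) (real k) \<in> {A. A \<in> sets borel \<and> bounded A}" for k
        by simp
      then show "?Q k \<in> mecke_rectangles" for k
        unfolding mecke_rectangles_def using whole_in_void_sets[where 'a = "real^2"]
        by (intro CollectI exI[of _ "ball 0 (real k)"] exI[of _ "{\<phi>. loc_finite \<phi>}"] conjI refl)
          (assumption | rule open_ball[THEN borel_open] bounded_ball)+
    qed
    show "(\<Union>k. ?Q k) = UNIV \<times> {\<phi>. loc_finite \<phi>}"
    proof -
      have "(\<Union>k. ?Q k) = (\<Union>k::nat. ball (0::real^2) (real k)) \<times> {\<phi>. loc_finite \<phi>}"
        by (rule Sigma_UN_image)
      then show ?thesis unfolding UNION_ball_nat .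
    qed
    show "emeasure \<mu> (?Q k) \<noteq> \<infinity>" for k
    proof -
      \<comment> \<open>The empty test set makes the void condition vacuous, so the rectangle
        formula gives the mass of the whole slice.\<close>
      have "emeasure \<mu> (?Q k) = ennreal n * emeasure lborel (ball (0::real^2) (real k)) * emeasure M {\<omega> \<in> space M. X \<omega> \<inter> {} = {}}"
        using rect(1)[of "ball 0 (real k)" "{}"] by simp
      moreover have "emeasure lborel (ball (0::real^2) (real k)) < \<infinity>"
        by (rule emeasure_bounded_finite) simp
      ultimately show ?thesis
        by (auto simp: ennreal_mult_eq_top_iff emeasure_eq_measure)
    qed
  qed
  with int_mu[OF assms] int_nu[OF assms] show ?thesis by simp
qed

end

section \<open>Sums over tuples with an empty ball\<close>

lemma nn_integral_count_space_Times:
  fixes f :: "'a \<times> 'b \<Rightarrow> ennreal"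
  shows "(\<integral>\<^sup>+z. f z \<partial>count_space (A \<times> B)) = (\<integral>\<^sup>+x. (\<integral>\<^sup>+y. f (x, y) \<partial>count_space B) \<partial>count_space A)"
proof -
  have "(\<integral>\<^sup>+z. f z \<partial>count_space (A \<times> B)) = (\<integral>\<^sup>+z. f z * indicator (A \<times> B) z \<partial>count_space UNIV)"
    by (rule nn_integral_count_space_indicator) simp
  also have "\<dots> = (\<integral>\<^sup>+x. (\<integral>\<^sup>+y. f (x, y) * indicator (A \<times> B) (x, y) \<partial>count_space UNIV) \<partial>count_space UNIV)"
    by (rule nn_integral_fst_count_space[symmetric])
  also have "\<dots> = (\<integral>\<^sup>+x. (\<integral>\<^sup>+y. f (x, y) * indicator B y \<partial>count_space UNIV) * indicator A x \<partial>count_space UNIV)"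
    by (intro nn_integral_cong) (simp add: indicator_def)
  also have "\<dots> = (\<integral>\<^sup>+x. (\<integral>\<^sup>+y. f (x, y) * indicator B y \<partial>count_space UNIV) \<partial>count_space A)"
    by (rule nn_integral_count_space_indicator[symmetric]) simp
  also have "\<dots> = (\<integral>\<^sup>+x. (\<integral>\<^sup>+y. f (x, y) \<partial>count_space B) \<partial>count_space A)"
    by (intro nn_integral_cong nn_integral_count_space_indicator[symmetric]) simp
  finally show ?thesis .
qed

lemma nn_integral_count_space_remove:
  assumes "f x = (0::ennreal)"
  shows "(\<integral>\<^sup>+y. f y \<partial>count_space A) = (\<integral>\<^sup>+y. f y \<partial>count_space (A - {x}))"
  by (rule nn_integral_count_space_eq) (use assms in auto)

text \<open>\<open>pred_void\<close> treats a fixed set, but circumscribed disks move with their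
  vertices. A moving ball is empty iff the number of points in it vanishes, and this number is a
  measurable sum with the parameters of the ball as \<open>p\<close>.\<close>

lemma pred_void_ball:
  fixes c :: "'p \<Rightarrow> 'a::euclidean_space"
  assumes [measurable]: "c \<in> borel_measurable P" "r \<in> borel_measurable P"
  shows "Measurable.pred (P \<Otimes>\<^sub>M config_space) (\<lambda>q. snd q \<inter> ball (c (fst q)) (r (fst q)) = {})"
proof -
  let ?g = "\<lambda>q::'p \<times> 'a \<times> 'a set. if dist (c (fst q)) (fst (snd q)) < r (fst q) then 1 else 0 :: ennreal"
  have "?g \<in> borel_measurable (P \<Otimes>\<^sub>M borel \<Otimes>\<^sub>M config_space)"
    by measurable
  from measurable_nn_sum_config[OF this]
  have m: "Measurable.pred (P \<Otimes>\<^sub>M config_space) (\<lambda>q. (case q of (p, \<phi>) \<Rightarrow> \<integral>\<^sup>+y. ?g (p, y, \<phi> - {y}) \<partial>count_space \<phi>) = 0)"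
    by measurable
  have eq: "snd q \<inter> ball (c (fst q)) (r (fst q)) = {} \<longleftrightarrow>
      (case q of (p, \<phi>) \<Rightarrow> \<integral>\<^sup>+y. ?g (p, y, \<phi> - {y}) \<partial>count_space \<phi>) = 0" for q
    by (cases q) (auto simp: nn_integral_0_iff_AE AE_count_space disjoint_iff)
  show ?thesis unfolding eq by (rule m)
qed

context poisson_process
begin

lemma mecke2:
  assumes [measurable]: "g \<in> borel_measurable (borel \<Otimes>\<^sub>M borel \<Otimes>\<^sub>M config_space)"
  shows "(\<integral>\<^sup>+\<omega>. (\<integral>\<^sup>+x. (\<integral>\<^sup>+y. g (x, y, X \<omega> - {x} - {y}) \<partial>count_space (X \<omega> - {x})) \<partial>count_space (X \<omega>)) \<partial>M) =
    ennreal n ^ 2 * (\<integral>\<^sup>+x. (\<integral>\<^sup>+y. (\<integral>\<^sup>+\<omega>. g (x, y, X \<omega>) \<partial>M) \<partial>lborel) \<partial>lborel)"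
proof -
  define G where "G = (\<lambda>(x, \<phi>). \<integral>\<^sup>+y. g (x, y, \<phi> - {y}) \<partial>count_space \<phi>)"
  have G: "G \<in> borel_measurable (borel \<Otimes>\<^sub>M config_space)"
    unfolding G_def by (rule measurable_nn_sum_config[OF assms])
  have "(\<integral>\<^sup>+\<omega>. (\<integral>\<^sup>+x. G (x, X \<omega> - {x}) \<partial>count_space (X \<omega>)) \<partial>M) = ennreal n * (\<integral>\<^sup>+x. (\<integral>\<^sup>+\<omega>. G (x, X \<omega>) \<partial>M) \<partial>lborel)"
    by (rule mecke[OF G])
  also have "(\<integral>\<^sup>+x. (\<integral>\<^sup>+\<omega>. G (x, X \<omega>) \<partial>M) \<partial>lborel) =
      (\<integral>\<^sup>+x. ennreal n * (\<integral>\<^sup>+y. (\<integral>\<^sup>+\<omega>. g (x, y, X \<omega>) \<partial>M) \<partial>lborel) \<partial>lborel)"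
  proof (rule nn_integral_cong)
    fix x :: "real^2"
    have "(\<lambda>q. g (x, q)) \<in> borel_measurable (borel \<Otimes>\<^sub>M config_space)"
      by measurable
    from mecke[OF this] show "(\<integral>\<^sup>+\<omega>. G (x, X \<omega>) \<partial>M) = ennreal n * (\<integral>\<^sup>+y. (\<integral>\<^sup>+\<omega>. g (x, y, X \<omega>) \<partial>M) \<partial>lborel)"
      by (simp add: G_def)
  qed
  also have "\<dots> = ennreal n * (\<integral>\<^sup>+x. (\<integral>\<^sup>+y. (\<integral>\<^sup>+\<omega>. g (x, y, X \<omega>) \<partial>M) \<partial>lborel) \<partial>lborel)"
    by (rule nn_integral_cmult) measurable
  finally show ?thesis
    by (simp add: G_def power2_eq_square mult.assoc)
qed

text \<open>\<open>mecke2\<close> is applied to the sum over the third point, seen as a function of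
  the first two and of the remaining configuration; one more use of \<open>mecke\<close> resolves
  that sum.\<close>

lemma mecke3:
  assumes [measurable]: "g \<in> borel_measurable (borel \<Otimes>\<^sub>M borel \<Otimes>\<^sub>M borel \<Otimes>\<^sub>M config_space)"
  shows "(\<integral>\<^sup>+\<omega>. (\<integral>\<^sup>+x. (\<integral>\<^sup>+y. (\<integral>\<^sup>+z. g (x, y, z, X \<omega> - {x} - {y} - {z})
      \<partial>count_space (X \<omega> - {x} - {y})) \<partial>count_space (X \<omega> - {x})) \<partial>count_space (X \<omega>)) \<partial>M) =
    ennreal n ^ 3 * (\<integral>\<^sup>+x. (\<integral>\<^sup>+y. (\<integral>\<^sup>+z. (\<integral>\<^sup>+\<omega>. g (x, y, z, X \<omega>) \<partial>M) \<partial>lborel) \<partial>lborel) \<partial>lborel)"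
proof -
  define G where "G = (\<lambda>(p, \<phi>). \<integral>\<^sup>+z. (\<lambda>q. g (fst (fst q), snd (fst q), snd q)) (p, z, \<phi> - {z}) \<partial>count_space \<phi>)"
  have G [measurable]: "G \<in> borel_measurable ((borel \<Otimes>\<^sub>M borel) \<Otimes>\<^sub>M config_space)"
    unfolding G_def by (rule measurable_nn_sum_config) measurable
  have "(\<lambda>q. G ((fst q, fst (snd q)), snd (snd q))) \<in> borel_measurable (borel \<Otimes>\<^sub>M borel \<Otimes>\<^sub>M config_space)"
    by measurable
  from mecke2[OF this]
  have "(\<integral>\<^sup>+\<omega>. (\<integral>\<^sup>+x. (\<integral>\<^sup>+y. G ((x, y), X \<omega> - {x} - {y}) \<partial>count_space (X \<omega> - {x})) \<partial>count_space (X \<omega>)) \<partial>M) =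
    ennreal n ^ 2 * (\<integral>\<^sup>+x. (\<integral>\<^sup>+y. (\<integral>\<^sup>+\<omega>. G ((x, y), X \<omega>) \<partial>M) \<partial>lborel) \<partial>lborel)"
    by simp
  also have "(\<integral>\<^sup>+x. (\<integral>\<^sup>+y. (\<integral>\<^sup>+\<omega>. G ((x, y), X \<omega>) \<partial>M) \<partial>lborel) \<partial>lborel) =
      (\<integral>\<^sup>+x. (\<integral>\<^sup>+y. ennreal n * (\<integral>\<^sup>+z. (\<integral>\<^sup>+\<omega>. g (x, y, z, X \<omega>) \<partial>M) \<partial>lborel) \<partial>lborel) \<partial>lborel)"
  proof (intro nn_integral_cong)
    fix x y :: "real^2"
    have "(\<lambda>q. g (x, y, q)) \<in> borel_measurable (borel \<Otimes>\<^sub>M config_space)"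
      by measurable
    from mecke[OF this] show "(\<integral>\<^sup>+\<omega>. G ((x, y), X \<omega>) \<partial>M) = ennreal n * (\<integral>\<^sup>+z. (\<integral>\<^sup>+\<omega>. g (x, y, z, X \<omega>) \<partial>M) \<partial>lborel)"
      by (simp add: G_def)
  qed
  also have "\<dots> = (\<integral>\<^sup>+x. ennreal n * (\<integral>\<^sup>+y. (\<integral>\<^sup>+z. (\<integral>\<^sup>+\<omega>. g (x, y, z, X \<omega>) \<partial>M) \<partial>lborel) \<partial>lborel) \<partial>lborel)"
    by (intro nn_integral_cong nn_integral_cmult) measurable
  also have "\<dots> = ennreal n * (\<integral>\<^sup>+x. (\<integral>\<^sup>+y. (\<integral>\<^sup>+z. (\<integral>\<^sup>+\<omega>. g (x, y, z, X \<omega>) \<partial>M) \<partial>lborel) \<partial>lborel) \<partial>lborel)"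
    by (rule nn_integral_cmult) measurable
  finally show ?thesis
    by (simp add: G_def power2_eq_square power3_eq_cube mult.assoc)
qed

lemma emeasure_void_ball:
  assumes "r \<ge> 0"
  shows "emeasure M {\<omega> \<in> space M. X \<omega> \<inter> ball c r = {}} = ennreal (exp (- (n * pi * r\<^sup>2)))"
  using assms by (simp add: emeasure_void content_ball unit_ball_vol_2 mult.assoc)

lemma nn_integral_void_ball:
  assumes "r \<ge> 0"
  shows "(\<integral>\<^sup>+\<omega>. (if X \<omega> \<inter> ball c r = {} then a else 0) \<partial>M) = a * ennreal (exp (- (n * pi * r\<^sup>2)))"
proof -
  have "{\<omega> \<in> space M. X \<omega> \<inter> ball c r = {}} \<in> sets M"
    using measurable_compose[OF X_measurable pred_void[of "ball c r"]] by (simp add: pred_def)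
  moreover have "(\<integral>\<^sup>+\<omega>. (if X \<omega> \<inter> ball c r = {} then a else 0) \<partial>M) =
      (\<integral>\<^sup>+\<omega>. a * indicator {\<omega> \<in> space M. X \<omega> \<inter> ball c r = {}} \<omega> \<partial>M)"
    by (intro nn_integral_cong) (simp add: indicator_def)
  ultimately show ?thesis
    by (simp add: nn_integral_cmult_indicator emeasure_void_ball[OF assms])
qed

end

text \<open>The triples may have repeated entries; the weights used later vanish on degenerate
  triples.\<close>

definition empty_sum3 ::
    "('a::euclidean_space \<Rightarrow> 'a \<Rightarrow> 'a \<Rightarrow> ennreal) \<Rightarrow> ('a \<Rightarrow> 'a \<Rightarrow> 'a \<Rightarrow> 'a) \<Rightarrow> ('a \<Rightarrow> 'a \<Rightarrow> 'a \<Rightarrow> real) \<Rightarrow> 'a set \<Rightarrow> ennreal" where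
  "empty_sum3 f c r \<phi> = (\<integral>\<^sup>+(x, y, z). (if \<phi> \<inter> ball (c x y z) (r x y z) = {} then f x y z else 0) \<partial>count_space (\<phi> \<times> \<phi> \<times> \<phi>))"

definition empty_sum2 ::
    "('a::euclidean_space \<Rightarrow> 'a \<Rightarrow> ennreal) \<Rightarrow> ('a \<Rightarrow> 'a \<Rightarrow> 'a) \<Rightarrow> ('a \<Rightarrow> 'a \<Rightarrow> real) \<Rightarrow> 'a set \<Rightarrow> ennreal" where
  "empty_sum2 f c r \<phi> = (\<integral>\<^sup>+(x, y). (if \<phi> \<inter> ball (c x y) (r x y) = {} then f x y else 0) \<partial>count_space (\<phi> \<times> \<phi>))"

definition empty_sum1 ::
    "('a::euclidean_space \<Rightarrow> ennreal) \<Rightarrow> ('a \<Rightarrow> 'a) \<Rightarrow> ('a \<Rightarrow> real) \<Rightarrow> 'a set \<Rightarrow> ennreal" where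
  "empty_sum1 f c r \<phi> = (\<integral>\<^sup>+x. (if \<phi> \<inter> ball (c x) (r x) = {} then f x else 0) \<partial>count_space \<phi>)"

text \<open>The vertices lie outside the open ball, so deleting them from the configuration does not
  affect its emptiness, and repeated entries have weight 0. This brings the sum into the form with
  successively removed points that the Mecke formula requires.\<close>

lemma empty_sum3_nested:
  assumes "\<And>x y z. f x y z \<noteq> 0 \<Longrightarrow> x \<noteq> y \<and> x \<noteq> z \<and> y \<noteq> z \<and>
    x \<notin> ball (c x y z) (r x y z) \<and> y \<notin> ball (c x y z) (r x y z) \<and> z \<notin> ball (c x y z) (r x y z)"
  shows "empty_sum3 f c r \<phi> = (\<integral>\<^sup>+x. (\<integral>\<^sup>+y. (\<integral>\<^sup>+z.
    (if (\<phi> - {x} - {y} - {z}) \<inter> ball (c x y z) (r x y z) = {} then f x y z else 0)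
      \<partial>count_space (\<phi> - {x} - {y})) \<partial>count_space (\<phi> - {x})) \<partial>count_space \<phi>)"
proof -
  have *: "f x x z = 0" "f x y x = 0" "f x y y = 0" for x y z
    using assms by blast+
  have **: "(if \<phi> \<inter> ball (c x y z) (r x y z) = {} then f x y z else 0) =
    (if (\<phi> - {x} - {y} - {z}) \<inter> ball (c x y z) (r x y z) = {} then f x y z else 0)" for x y z
  proof (cases "f x y z = 0")
    case False
    from assms[OF this] have "(\<phi> - {x} - {y} - {z}) \<inter> ball (c x y z) (r x y z) = \<phi> \<inter> ball (c x y z) (r x y z)"
      by blast
    then show ?thesis by simp
  qed simp
  let ?g = "\<lambda>x y z. if (\<phi> - {x} - {y} - {z}) \<inter> ball (c x y z) (r x y z) = {} then f x y z else 0"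
  have "empty_sum3 f c r \<phi> = (\<integral>\<^sup>+x. (\<integral>\<^sup>+y. (\<integral>\<^sup>+z. ?g x y z \<partial>count_space \<phi>) \<partial>count_space \<phi>) \<partial>count_space \<phi>)"
    unfolding empty_sum3_def nn_integral_count_space_Times prod.case ** ..
  also have "\<dots> = (\<integral>\<^sup>+x. (\<integral>\<^sup>+y. (\<integral>\<^sup>+z. ?g x y z \<partial>count_space \<phi>) \<partial>count_space (\<phi> - {x})) \<partial>count_space \<phi>)"
    by (intro nn_integral_cong nn_integral_count_space_remove) (simp add: * cong: if_cong)
  also have "\<dots> = (\<integral>\<^sup>+x. (\<integral>\<^sup>+y. (\<integral>\<^sup>+z. ?g x y z
      \<partial>count_space (\<phi> - {x} - {y})) \<partial>count_space (\<phi> - {x})) \<partial>count_space \<phi>)"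
  proof (intro nn_integral_cong)
    fix x y
    have "(\<integral>\<^sup>+z. ?g x y z \<partial>count_space \<phi>) = (\<integral>\<^sup>+z. ?g x y z \<partial>count_space (\<phi> - {x}))"
      by (rule nn_integral_count_space_remove) (simp add: * cong: if_cong)
    also have "\<dots> = (\<integral>\<^sup>+z. ?g x y z \<partial>count_space (\<phi> - {x} - {y}))"
      by (rule nn_integral_count_space_remove) (simp add: * cong: if_cong)
    finally show "(\<integral>\<^sup>+z. ?g x y z \<partial>count_space \<phi>) = (\<integral>\<^sup>+z. ?g x y z \<partial>count_space (\<phi> - {x} - {y}))" .
  qed
  finally show ?thesis .
qed

lemma empty_sum2_nested:
  assumes "\<And>x y. f x y \<noteq> 0 \<Longrightarrow> x \<noteq> y \<and> x \<notin> ball (c x y) (r x y) \<and> y \<notin> ball (c x y) (r x y)"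
  shows "empty_sum2 f c r \<phi> = (\<integral>\<^sup>+x. (\<integral>\<^sup>+y.
    (if (\<phi> - {x} - {y}) \<inter> ball (c x y) (r x y) = {} then f x y else 0)
      \<partial>count_space (\<phi> - {x})) \<partial>count_space \<phi>)"
proof -
  have *: "f x x = 0" for x
    using assms by blast
  have **: "(if \<phi> \<inter> ball (c x y) (r x y) = {} then f x y else 0) =
    (if (\<phi> - {x} - {y}) \<inter> ball (c x y) (r x y) = {} then f x y else 0)" for x y
  proof (cases "f x y = 0")
    case False
    from assms[OF this] have "(\<phi> - {x} - {y}) \<inter> ball (c x y) (r x y) = \<phi> \<inter> ball (c x y) (r x y)"
      by blast
    then show ?thesis by simp
  qed simp
  have "empty_sum2 f c r \<phi> = (\<integral>\<^sup>+x. (\<integral>\<^sup>+y.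
      (if (\<phi> - {x} - {y}) \<inter> ball (c x y) (r x y) = {} then f x y else 0) \<partial>count_space \<phi>) \<partial>count_space \<phi>)"
    unfolding empty_sum2_def nn_integral_count_space_Times prod.case ** ..
  also have "\<dots> = (\<integral>\<^sup>+x. (\<integral>\<^sup>+y.
      (if (\<phi> - {x} - {y}) \<inter> ball (c x y) (r x y) = {} then f x y else 0) \<partial>count_space (\<phi> - {x})) \<partial>count_space \<phi>)"
    by (intro nn_integral_cong nn_integral_count_space_remove) (simp add: * cong: if_cong)
  finally show ?thesis .
qed

lemma empty_sum1_nested:
  assumes "\<And>x. f x \<noteq> 0 \<Longrightarrow> x \<notin> ball (c x) (r x)"
  shows "empty_sum1 f c r \<phi> = (\<integral>\<^sup>+x. (if (\<phi> - {x}) \<inter> ball (c x) (r x) = {} then f x else 0) \<partial>count_space \<phi>)"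
  unfolding empty_sum1_def
proof (rule nn_integral_cong)
  show "(if \<phi> \<inter> ball (c x) (r x) = {} then f x else 0) = (if (\<phi> - {x}) \<inter> ball (c x) (r x) = {} then f x else 0)" for x
  proof (cases "f x = 0")
    case False
    from assms[OF this] have "(\<phi> - {x}) \<inter> ball (c x) (r x) = \<phi> \<inter> ball (c x) (r x)"
      by blast
    then show ?thesis by simp
  qed simp
qed

lemma measurable_void_if3:
  fixes f :: "'a::euclidean_space \<Rightarrow> 'a \<Rightarrow> 'a \<Rightarrow> ennreal"
  assumes [measurable]: "(\<lambda>(x, y, z). f x y z) \<in> borel_measurable (borel \<Otimes>\<^sub>M borel \<Otimes>\<^sub>M borel)"
    "(\<lambda>(x, y, z). c x y z) \<in> borel_measurable (borel \<Otimes>\<^sub>M borel \<Otimes>\<^sub>M borel)"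
    "(\<lambda>(x, y, z). r x y z) \<in> borel_measurable (borel \<Otimes>\<^sub>M borel \<Otimes>\<^sub>M borel)"
  shows "(\<lambda>(x, y, z, \<phi>). if \<phi> \<inter> ball (c x y z) (r x y z) = {} then f x y z else 0)
    \<in> borel_measurable (borel \<Otimes>\<^sub>M borel \<Otimes>\<^sub>M borel \<Otimes>\<^sub>M (config_space :: 'a set measure))"
proof -
  let ?c = "\<lambda>(x, y, z). c x y z" and ?r = "\<lambda>(x, y, z). r x y z"
  have [measurable]: "Measurable.pred ((borel \<Otimes>\<^sub>M borel \<Otimes>\<^sub>M borel) \<Otimes>\<^sub>M config_space)
      (\<lambda>q. snd q \<inter> ball (?c (fst q)) (?r (fst q)) = {})"
    by (rule pred_void_ball) measurable
  have "(\<lambda>q. (\<lambda>q. snd q \<inter> ball (?c (fst q)) (?r (fst q)) = {}) ((fst q, fst (snd q), fst (snd (snd q))), snd (snd (snd q))))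
      \<in> measurable (borel \<Otimes>\<^sub>M borel \<Otimes>\<^sub>M borel \<Otimes>\<^sub>M (config_space :: 'a set measure)) (count_space UNIV)"
    by measurable
  then have [measurable]: "Measurable.pred (borel \<Otimes>\<^sub>M borel \<Otimes>\<^sub>M borel \<Otimes>\<^sub>M (config_space :: 'a set measure))
      (\<lambda>(x, y, z, \<phi>). \<phi> \<inter> ball (c x y z) (r x y z) = {})"
    by (simp add: case_prod_beta')
  have "(\<lambda>q. if (\<lambda>(x, y, z, \<phi>). \<phi> \<inter> ball (c x y z) (r x y z) = {}) q
      then (\<lambda>(x, y, z). f x y z) (fst q, fst (snd q), fst (snd (snd q))) else 0)
    \<in> borel_measurable (borel \<Otimes>\<^sub>M borel \<Otimes>\<^sub>M borel \<Otimes>\<^sub>M (config_space :: 'a set measure))"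
    by measurable
  then show ?thesis
    by (simp add: case_prod_beta' cong: if_cong)
qed

lemma measurable_void_if2:
  fixes f :: "'a::euclidean_space \<Rightarrow> 'a \<Rightarrow> ennreal"
  assumes "(\<lambda>(x, y). f x y) \<in> borel_measurable (borel \<Otimes>\<^sub>M borel)"
    "(\<lambda>(x, y). c x y) \<in> borel_measurable (borel \<Otimes>\<^sub>M borel)"
    "(\<lambda>(x, y). r x y) \<in> borel_measurable (borel \<Otimes>\<^sub>M borel)"
  shows "(\<lambda>(x, y, \<phi>). if \<phi> \<inter> ball (c x y) (r x y) = {} then f x y else 0)
    \<in> borel_measurable (borel \<Otimes>\<^sub>M borel \<Otimes>\<^sub>M (config_space :: 'a set measure))"
proof -
  note [measurable] = assms(1)[unfolded case_prod_beta'] assms(2)[unfolded case_prod_beta'] assms(3)[unfolded case_prod_beta']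
  \<comment> \<open>A dummy first variable reduces the case of two points to that of three.\<close>
  have "(\<lambda>(x :: 'a, y, z, \<phi>). if \<phi> \<inter> ball (c y z) (r y z) = {} then f y z else 0)
      \<in> borel_measurable (borel \<Otimes>\<^sub>M borel \<Otimes>\<^sub>M borel \<Otimes>\<^sub>M (config_space :: 'a set measure))"
    by (rule measurable_void_if3[where f = "\<lambda>x y z. f y z" and c = "\<lambda>x y z. c y z" and r = "\<lambda>x y z. r y z"])
      (simp_all add: case_prod_beta')
  from measurable_compose[OF _ this, of "\<lambda>q. (0, q)" "borel \<Otimes>\<^sub>M borel \<Otimes>\<^sub>M config_space"] show ?thesis
    by simp
qed

lemma measurable_void_if1:
  fixes f :: "'a::euclidean_space \<Rightarrow> ennreal"
  assumes [measurable]: "f \<in> borel_measurable borel" "c \<in> borel_measurable borel" "r \<in> borel_measurable borel"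
  shows "(\<lambda>(x, \<phi>). if \<phi> \<inter> ball (c x) (r x) = {} then f x else 0)
    \<in> borel_measurable (borel \<Otimes>\<^sub>M (config_space :: 'a set measure))"
proof -
  have "(\<lambda>(x :: 'a, y, \<phi>). if \<phi> \<inter> ball (c y) (r y) = {} then f y else 0)
      \<in> borel_measurable (borel \<Otimes>\<^sub>M borel \<Otimes>\<^sub>M (config_space :: 'a set measure))"
    by (rule measurable_void_if2[where f = "\<lambda>x y. f y" and c = "\<lambda>x y. c y" and r = "\<lambda>x y. r y"])
      (simp_all add: case_prod_beta')
  from measurable_compose[OF _ this, of "\<lambda>q. (0, q)" "borel \<Otimes>\<^sub>M config_space"] show ?thesis
    by simp
qed

lemma measurable_empty_sum3:
  fixes f :: "'a::euclidean_space \<Rightarrow> 'a \<Rightarrow> 'a \<Rightarrow> ennreal"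
  assumes m: "(\<lambda>(x, y, z). f x y z) \<in> borel_measurable (borel \<Otimes>\<^sub>M borel \<Otimes>\<^sub>M borel)"
    "(\<lambda>(x, y, z). c x y z) \<in> borel_measurable (borel \<Otimes>\<^sub>M borel \<Otimes>\<^sub>M borel)"
    "(\<lambda>(x, y, z). r x y z) \<in> borel_measurable (borel \<Otimes>\<^sub>M borel \<Otimes>\<^sub>M borel)"
    and d: "\<And>x y z. f x y z \<noteq> 0 \<Longrightarrow> x \<noteq> y \<and> x \<noteq> z \<and> y \<noteq> z \<and>
    x \<notin> ball (c x y z) (r x y z) \<and> y \<notin> ball (c x y z) (r x y z) \<and> z \<notin> ball (c x y z) (r x y z)"
  shows "empty_sum3 f c r \<in> borel_measurable config_space"
proof -
  let ?g = "\<lambda>(x, y, z, \<phi>). if \<phi> \<inter> ball (c x y z) (r x y z) = {} then f x y z else 0"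
  have g [measurable]: "?g \<in> borel_measurable (borel \<Otimes>\<^sub>M borel \<Otimes>\<^sub>M borel \<Otimes>\<^sub>M config_space)"
    by (rule measurable_void_if3[OF m])
  define G where "G = (\<lambda>(p, \<phi>). \<integral>\<^sup>+z. (\<lambda>q. ?g (fst (fst q), snd (fst q), snd q)) (p, z, \<phi> - {z}) \<partial>count_space \<phi>)"
  have G [measurable]: "G \<in> borel_measurable ((borel \<Otimes>\<^sub>M borel) \<Otimes>\<^sub>M config_space)"
    unfolding G_def by (rule measurable_nn_sum_config) measurable
  define H where "H = (\<lambda>(p, \<phi>). \<integral>\<^sup>+z. (\<lambda>q. G ((fst q, fst (snd q)), snd (snd q))) (p, z, \<phi> - {z}) \<partial>count_space \<phi>)"
  have H [measurable]: "H \<in> borel_measurable (borel \<Otimes>\<^sub>M config_space)"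
    unfolding H_def by (rule measurable_nn_sum_config) measurable
  have "empty_sum3 f c r = (\<lambda>\<phi>. \<integral>\<^sup>+x. H (x, \<phi> - {x}) \<partial>count_space \<phi>)"
    by (rule ext) (simp add: empty_sum3_nested[OF d] H_def G_def cong: if_cong)
  then show ?thesis
    using measurable_nn_sum_config'[OF H] by simp
qed

context poisson_process
begin

text \<open>Once the three points are integration variables, emptiness of the disk is independent of
  them and contributes the void probability exp(- n pi r^2).\<close>

lemma expected_empty_sum3:
  assumes m: "(\<lambda>(x, y, z). f x y z) \<in> borel_measurable (borel \<Otimes>\<^sub>M borel \<Otimes>\<^sub>M borel)"
    "(\<lambda>(x, y, z). c x y z) \<in> borel_measurable (borel \<Otimes>\<^sub>M borel \<Otimes>\<^sub>M borel)"
    "(\<lambda>(x, y, z). r x y z) \<in> borel_measurable (borel \<Otimes>\<^sub>M borel \<Otimes>\<^sub>M borel)"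
    and r: "\<And>x y z. r x y z \<ge> 0"
    and d: "\<And>x y z. f x y z \<noteq> 0 \<Longrightarrow> x \<noteq> y \<and> x \<noteq> z \<and> y \<noteq> z \<and>
    x \<notin> ball (c x y z) (r x y z) \<and> y \<notin> ball (c x y z) (r x y z) \<and> z \<notin> ball (c x y z) (r x y z)"
  shows "(\<integral>\<^sup>+\<omega>. empty_sum3 f c r (X \<omega>) \<partial>M) =
    ennreal n ^ 3 * (\<integral>\<^sup>+x. (\<integral>\<^sup>+y. (\<integral>\<^sup>+z. f x y z * ennreal (exp (- (n * pi * (r x y z)\<^sup>2))) \<partial>lborel) \<partial>lborel) \<partial>lborel)"
  using mecke3[OF measurable_void_if3[OF m]]
  by (simp add: empty_sum3_nested[OF d] nn_integral_void_ball[OF r])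

lemma expected_empty_sum2:
  assumes m: "(\<lambda>(x, y). f x y) \<in> borel_measurable (borel \<Otimes>\<^sub>M borel)"
    "(\<lambda>(x, y). c x y) \<in> borel_measurable (borel \<Otimes>\<^sub>M borel)"
    "(\<lambda>(x, y). r x y) \<in> borel_measurable (borel \<Otimes>\<^sub>M borel)"
    and r: "\<And>x y. r x y \<ge> 0"
    and d: "\<And>x y. f x y \<noteq> 0 \<Longrightarrow> x \<noteq> y \<and> x \<notin> ball (c x y) (r x y) \<and> y \<notin> ball (c x y) (r x y)"
  shows "(\<integral>\<^sup>+\<omega>. empty_sum2 f c r (X \<omega>) \<partial>M) =
    ennreal n ^ 2 * (\<integral>\<^sup>+x. (\<integral>\<^sup>+y. f x y * ennreal (exp (- (n * pi * (r x y)\<^sup>2))) \<partial>lborel) \<partial>lborel)"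
  using mecke2[OF measurable_void_if2[OF m]]
  by (simp add: empty_sum2_nested[OF d] nn_integral_void_ball[OF r])

lemma expected_empty_sum1:
  assumes m: "f \<in> borel_measurable borel" "c \<in> borel_measurable borel" "r \<in> borel_measurable borel"
    and r: "\<And>x. r x \<ge> 0"
    and d: "\<And>x. f x \<noteq> 0 \<Longrightarrow> x \<notin> ball (c x) (r x)"
  shows "(\<integral>\<^sup>+\<omega>. empty_sum1 f c r (X \<omega>) \<partial>M) =
    ennreal n * (\<integral>\<^sup>+x. f x * ennreal (exp (- (n * pi * (r x)\<^sup>2))) \<partial>lborel)"
  using mecke[OF measurable_void_if1[OF m]]
  by (simp add: empty_sum1_nested[OF d] nn_integral_void_ball[OF r])

end

section \<open>Delaunay triangles crossed by a segment\<close>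

text \<open>Gram determinant: the squared area of the parallelogram spanned by \<open>a\<close> and
  \<open>b\<close>. As a polynomial expression it makes nondegeneracy a measurable
  condition.\<close>

definition gram :: "'a::real_inner \<Rightarrow> 'a \<Rightarrow> real" where
  "gram a b = (a \<bullet> a) * (b \<bullet> b) - (a \<bullet> b)\<^sup>2"

definition noncollinear :: "'a::real_inner \<Rightarrow> 'a \<Rightarrow> 'a \<Rightarrow> bool" where
  "noncollinear x y z \<longleftrightarrow> gram (y - x) (z - x) \<noteq> 0"

text \<open>Cramer's rule for the equations of two perpendicular bisectors. An explicit formula,
  rather than a chosen centre, makes centre and radius measurable in the vertices. For collinear
  points the division by 0 returns \<open>x\<close>.\<close>

definition circumcenter :: "'a::real_inner \<Rightarrow> 'a \<Rightarrow> 'a \<Rightarrow> 'a" where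
  "circumcenter x y z = (let a = y - x; b = z - x in
     x + (1 / (2 * gram a b)) *\<^sub>R
       (((b \<bullet> b) * (a \<bullet> a - a \<bullet> b)) *\<^sub>R a + ((a \<bullet> a) * (b \<bullet> b - a \<bullet> b)) *\<^sub>R b))"

definition circumradius :: "'a::real_inner \<Rightarrow> 'a \<Rightarrow> 'a \<Rightarrow> real" where
  "circumradius x y z = dist (circumcenter x y z) x"

text \<open>The equality case of the Cauchy-Schwarz inequality, squared.\<close>

lemma collinear_iff_gram: "collinear {x, y, z :: 'a::euclidean_space} \<longleftrightarrow> \<not> noncollinear x y z"
proof -
  have "collinear {x, y, z} \<longleftrightarrow> collinear {y, x, z}" by (simp add: insert_commute)
  also have "\<dots> \<longleftrightarrow> collinear {0, y - x, z - x}"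
    by (rule collinear_3) (simp add: NO_MATCH_def)
  also have "\<dots> \<longleftrightarrow> \<bar>(y - x) \<bullet> (z - x)\<bar> = norm (y - x) * norm (z - x)"
    by (rule norm_cauchy_schwarz_equal[symmetric])
  also have "\<dots> \<longleftrightarrow> ((y - x) \<bullet> (z - x))\<^sup>2 = (norm (y - x) * norm (z - x))\<^sup>2"
    using power2_eq_iff_nonneg[of "\<bar>(y - x) \<bullet> (z - x)\<bar>" "norm (y - x) * norm (z - x)"] by simp
  finally show ?thesis
    by (auto simp: noncollinear_def gram_def power_mult_distrib dot_square_norm)
qed

lemma noncollinear_iff: "noncollinear x y (z :: 'a::euclidean_space) \<longleftrightarrow> \<not> collinear {x, y, z}"
  by (simp add: collinear_iff_gram)

lemma noncollinear_perm:
  fixes x y z :: "'a::euclidean_space"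
  assumes "noncollinear x y z"
  shows "noncollinear y x z" "noncollinear z y x" "noncollinear x z y"
proof -
  have "{y, x, z} = {x, y, z}" "{z, y, x} = {x, y, z}" "{x, z, y} = {x, y, z}" by blast+
  with assms show "noncollinear y x z" "noncollinear z y x" "noncollinear x z y"
    unfolding noncollinear_iff by simp_all
qed

lemma noncollinear_distinct: "noncollinear x y z \<Longrightarrow> x \<noteq> y \<and> x \<noteq> z \<and> y \<noteq> z"
  by (auto simp: noncollinear_def gram_def power2_eq_square)

lemma half_cancel: "G \<noteq> 0 \<Longrightarrow> 1 / (2 * G) * (p * G) = p / (2 :: real)"
  by simp

text \<open>Equality of the distances to two vertices becomes linear in the centre, because the
  quadratic terms cancel; this is the resulting linear system.\<close>

lemma circumcenter_inner:
  assumes "noncollinear x y z"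
  shows "(circumcenter x y z - x) \<bullet> (y - x) = ((y - x) \<bullet> (y - x)) / 2"
    and "(circumcenter x y z - x) \<bullet> (z - x) = ((z - x) \<bullet> (z - x)) / 2"
proof -
  define a b where "a = y - x" and "b = z - x"
  define p q m where "p = a \<bullet> a" and "q = b \<bullet> b" and "m = a \<bullet> b"
  have G: "gram a b = p * q - m\<^sup>2" by (simp add: gram_def p_def q_def m_def)
  have G0: "p * q - m\<^sup>2 \<noteq> 0" using assms by (simp add: noncollinear_def a_def[symmetric] b_def[symmetric] G)
  have v: "circumcenter x y z - x = (1 / (2 * (p * q - m\<^sup>2))) *\<^sub>R ((q * (p - m)) *\<^sub>R a + (p * (q - m)) *\<^sub>R b)"
    unfolding circumcenter_def Let_def a_def[symmetric] b_def[symmetric] G p_def[symmetric] q_def[symmetric] m_def[symmetric]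
    by simp
  have ip: "a \<bullet> a = p" "b \<bullet> b = q" "a \<bullet> b = m" "b \<bullet> a = m"
    by (simp_all add: p_def q_def m_def inner_commute)
  have "(circumcenter x y z - x) \<bullet> a = 1 / (2 * (p * q - m\<^sup>2)) * (q * (p - m) * p + p * (q - m) * m)"
    by (simp only: v inner_scaleR_left inner_add_left ip)
  also have "q * (p - m) * p + p * (q - m) * m = p * (p * q - m\<^sup>2)"
    by (simp add: algebra_simps power2_eq_square)
  also have "1 / (2 * (p * q - m\<^sup>2)) * (p * (p * q - m\<^sup>2)) = p / 2"
    using G0 by (rule half_cancel)
  finally have "(circumcenter x y z - x) \<bullet> a = p / 2" .
  then show "(circumcenter x y z - x) \<bullet> (y - x) = ((y - x) \<bullet> (y - x)) / 2"
    by (simp only: a_def[symmetric] ip)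
  have "(circumcenter x y z - x) \<bullet> b = 1 / (2 * (p * q - m\<^sup>2)) * (q * (p - m) * m + p * (q - m) * q)"
    by (simp only: v inner_scaleR_left inner_add_left ip)
  also have "q * (p - m) * m + p * (q - m) * q = q * (p * q - m\<^sup>2)"
    by (simp add: algebra_simps power2_eq_square)
  also have "1 / (2 * (p * q - m\<^sup>2)) * (q * (p * q - m\<^sup>2)) = q / 2"
    using G0 by (rule half_cancel)
  finally have "(circumcenter x y z - x) \<bullet> b = q / 2" .
  then show "(circumcenter x y z - x) \<bullet> (z - x) = ((z - x) \<bullet> (z - x)) / 2"
    by (simp only: b_def[symmetric] ip)
qed

lemma dist_sq_eq_inner: "(dist c y)\<^sup>2 = (dist c x)\<^sup>2 - 2 * ((c - x) \<bullet> (y - x)) + (y - x) \<bullet> (y - x)"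
  for c x y :: "'a::real_inner"
  unfolding dist_norm power2_norm_eq_inner by (simp add: inner_diff_left inner_diff_right inner_commute)

lemma dist_circumcenter:
  assumes "noncollinear x y z"
  shows "dist (circumcenter x y z) x = circumradius x y z"
    "dist (circumcenter x y z) y = circumradius x y z"
    "dist (circumcenter x y z) z = circumradius x y z"
proof -
  show "dist (circumcenter x y z) x = circumradius x y z" by (simp add: circumradius_def)
  have "(dist (circumcenter x y z) y)\<^sup>2 = (dist (circumcenter x y z) x)\<^sup>2"
    using circumcenter_inner(1)[OF assms] dist_sq_eq_inner[of "circumcenter x y z" y x] by simp
  then show "dist (circumcenter x y z) y = circumradius x y z"
    by (simp add: circumradius_def)
  have "(dist (circumcenter x y z) z)\<^sup>2 = (dist (circumcenter x y z) x)\<^sup>2"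
    using circumcenter_inner(2)[OF assms] dist_sq_eq_inner[of "circumcenter x y z" z x] by simp
  then show "dist (circumcenter x y z) z = circumradius x y z"
    by (simp add: circumradius_def)
qed

lemma circumradius_nonneg [simp]: "circumradius x y z \<ge> 0"
  by (simp add: circumradius_def)

lemma inner_real2: "(v :: real^2) \<bullet> w = v $ 1 * w $ 1 + v $ 2 * w $ 2"
  by (simp add: inner_vec_def sum_2)

lemma gram_real2: "gram a (b :: real^2) = (a $ 1 * b $ 2 - a $ 2 * b $ 1)\<^sup>2"
  by (simp add: gram_def inner_real2 power2_eq_square algebra_simps)

text \<open>Dimension two enters here: two independent vectors span the plane, so only 0 is
  orthogonal to both. The uniqueness of the circumscribed circle rests on it.\<close>

lemma gram_eq_0_imp:
  fixes w a b :: "real^2"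
  assumes "gram a b \<noteq> 0" "w \<bullet> a = 0" "w \<bullet> b = 0"
  shows "w = 0"
proof -
  have c: "a $ 1 * b $ 2 - a $ 2 * b $ 1 \<noteq> 0" using assms(1) by (simp add: gram_real2)
  have 1: "w $ 1 * a $ 1 + w $ 2 * a $ 2 = 0" "w $ 1 * b $ 1 + w $ 2 * b $ 2 = 0"
    using assms by (simp_all add: inner_real2)
  have "w $ 1 * (a $ 1 * b $ 2 - a $ 2 * b $ 1) = (w $ 1 * a $ 1 + w $ 2 * a $ 2) * b $ 2 - (w $ 1 * b $ 1 + w $ 2 * b $ 2) * a $ 2"
    "w $ 2 * (a $ 1 * b $ 2 - a $ 2 * b $ 1) = (w $ 1 * b $ 1 + w $ 2 * b $ 2) * a $ 1 - (w $ 1 * a $ 1 + w $ 2 * a $ 2) * b $ 1"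
    by (simp_all add: algebra_simps)
  then have "w $ 1 = 0" "w $ 2 = 0" unfolding 1 using c by simp_all
  then show ?thesis by (simp add: vec_eq_iff forall_2)
qed

lemma circumcenter_unique:
  fixes x y z c :: "real^2"
  assumes "noncollinear x y z" "dist c x = r" "dist c y = r" "dist c z = r"
  shows "c = circumcenter x y z" "r = circumradius x y z"
proof -
  have "(c - x) \<bullet> (y - x) = ((y - x) \<bullet> (y - x)) / 2" "(c - x) \<bullet> (z - x) = ((z - x) \<bullet> (z - x)) / 2"
    using dist_sq_eq_inner[of c y x] dist_sq_eq_inner[of c z x] assms by simp_all
  then have "(c - circumcenter x y z) \<bullet> (y - x) = 0" "(c - circumcenter x y z) \<bullet> (z - x) = 0"
    using circumcenter_inner[OF assms(1)] by (simp_all add: inner_diff_left)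
  then have "c - circumcenter x y z = 0"
    by (intro gram_eq_0_imp[of "y - x" "z - x"]) (use assms(1) in \<open>auto simp: noncollinear_def\<close>)
  then show "c = circumcenter x y z" by simp
  then show "r = circumradius x y z" using assms(2) by (simp add: circumradius_def)
qed

lemma circumcenter_perm:
  fixes x y z :: "real^2"
  assumes "noncollinear x y z"
  shows "circumcenter y x z = circumcenter x y z" "circumradius y x z = circumradius x y z"
    "circumcenter z y x = circumcenter x y z" "circumradius z y x = circumradius x y z"
    "circumcenter x z y = circumcenter x y z" "circumradius x z y = circumradius x y z"
  using circumcenter_unique[OF noncollinear_perm(1)[OF assms] dist_circumcenter(2,1,3)[OF assms]]
    circumcenter_unique[OF noncollinear_perm(2)[OF assms] dist_circumcenter(3,2,1)[OF assms]]
    circumcenter_unique[OF noncollinear_perm(3)[OF assms] dist_circumcenter(1,3,2)[OF assms]]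
  by (simp_all only:)

text \<open>The classical R = a b c / (4 area) in squared form, \<open>gram\<close> being four times
  the squared area. It expresses the exponent of the void probability by side lengths.\<close>

lemma circumradius_formula:
  assumes "noncollinear x y z"
  shows "4 * gram (y - x) (z - x) * (circumradius x y z)\<^sup>2 = (dist x y)\<^sup>2 * (dist x z)\<^sup>2 * (dist y z)\<^sup>2"
proof -
  define a b where "a = y - x" and "b = z - x"
  define p q m where "p = a \<bullet> a" and "q = b \<bullet> b" and "m = a \<bullet> b"
  define v where "v = circumcenter x y z - x"
  have G: "gram a b = p * q - m\<^sup>2" by (simp add: gram_def p_def q_def m_def)
  have G0: "p * q - m\<^sup>2 \<noteq> 0" using assms by (simp add: noncollinear_def a_def[symmetric] b_def[symmetric] G)
  have v: "v = (1 / (2 * (p * q - m\<^sup>2))) *\<^sub>R ((q * (p - m)) *\<^sub>R a + (p * (q - m)) *\<^sub>R b)"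
    unfolding v_def circumcenter_def Let_def a_def[symmetric] b_def[symmetric] G p_def[symmetric] q_def[symmetric] m_def[symmetric]
    by simp
  have va: "v \<bullet> a = p / 2" "v \<bullet> b = q / 2"
    using circumcenter_inner[OF assms] by (simp_all add: v_def a_def b_def p_def q_def)
  have "(circumradius x y z)\<^sup>2 = v \<bullet> v"
    by (simp add: circumradius_def dist_norm power2_norm_eq_inner v_def)
  also have "\<dots> = (1 / (2 * (p * q - m\<^sup>2))) * ((q * (p - m)) * (v \<bullet> a) + (p * (q - m)) * (v \<bullet> b))"
    by (subst (2) v) (simp only: inner_scaleR_right inner_add_right)
  also have "\<dots> = (p * q * (p + q - 2 * m)) / (4 * (p * q - m\<^sup>2))"
  proof -
    have "(q * (p - m)) * (v \<bullet> a) + (p * (q - m)) * (v \<bullet> b) = p * q * (p + q - 2 * m) / 2"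
      unfolding va by (simp add: field_simps)
    then show ?thesis by (simp only:) simp
  qed
  finally have "4 * (p * q - m\<^sup>2) * (circumradius x y z)\<^sup>2 = p * q * (p + q - 2 * m)"
    using G0 by (simp add: field_simps)
  moreover have "(dist x y)\<^sup>2 = p" "(dist x z)\<^sup>2 = q"
    by (simp_all add: p_def q_def a_def b_def dist_norm norm_minus_commute power2_norm_eq_inner[symmetric])
  moreover have "(dist y z)\<^sup>2 = p + q - 2 * m"
  proof -
    have "dist y z = norm (a - b)" by (simp add: a_def b_def dist_norm)
    then show ?thesis
      by (simp add: power2_norm_eq_inner p_def q_def m_def inner_diff_left inner_diff_right inner_commute)
  qed
  ultimately show ?thesis unfolding a_def[symmetric] b_def[symmetric] G by simp
qed

text \<open>In the plane the circle through three noncollinear points is unique, so the quantified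
  circle may be replaced by the explicit one. Emptiness then has the shape used in
  \<open>empty_sum3\<close>.\<close>

lemma delaunay_triangle_iff:
  fixes x y z :: "real^2"
  assumes "noncollinear x y z"
  shows "{x, y, z} \<in> delaunay_triangles P \<longleftrightarrow>
    x \<in> P \<and> y \<in> P \<and> z \<in> P \<and> P \<inter> ball (circumcenter x y z) (circumradius x y z) = {}"
proof -
  have "card {x, y, z} = 3"
    using noncollinear_distinct[OF assms] by simp
  moreover have "(\<exists>c r. {x, y, z} \<subseteq> sphere c r \<and> ball c r \<inter> P = {}) \<longleftrightarrow>
      P \<inter> ball (circumcenter x y z) (circumradius x y z) = {}"
  proof
    assume "\<exists>c r. {x, y, z} \<subseteq> sphere c r \<and> ball c r \<inter> P = {}"
    then obtain c r where cr: "dist c x = r" "dist c y = r" "dist c z = r" "ball c r \<inter> P = {}" by auto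
    with circumcenter_unique[OF assms cr(1-3)] show "P \<inter> ball (circumcenter x y z) (circumradius x y z) = {}"
      by (simp add: Int_commute)
  next
    assume "P \<inter> ball (circumcenter x y z) (circumradius x y z) = {}"
    then show "\<exists>c r. {x, y, z} \<subseteq> sphere c r \<and> ball c r \<inter> P = {}"
      using dist_circumcenter[OF assms]
      by (intro exI[of _ "circumcenter x y z"] exI[of _ "circumradius x y z"]) (simp add: Int_commute)
  qed
  ultimately show ?thesis
    using assms by (simp add: delaunay_triangles_def collinear_iff_gram)
qed

lemma delaunay_triangleE:
  assumes "T \<in> delaunay_triangles P" "p \<in> T" "q \<in> T" "p \<noteq> q"
  obtains r where "T = {p, q, r}" "noncollinear p q r"
proof -
  have T: "card T = 3" "\<not> collinear T" using assms(1) by (simp_all add: delaunay_triangles_def)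
  then have "card (T - {p, q}) = 1"
    using assms by (subst card_Diff_subset) auto
  then obtain r where "T - {p, q} = {r}" by (auto simp: card_1_singleton_iff)
  then have "T = {p, q, r}" using assms by blast
  moreover from this T(2) have "noncollinear p q r" by (simp add: noncollinear_iff)
  ultimately show thesis by (rule that)
qed

lemma diameter_closed_segment: "diameter (closed_segment p q) = dist p (q :: 'a::euclidean_space)"
proof (rule antisym)
  show "diameter (closed_segment p q) \<le> dist p q"
  proof (rule diameter_le)
    show "norm (x - y) \<le> dist p q" if "x \<in> closed_segment p q" "y \<in> closed_segment p q" for x y
    proof -
      have "\<exists>a\<in>{p, q}. \<exists>b\<in>{p, q}. norm (x - y) \<le> norm (a - b)"
        using that unfolding segment_convex_hull by (intro simplex_extremal_le_exists) simp_all
      then show ?thesis by (auto simp: dist_norm norm_minus_commute)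
    qed
  qed simp
  show "dist p q \<le> diameter (closed_segment p q)"
    by (intro diameter_bounded_bound compact_imp_bounded compact_segment) auto
qed


section \<open>Barycentric coordinates\<close>

lemma interior_triangle_iff:
  fixes x y z p :: "real^2"
  assumes "noncollinear x y z"
  shows "p \<in> interior (convex hull {x, y, z}) \<longleftrightarrow>
    (\<exists>\<beta> \<gamma>. 0 < \<beta> \<and> 0 < \<gamma> \<and> \<beta> + \<gamma> < 1 \<and> p = x + \<beta> *\<^sub>R (y - x) + \<gamma> *\<^sub>R (z - x))"
proof -
  have "\<not> collinear {x, y, z}" using assms by (simp add: noncollinear_iff)
  then have i: "interior (convex hull {x, y, z}) =
      {v. \<exists>a b c. 0 < a \<and> 0 < b \<and> 0 < c \<and> a + b + c = 1 \<and> a *\<^sub>R x + b *\<^sub>R y + c *\<^sub>R z = v}"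
    by (rule interior_convex_hull_3_minimal) simp
  show ?thesis
  proof
    assume "p \<in> interior (convex hull {x, y, z})"
    then obtain a b c where "0 < a" "0 < b" "0 < c" "a + b + c = 1" "p = a *\<^sub>R x + b *\<^sub>R y + c *\<^sub>R z"
      unfolding i by auto
    moreover from this have "a = 1 - b - c" by simp
    ultimately show "\<exists>\<beta> \<gamma>. 0 < \<beta> \<and> 0 < \<gamma> \<and> \<beta> + \<gamma> < 1 \<and> p = x + \<beta> *\<^sub>R (y - x) + \<gamma> *\<^sub>R (z - x)"
      by (intro exI[of _ b] exI[of _ c]) (simp add: algebra_simps)
  next
    assume "\<exists>\<beta> \<gamma>. 0 < \<beta> \<and> 0 < \<gamma> \<and> \<beta> + \<gamma> < 1 \<and> p = x + \<beta> *\<^sub>R (y - x) + \<gamma> *\<^sub>R (z - x)"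
    then obtain b c where "0 < b" "0 < c" "b + c < 1" "p = x + b *\<^sub>R (y - x) + c *\<^sub>R (z - x)" by auto
    then show "p \<in> interior (convex hull {x, y, z})"
      unfolding i by (intro CollectI exI[of _ "1 - b - c"] exI[of _ b] exI[of _ c]) (simp add: algebra_simps)
  qed
qed

text \<open>Cramer's rule for the coefficient of \<open>y - x\<close> in the expansion of
  \<open>p - x\<close> by \<open>y - x\<close> and \<open>z - x\<close>; exchanging \<open>y\<close>
  and \<open>z\<close> gives the other coefficient. The closed form serves measurability.\<close>

definition bary :: "'a::real_inner \<Rightarrow> 'a \<Rightarrow> 'a \<Rightarrow> 'a \<Rightarrow> real" where
  "bary p x y z = (((z - x) \<bullet> (z - x)) * ((p - x) \<bullet> (y - x)) - ((y - x) \<bullet> (z - x)) * ((p - x) \<bullet> (z - x)))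
     / gram (y - x) (z - x)"

lemma gram_commute: "gram a b = gram b a"
  by (simp add: gram_def inner_commute mult.commute)

lemma bary_combination:
  assumes "noncollinear x y z"
  shows "bary (x + \<beta> *\<^sub>R (y - x) + \<gamma> *\<^sub>R (z - x)) x y z = \<beta>"
    "bary (x + \<beta> *\<^sub>R (y - x) + \<gamma> *\<^sub>R (z - x)) x z y = \<gamma>"
proof -
  have G: "gram (y - x) (z - x) \<noteq> 0" using assms by (simp add: noncollinear_def)
  define a b where "a = y - x" and "b = z - x"
  have "(b \<bullet> b) * ((\<beta> *\<^sub>R a + \<gamma> *\<^sub>R b) \<bullet> a) - (a \<bullet> b) * ((\<beta> *\<^sub>R a + \<gamma> *\<^sub>R b) \<bullet> b) = \<beta> * gram a b"
    "(a \<bullet> a) * ((\<beta> *\<^sub>R a + \<gamma> *\<^sub>R b) \<bullet> b) - (b \<bullet> a) * ((\<beta> *\<^sub>R a + \<gamma> *\<^sub>R b) \<bullet> a) = \<gamma> * gram a b"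
    by (simp_all add: gram_def inner_add_left inner_commute[of b a] algebra_simps power2_eq_square)
  then show "bary (x + \<beta> *\<^sub>R (y - x) + \<gamma> *\<^sub>R (z - x)) x y z = \<beta>"
    "bary (x + \<beta> *\<^sub>R (y - x) + \<gamma> *\<^sub>R (z - x)) x z y = \<gamma>"
    using G unfolding bary_def a_def[symmetric] b_def[symmetric] gram_commute[of b a]
    by (simp_all add: add.assoc)
qed

lemma bary_spec:
  fixes x y z p :: "real^2"
  assumes "noncollinear x y z"
  shows "p = x + bary p x y z *\<^sub>R (y - x) + bary p x z y *\<^sub>R (z - x)"
proof -
  define a b v where "a = y - x" and "b = z - x" and "v = p - x"
  have G: "gram a b \<noteq> 0" using assms by (simp add: noncollinear_def a_def b_def)
  define \<beta> \<gamma> where "\<beta> = bary p x y z" and "\<gamma> = bary p x z y"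
  have \<beta>: "\<beta> * gram a b = (b \<bullet> b) * (v \<bullet> a) - (a \<bullet> b) * (v \<bullet> b)"
    and \<gamma>: "\<gamma> * gram a b = (a \<bullet> a) * (v \<bullet> b) - (a \<bullet> b) * (v \<bullet> a)"
    using G by (simp_all add: \<beta>_def \<gamma>_def bary_def a_def[symmetric] b_def[symmetric] v_def[symmetric] gram_commute[of b a] inner_commute[of b a])
  have "gram a b * ((v - \<beta> *\<^sub>R a - \<gamma> *\<^sub>R b) \<bullet> a) = gram a b * (v \<bullet> a) - (\<beta> * gram a b) * (a \<bullet> a) - (\<gamma> * gram a b) * (a \<bullet> b)"
    by (simp add: inner_diff_left algebra_simps inner_commute[of b a])
  also have "\<dots> = 0" unfolding \<beta> \<gamma> by (simp add: gram_def algebra_simps power2_eq_square)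
  finally have 1: "(v - \<beta> *\<^sub>R a - \<gamma> *\<^sub>R b) \<bullet> a = 0" using G by simp
  have "gram a b * ((v - \<beta> *\<^sub>R a - \<gamma> *\<^sub>R b) \<bullet> b) = gram a b * (v \<bullet> b) - (\<beta> * gram a b) * (a \<bullet> b) - (\<gamma> * gram a b) * (b \<bullet> b)"
    by (simp add: inner_diff_left algebra_simps)
  also have "\<dots> = 0" unfolding \<beta> \<gamma> by (simp add: gram_def algebra_simps power2_eq_square)
  finally have 2: "(v - \<beta> *\<^sub>R a - \<gamma> *\<^sub>R b) \<bullet> b = 0" using G by simp
  have "v - \<beta> *\<^sub>R a - \<gamma> *\<^sub>R b = 0" by (rule gram_eq_0_imp[OF G 1 2])
  then show ?thesis
    unfolding \<beta>_def[symmetric] \<gamma>_def[symmetric] a_def[symmetric] b_def[symmetric]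
    by (simp add: v_def algebra_simps)
qed

lemma interior_triangle_iff_bary:
  fixes x y z p :: "real^2"
  assumes "noncollinear x y z"
  shows "p \<in> interior (convex hull {x, y, z}) \<longleftrightarrow>
    0 < bary p x y z \<and> 0 < bary p x z y \<and> bary p x y z + bary p x z y < 1"
  unfolding interior_triangle_iff[OF assms]
  using bary_combination[OF assms] bary_spec[OF assms, of p] by metis

section \<open>Coordinates along the segment\<close>

locale segment_frame =
  fixes s t u :: "real^2"
  assumes st: "s \<noteq> t" and norm_u: "norm u = 1" and orth: "u \<bullet> (t - s) = 0"
begin

definition len :: real where "len = norm (t - s)"
definition dir :: "real^2" where "dir = (1 / len) *\<^sub>R (t - s)"
definition absc :: "real^2 \<Rightarrow> real" where "absc p = (p - s) \<bullet> dir"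
definition hgt :: "real^2 \<Rightarrow> real" where "hgt p = (p - s) \<bullet> u"

definition crosses :: "real^2 \<Rightarrow> real^2 \<Rightarrow> real^2 \<Rightarrow> bool" where
  "crosses x y z \<longleftrightarrow> interior (convex hull {x, y, z}) \<inter> closed_segment s t \<noteq> {}"

lemma len_pos: "len > 0" using st by (simp add: len_def)

lemma frame_inner: "dir \<bullet> dir = 1" "u \<bullet> u = 1" "dir \<bullet> u = 0" "u \<bullet> dir = 0"
proof -
  have "dir \<bullet> dir = (1 / len) * (1 / len) * (len * len)"
    by (simp add: dir_def len_def dot_square_norm power2_eq_square)
  then show "dir \<bullet> dir = 1" using len_pos by simp
  show "u \<bullet> u = 1" using norm_u by (simp add: dot_square_norm)
  show "dir \<bullet> u = 0" "u \<bullet> dir = 0" using orth by (simp_all add: dir_def inner_commute)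
qed

lemma frame_expand: "v = (v \<bullet> dir) *\<^sub>R dir + (v \<bullet> u) *\<^sub>R u"
proof -
  have "gram dir u \<noteq> 0" by (simp add: gram_def frame_inner)
  then have "v - (v \<bullet> dir) *\<^sub>R dir - (v \<bullet> u) *\<^sub>R u = 0"
    by (rule gram_eq_0_imp) (simp_all add: inner_diff_left frame_inner)
  then show ?thesis by (simp add: algebra_simps)
qed

lemma inner_frame: "v \<bullet> w = (v \<bullet> dir) * (w \<bullet> dir) + (v \<bullet> u) * (w \<bullet> u)"
proof -
  have "v \<bullet> w = ((v \<bullet> dir) *\<^sub>R dir + (v \<bullet> u) *\<^sub>R u) \<bullet> w"
    by (simp only: frame_expand[symmetric])
  then show ?thesis
    by (simp only: inner_add_left inner_scaleR_left inner_commute[of w])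
qed

lemma dist_sq_frame: "(dist p q)\<^sup>2 = (absc p - absc q)\<^sup>2 + (hgt p - hgt q)\<^sup>2"
proof -
  have "(dist p q)\<^sup>2 = (p - q) \<bullet> (p - q)" by (simp add: dist_norm power2_norm_eq_inner)
  also have "\<dots> = ((p - q) \<bullet> dir)\<^sup>2 + ((p - q) \<bullet> u)\<^sup>2"
    by (subst inner_frame) (simp add: power2_eq_square)
  finally show ?thesis by (simp add: absc_def hgt_def inner_diff_left)
qed

lemma abs_absc_le_dist: "\<bar>absc p - absc q\<bar> \<le> dist p q"
  and abs_hgt_le_dist: "\<bar>hgt p - hgt q\<bar> \<le> dist p q"
  and dist_le_absc_hgt: "dist p q \<le> \<bar>absc p - absc q\<bar> + \<bar>hgt p - hgt q\<bar>"
proof -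
  have "(absc p - absc q)\<^sup>2 \<le> (dist p q)\<^sup>2" "(hgt p - hgt q)\<^sup>2 \<le> (dist p q)\<^sup>2"
    by (simp_all add: dist_sq_frame)
  then show "\<bar>absc p - absc q\<bar> \<le> dist p q" "\<bar>hgt p - hgt q\<bar> \<le> dist p q"
    by (metis abs_le_square_iff abs_of_nonneg zero_le_dist)+
  have "(dist p q)\<^sup>2 \<le> (\<bar>absc p - absc q\<bar> + \<bar>hgt p - hgt q\<bar>)\<^sup>2"
    by (simp add: dist_sq_frame power2_sum)
  then show "dist p q \<le> \<bar>absc p - absc q\<bar> + \<bar>hgt p - hgt q\<bar>"
    by (rule power2_le_imp_le) simp
qed

lemma absc_s [simp]: "absc s = 0" and hgt_s [simp]: "hgt s = 0"
  and absc_t [simp]: "absc t = len" and hgt_t [simp]: "hgt t = 0"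
proof -
  show "absc s = 0" "hgt s = 0" by (simp_all add: absc_def hgt_def)
  show "hgt t = 0" using orth by (simp add: hgt_def inner_commute)
  have "absc t = (1 / len) * (len * len)" by (simp add: absc_def dir_def len_def dot_square_norm power2_eq_square)
  then show "absc t = len" using len_pos by simp
qed

lemma on_segment_iff: "p \<in> closed_segment s t \<longleftrightarrow> hgt p = 0 \<and> 0 \<le> absc p \<and> absc p \<le> len"
proof
  assume "p \<in> closed_segment s t"
  then obtain l where l: "0 \<le> l" "l \<le> 1" "p = (1 - l) *\<^sub>R s + l *\<^sub>R t"
    by (auto simp: in_segment)
  then have p: "p - s = l *\<^sub>R (t - s)" by (simp add: algebra_simps)
  have "hgt p = l * hgt t" "absc p = l * absc t" unfolding hgt_def absc_def p by simp_all
  then show "hgt p = 0 \<and> 0 \<le> absc p \<and> absc p \<le> len" using l len_pos by (simp add: mult_left_le_one_le)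
next
  assume h: "hgt p = 0 \<and> 0 \<le> absc p \<and> absc p \<le> len"
  have "p - s = absc p *\<^sub>R dir" using frame_expand[of "p - s"] h by (simp add: absc_def hgt_def)
  then have "p = (1 - absc p / len) *\<^sub>R s + (absc p / len) *\<^sub>R t"
    by (simp add: dir_def algebra_simps)
  then show "p \<in> closed_segment s t"
    using h len_pos by (auto simp: in_segment intro!: exI[of _ "absc p / len"])
qed

lemma combination_frame:
  "absc (x + \<beta> *\<^sub>R (y - x) + \<gamma> *\<^sub>R (z - x)) = absc x + \<beta> * (absc y - absc x) + \<gamma> * (absc z - absc x)"
  "hgt (x + \<beta> *\<^sub>R (y - x) + \<gamma> *\<^sub>R (z - x)) = hgt x + \<beta> * (hgt y - hgt x) + \<gamma> * (hgt z - hgt x)"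
  by (simp_all add: absc_def hgt_def inner_diff_left inner_add_left)

lemma dist_circumcenter_interior:
  assumes "noncollinear x y z" "p \<in> interior (convex hull {x, y, z})"
  shows "dist (circumcenter x y z) p \<le> circumradius x y z"
proof -
  have "convex hull {x, y, z} \<subseteq> cball (circumcenter x y z) (circumradius x y z)"
    using dist_circumcenter[OF assms(1)] by (intro hull_minimal) auto
  then show ?thesis using assms(2) interior_subset by fastforce
qed

text \<open>The factor 2 is what \<open>near_point\<close> delivers. The condition covers in
  particular all disks that contain \<open>s\<close> or \<open>t\<close>, so a triple that is not
  near keeps an empty disk after the ends are added.\<close>

definition near_end :: "real^2 \<Rightarrow> real^2 \<Rightarrow> real^2 \<Rightarrow> bool" where
  "near_end x y z \<longleftrightarrow> dist (circumcenter x y z) s \<le> 2 * circumradius x y z \<or>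
     dist (circumcenter x y z) t \<le> 2 * circumradius x y z"

text \<open>Both coordinates of \<open>c\<close> and \<open>w\<close> differ by at most
  \<open>R\<close>: the heights because \<open>p\<close> and \<open>w\<close> lie on the line, the
  abscissas because that of \<open>w\<close> lies between those of \<open>p\<close> and
  \<open>q\<close>. The sum of the two differences bounds the distance.\<close>

lemma near_point:
  assumes "dist c p \<le> R" "dist c q \<le> R" "hgt p = 0" "hgt w = 0"
    "absc p \<le> absc w \<and> absc w \<le> absc q \<or> absc q \<le> absc w \<and> absc w \<le> absc p"
  shows "dist c w \<le> 2 * R"
proof -
  have "\<bar>hgt c - hgt w\<bar> \<le> R"
    using abs_hgt_le_dist[of c p] assms by simp
  moreover have "\<bar>absc c - absc w\<bar> \<le> R"
    using abs_absc_le_dist[of c p] abs_absc_le_dist[of c q] assms by linarith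
  ultimately show ?thesis
    using dist_le_absc_hgt[of c w] by linarith
qed

text \<open>The triangle contains a point of the segment while \<open>x\<close> projects outside it,
  so the abscissa of one end lies between the two and \<open>near_point\<close> applies to that
  end.\<close>

lemma crosses_absc:
  assumes "noncollinear x y z" "crosses x y z" "\<not> (0 \<le> absc x \<and> absc x \<le> len)"
  shows "near_end x y z"
proof -
  obtain p where p: "p \<in> interior (convex hull {x, y, z})" "p \<in> closed_segment s t"
    using assms(2) unfolding crosses_def by blast
  have d: "dist (circumcenter x y z) p \<le> circumradius x y z" "dist (circumcenter x y z) x \<le> circumradius x y z"
    using dist_circumcenter_interior[OF assms(1) p(1)] dist_circumcenter(1)[OF assms(1)] by simp_all
  show ?thesis
    using near_point[OF d, of s] near_point[OF d, of t] p(2) assms(3)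
    unfolding on_segment_iff near_end_def by fastforce
qed

text \<open>An interior point of the triangle is a combination of the vertices with positive
  coefficients; its height could not be 0 if no vertex were below the line and \<open>x\<close>
  strictly above it.\<close>

lemma crosses_heights:
  assumes "noncollinear x y z" "crosses x y z" "hgt x \<ge> 0" "hgt y \<ge> 0" "hgt x \<noteq> 0"
  shows "hgt z < 0"
proof (rule ccontr)
  assume n: "\<not> hgt z < 0"
  obtain p where p: "p \<in> interior (convex hull {x, y, z})" "p \<in> closed_segment s t"
    using assms(2) unfolding crosses_def by blast
  obtain b c where bc: "0 < b" "0 < c" "b + c < 1" "p = x + b *\<^sub>R (y - x) + c *\<^sub>R (z - x)"
    using p(1) unfolding interior_triangle_iff[OF assms(1)] by blast
  have "0 = (1 - b - c) * hgt x + b * hgt y + c * hgt z"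
    using p(2) combination_frame(2)[of x b y c z] unfolding on_segment_iff bc(4)
    by (simp add: algebra_simps)
  moreover have "(1 - b - c) * hgt x > 0" "b * hgt y \<ge> 0" "c * hgt z \<ge> 0"
    using bc assms n by simp_all
  ultimately show False by linarith
qed

text \<open>The interior of such a triangle meets the line. If it misses the segment, the meeting
  point lies beyond an end while \<open>x\<close> projects onto the segment, and
  \<open>near_point\<close> applies to this end.\<close>

lemma not_crosses_near:
  assumes nc: "noncollinear x y z" and h: "hgt x > 0" "hgt y > 0" "hgt z < 0"
    and a: "0 \<le> absc x" "absc x \<le> len" and "\<not> crosses x y z"
  shows "near_end x y z"
proof -
  define m where "m = (hgt x + hgt y) / 2"
  \<comment> \<open>The weight of \<open>z\<close> for which the combination of \<open>z\<close>
    with the midpoint of \<open>x\<close> and \<open>y\<close>, whose height is \<open>m\<close>,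
    has height 0.\<close>
  define c where "c = m / (m - hgt z)"
  have m: "m > 0" using h by (simp add: m_def)
  then have mz: "m - hgt z > 0" using h by simp
  have c: "0 < c" "c < 1" using m mz h by (simp_all add: c_def)
  define b where "b = (1 - c) / 2"
  define p where "p = x + b *\<^sub>R (y - x) + c *\<^sub>R (z - x)"
  have b: "0 < b" "b + c < 1" using c by (simp_all add: b_def field_simps)
  have pin: "p \<in> interior (convex hull {x, y, z})"
    unfolding interior_triangle_iff[OF nc] p_def using b c by blast
  have "hgt p = (1 - c) * m + c * hgt z"
    unfolding p_def combination_frame b_def m_def by (simp add: field_simps)
  also have "\<dots> = m - c * (m - hgt z)" by (simp add: algebra_simps)
  also have "\<dots> = 0" using mz by (simp add: c_def)
  finally have hp: "hgt p = 0" .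
  then have "\<not> (0 \<le> absc p \<and> absc p \<le> len)"
    using pin assms(7) on_segment_iff unfolding crosses_def by blast
  moreover have d: "dist (circumcenter x y z) p \<le> circumradius x y z" "dist (circumcenter x y z) x \<le> circumradius x y z"
    using dist_circumcenter_interior[OF nc pin] dist_circumcenter(1)[OF nc] by simp_all
  ultimately show ?thesis
    using near_point[OF d hp, of s] near_point[OF d hp, of t] a
    unfolding near_end_def by fastforce
qed

text \<open>
  The difference of the powers of a point with respect to the two circles is an affine function. It is
  negative at \<open>s\<close> and \<open>t\<close>, hence on the segment, but nonnegative at the vertices, hence on the
  triangle.
\<close>

lemma no_crossing_of_edge:
  assumes nc: "noncollinear x y z" and c: "crosses x y z"
    and st_circle: "dist k s = r" "dist k t = r"
    and outside: "r \<le> dist k x" "r \<le> dist k y" "r \<le> dist k z"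
    and far: "circumradius x y z < dist (circumcenter x y z) s" "circumradius x y z < dist (circumcenter x y z) t"
  shows False
proof -
  define l R where "l = circumcenter x y z" and "R = circumradius x y z"
  define F where "F = (\<lambda>p. (dist k p)\<^sup>2 - r\<^sup>2 - ((dist l p)\<^sup>2 - R\<^sup>2))"
  have r0: "r \<ge> 0" using st_circle(1) by auto
  have aff: "F p = F q + 2 * ((p - q) \<bullet> (l - k))" for p q
    unfolding F_def using dist_sq_eq_inner[of k p q] dist_sq_eq_inner[of l p q]
    by (simp add: inner_diff_left inner_diff_right inner_commute algebra_simps)
  have Fs: "F s < 0" "F t < 0"
    using far power_strict_mono[of R "dist l s" 2] power_strict_mono[of R "dist l t" 2]
    unfolding F_def st_circle by (simp_all add: l_def R_def)
  have Fx: "F x \<ge> 0" "F y \<ge> 0" "F z \<ge> 0"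
    using outside r0 power_mono[of r "dist k x" 2] power_mono[of r "dist k y" 2] power_mono[of r "dist k z" 2]
    unfolding F_def l_def R_def dist_circumcenter[OF nc] by simp_all
  obtain p where p: "p \<in> interior (convex hull {x, y, z})" "p \<in> closed_segment s t"
    using c unfolding crosses_def by blast
  obtain b c where bc: "0 < b" "0 < c" "b + c < 1" "p = x + b *\<^sub>R (y - x) + c *\<^sub>R (z - x)"
    using p(1) unfolding interior_triangle_iff[OF nc] by blast
  have "F p = (1 - b - c) * F x + b * F y + c * F z"
  proof -
    have "p - x = b *\<^sub>R (y - x) + c *\<^sub>R (z - x)" using bc(4) by simp
    then have "(p - x) \<bullet> (l - k) = b * ((y - x) \<bullet> (l - k)) + c * ((z - x) \<bullet> (l - k))"
      by (simp only: inner_add_left inner_scaleR_left)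
    moreover have "f + 2 * (b * A + c * B) = (1 - b - c) * f + b * (f + 2 * A) + c * (f + 2 * B)" for f A B :: real
      by (simp add: algebra_simps)
    ultimately show ?thesis
      unfolding aff[of p x] aff[of y x] aff[of z x] by (simp only:)
  qed
  moreover have "(1 - b - c) * F x \<ge> 0" "b * F y \<ge> 0" "c * F z \<ge> 0"
    using bc Fx by simp_all
  ultimately have "F p \<ge> 0" by linarith
  obtain w where w: "0 \<le> w" "w \<le> 1" "p = (1 - w) *\<^sub>R s + w *\<^sub>R t"
    using p(2) by (auto simp: in_segment)
  have ps: "p - s = w *\<^sub>R (t - s)" using w(3) by (simp add: algebra_simps)
  have "F p = (1 - w) * F s + w * F t"
  proof -
    have "(p - s) \<bullet> (l - k) = w * ((t - s) \<bullet> (l - k))"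
      unfolding ps by simp
    moreover have "f + 2 * (w * A) = (1 - w) * f + w * (f + 2 * A)" for f A :: real
      by (simp add: algebra_simps)
    ultimately show ?thesis
      unfolding aff[of p s] aff[of t s] by (simp only:)
  qed
  moreover have "(1 - w) * F s + w * F t < 0"
  proof (cases "w = 0")
    case False
    then have "w * F t < 0" using w Fs by (simp add: mult_pos_neg)
    moreover have "(1 - w) * F s \<le> 0" using w Fs by (simp add: mult_nonneg_nonpos)
    ultimately show ?thesis by linarith
  qed (use Fs in simp)
  ultimately show False using \<open>F p \<ge> 0\<close> by linarith
qed


lemma segment_upper_iff:
  "closed_segment x y \<subseteq> upper_half_plane s u \<longleftrightarrow> hgt x \<ge> 0 \<and> hgt y \<ge> 0"
proof
  assume "closed_segment x y \<subseteq> upper_half_plane s u"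
  then show "hgt x \<ge> 0 \<and> hgt y \<ge> 0"
    using ends_in_segment[of x y] by (auto simp: upper_half_plane_def hgt_def)
next
  assume h: "hgt x \<ge> 0 \<and> hgt y \<ge> 0"
  show "closed_segment x y \<subseteq> upper_half_plane s u"
  proof
    fix p assume "p \<in> closed_segment x y"
    then obtain l where l: "0 \<le> l" "l \<le> 1" "p = (1 - l) *\<^sub>R x + l *\<^sub>R y"
      by (auto simp: in_segment)
    have "hgt p = (1 - l) * hgt x + l * hgt y"
      unfolding hgt_def l(3) by (simp add: inner_diff_left inner_add_left algebra_simps)
    also have "\<dots> \<ge> 0" using h l by simp
    finally show "p \<in> upper_half_plane s u" by (simp add: upper_half_plane_def hgt_def)
  qed
qed

text \<open>
  A triangle with an edge in the upper half plane is an ordered triple with the third point off the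
  edge; the two orientations of the edge make every incidence occur twice.
\<close>

definition up_triples :: "(real^2) set \<Rightarrow> ((real^2) \<times> (real^2) \<times> (real^2)) set" where
  "up_triples \<psi> = {(x, y, z). x \<in> \<psi> \<and> y \<in> \<psi> \<and> z \<in> \<psi> \<and> noncollinear x y z \<and>
     \<psi> \<inter> ball (circumcenter x y z) (circumradius x y z) = {} \<and> crosses x y z \<and> 0 \<le> hgt x \<and> 0 \<le> hgt y}"

definition incidence :: "(real^2) \<times> (real^2) \<times> (real^2) \<Rightarrow> (real^2) set \<times> (real^2) set" where
  "incidence = (\<lambda>(x, y, z). ({x, y, z}, closed_segment x y))"

lemma up_triples_iff:
  "(x, y, z) \<in> up_triples \<psi> \<longleftrightarrow> noncollinear x y z \<and> {x, y, z} \<in> crossed_triangles \<psi> s t \<and>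
     closed_segment x y \<subseteq> upper_half_plane s u"
  unfolding up_triples_def crossed_triangles_def segment_upper_iff crosses_def
  using delaunay_triangle_iff[of x y z \<psi>] by auto

lemma upper_incidences_eq: "upper_incidences \<psi> s t u = incidence ` up_triples \<psi>"
proof (intro equalityI subsetI)
  fix i assume "i \<in> upper_incidences \<psi> s t u"
  then obtain T x y where i: "i = (T, closed_segment x y)" "T \<in> crossed_triangles \<psi> s t"
    "x \<in> T" "y \<in> T" "x \<noteq> y" "closed_segment x y \<subseteq> upper_half_plane s u"
    by (auto simp: upper_incidences_def triangle_edges_def)
  moreover have "T \<in> delaunay_triangles \<psi>" using i(2) by (simp add: crossed_triangles_def)
  ultimately obtain z where "T = {x, y, z}" "noncollinear x y z"
    using delaunay_triangleE by blast
  then show "i \<in> incidence ` up_triples \<psi>"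
    using i by (intro image_eqI[of _ _ "(x, y, z)"]) (simp_all add: incidence_def up_triples_iff)
next
  fix i assume "i \<in> incidence ` up_triples \<psi>"
  then obtain x y z where i: "(x, y, z) \<in> up_triples \<psi>" "i = ({x, y, z}, closed_segment x y)"
    by (auto simp: incidence_def)
  then have "noncollinear x y z" by (simp add: up_triples_iff)
  then have "x \<noteq> y" using noncollinear_distinct by blast
  then show "i \<in> upper_incidences \<psi> s t u"
    using i by (auto simp: up_triples_iff upper_incidences_def triangle_edges_def)
qed

lemma up_triples_swap: "(x, y, z) \<in> up_triples \<psi> \<Longrightarrow> (y, x, z) \<in> up_triples \<psi>"
  unfolding up_triples_iff using noncollinear_perm(1)[of x y z]
  by (simp add: insert_commute closed_segment_commute)

text \<open>A segment determines its pair of end points, so the edge fixes \<open>x\<close> and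
  \<open>y\<close> up to order, and \<open>z\<close> is the remaining vertex of the
  triangle.\<close>

lemma incidence_fibre:
  assumes "(x, y, z) \<in> up_triples \<psi>"
  shows "{w \<in> up_triples \<psi>. incidence w = incidence (x, y, z)} = {(x, y, z), (y, x, z)}"
proof (intro equalityI subsetI)
  fix w assume "w \<in> {w \<in> up_triples \<psi>. incidence w = incidence (x, y, z)}"
  moreover obtain a b c where w: "w = (a, b, c)" by (cases w)
  ultimately have abc: "(a, b, c) \<in> up_triples \<psi>" "{a, b, c} = {x, y, z}" "closed_segment a b = closed_segment x y"
    by (auto simp: incidence_def)
  then have ab: "{a, b} = {x, y}" by simp
  have "a \<noteq> c" "b \<noteq> c" "x \<noteq> z" "y \<noteq> z"
    using abc(1) assms noncollinear_distinct unfolding up_triples_iff by blast+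
  have "c \<in> {x, y, z}" using abc(2) by blast
  moreover have "c \<notin> {x, y}" using ab \<open>a \<noteq> c\<close> \<open>b \<noteq> c\<close> by auto
  ultimately have "c = z" by blast
  with ab show "w \<in> {(x, y, z), (y, x, z)}"
    unfolding w by (auto simp: doubleton_eq_iff)
next
  fix w assume "w \<in> {(x, y, z), (y, x, z)}"
  then show "w \<in> {w \<in> up_triples \<psi>. incidence w = incidence (x, y, z)}"
    using assms up_triples_swap[OF assms] by (auto simp: incidence_def insert_commute closed_segment_commute)
qed

lemma finite_upper_incidences_iff: "finite (upper_incidences \<psi> s t u) \<longleftrightarrow> finite (up_triples \<psi>)"
proof
  assume fin: "finite (upper_incidences \<psi> s t u)"
  show "finite (up_triples \<psi>)"
  proof (rule finite_subset)
    show "up_triples \<psi> \<subseteq> (\<Union>i\<in>upper_incidences \<psi> s t u. {w \<in> up_triples \<psi>. incidence w = i})"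
      unfolding upper_incidences_eq by blast
    show "finite (\<Union>i\<in>upper_incidences \<psi> s t u. {w \<in> up_triples \<psi>. incidence w = i})"
    proof (rule finite_UN_I[OF fin])
      fix i assume "i \<in> upper_incidences \<psi> s t u"
      then obtain x y z where "(x, y, z) \<in> up_triples \<psi>" "i = incidence (x, y, z)"
        unfolding upper_incidences_eq by (metis imageE prod_cases3)
      then show "finite {w \<in> up_triples \<psi>. incidence w = i}"
        using incidence_fibre[of x y z \<psi>] by simp
    qed
  qed
qed (simp add: upper_incidences_eq)

lemma sum_upper_incidences:
  assumes fin: "finite (up_triples \<psi>)"
  shows "(\<Sum>(T, e)\<in>upper_incidences \<psi> s t u. diameter e) = (\<Sum>(x, y, z)\<in>up_triples \<psi>. dist x y) / 2"
proof -
  have "(\<Sum>(x, y, z)\<in>up_triples \<psi>. dist x y) =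
    (\<Sum>i\<in>incidence ` up_triples \<psi>. \<Sum>w\<in>{w \<in> up_triples \<psi>. incidence w = i}. case w of (x, y, z) \<Rightarrow> dist x y)"
    by (rule sum.image_gen[OF fin])
  also have "\<dots> = (\<Sum>i\<in>incidence ` up_triples \<psi>. 2 * diameter (snd i))"
  proof (rule sum.cong[OF refl])
    fix i assume "i \<in> incidence ` up_triples \<psi>"
    then obtain x y z where w: "(x, y, z) \<in> up_triples \<psi>" "i = incidence (x, y, z)"
      by (metis imageE prod_cases3)
    then have "x \<noteq> y" using noncollinear_distinct unfolding up_triples_iff by blast
    then show "(\<Sum>w\<in>{w \<in> up_triples \<psi>. incidence w = i}. case w of (x, y, z) \<Rightarrow> dist x y) = 2 * diameter (snd i)"
      unfolding w(2) incidence_fibre[OF w(1)]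
      by (simp add: incidence_def diameter_closed_segment dist_commute)
  qed
  finally show ?thesis
    unfolding upper_incidences_eq by (simp add: sum_distrib_left[symmetric] case_prod_beta')
qed

lemma path_length_eq:
  "path_length (upper_path \<psi> s t u) =
    (if closed_segment s t \<in> delaunay_edges \<psi> then dist s t
     else if finite (up_triples \<psi>) then (\<Sum>(x, y, z)\<in>up_triples \<psi>. dist x y) / 2 else 0)"
proof (cases "closed_segment s t \<in> delaunay_edges \<psi>")
  case True
  then show ?thesis
    by (simp add: upper_path_def path_length_def diameter_closed_segment)
next
  case False
  then show ?thesis
    using path_length_upper_path[OF False] sum_upper_incidences[of \<psi>] finite_upper_incidences_iff[of \<psi>]
    by (auto simp: case_prod_beta')
qed

lemma segment_delaunay_iff:
  "closed_segment s t \<in> delaunay_edges \<psi> \<longleftrightarrow>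
    s \<in> \<psi> \<and> t \<in> \<psi> \<and> (\<exists>z\<in>\<psi>. noncollinear s t z \<and> \<psi> \<inter> ball (circumcenter s t z) (circumradius s t z) = {})"
proof
  assume "closed_segment s t \<in> delaunay_edges \<psi>"
  then obtain T p q where T: "T \<in> delaunay_triangles \<psi>" "closed_segment s t = closed_segment p q" "p \<in> T" "q \<in> T"
    unfolding delaunay_edges_def triangle_edges_def by blast
  then have "{s, t} = {p, q}" by simp
  then have "s \<in> T" "t \<in> T" using T by (auto simp: doubleton_eq_iff)
  then obtain z where z: "T = {s, t, z}" "noncollinear s t z"
    using delaunay_triangleE[OF T(1) _ _ st] by blast
  with T(1) delaunay_triangle_iff[OF z(2)]
  show "s \<in> \<psi> \<and> t \<in> \<psi> \<and> (\<exists>z\<in>\<psi>. noncollinear s t z \<and> \<psi> \<inter> ball (circumcenter s t z) (circumradius s t z) = {})"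
    by blast
next
  assume "s \<in> \<psi> \<and> t \<in> \<psi> \<and> (\<exists>z\<in>\<psi>. noncollinear s t z \<and> \<psi> \<inter> ball (circumcenter s t z) (circumradius s t z) = {})"
  then obtain z where "noncollinear s t z" "{s, t, z} \<in> delaunay_triangles \<psi>"
    using delaunay_triangle_iff by blast
  then show "closed_segment s t \<in> delaunay_edges \<psi>"
    using st unfolding delaunay_edges_def triangle_edges_def by blast
qed

text \<open>The interior is open, so a crossing point can be moved to a rational parameter. Crossing
  becomes a countable union of conditions and thereby measurable.\<close>

lemma crosses_iff_rational:
  "crosses x y z \<longleftrightarrow> (\<exists>q::rat. 0 \<le> q \<and> q \<le> 1 \<and> s + of_rat q *\<^sub>R (t - s) \<in> interior (convex hull {x, y, z}))"
proof
  assume "crosses x y z"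
  then obtain p where p: "p \<in> interior (convex hull {x, y, z})" "p \<in> closed_segment s t"
    unfolding crosses_def by blast
  obtain w where w: "0 \<le> w" "w \<le> 1" "p = (1 - w) *\<^sub>R s + w *\<^sub>R t"
    using p(2) by (auto simp: in_segment)
  obtain e where e: "e > 0" "ball p e \<subseteq> interior (convex hull {x, y, z})"
    using p(1) open_interior open_contains_ball by metis
  have el: "e / len > 0" using e len_pos by simp
  have "\<exists>q::rat. 0 \<le> q \<and> q \<le> 1 \<and> \<bar>of_rat q - w\<bar> < e / len"
  \<comment> \<open>The rational is sought to the right of \<open>w\<close>; at \<open>w = 1\<close>
    there is no room, but 1 itself is rational.\<close>
  proof (cases "w < 1")
    case True
    then have "w < min 1 (w + e / len)" using el by simp
    from of_rat_dense[OF this] obtain q where q: "w < of_rat q" "of_rat q < min 1 (w + e / len)" by blast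
    have "0 < (of_rat q :: real)" "(of_rat q :: real) < 1" "\<bar>of_rat q - w\<bar> < e / len"
      using q w(1) by linarith+
    then show ?thesis by (intro exI[of _ q]) auto
  next
    case False
    then have "w = 1" using w by simp
    then show ?thesis using el by (intro exI[of _ 1]) simp
  qed
  then obtain q :: rat where q: "0 \<le> q" "q \<le> 1" "\<bar>of_rat q - w\<bar> < e / len" by blast
  have "dist p (s + of_rat q *\<^sub>R (t - s)) = norm ((w - of_rat q) *\<^sub>R (t - s))"
    unfolding w(3) dist_norm by (simp add: algebra_simps)
  also have "\<dots> = \<bar>of_rat q - w\<bar> * len" by (simp add: len_def abs_minus_commute)
  also have "\<dots> < e" using q(3) len_pos by (simp add: pos_less_divide_eq)
  finally have "s + of_rat q *\<^sub>R (t - s) \<in> ball p e" by simp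
  with e(2) q show "\<exists>q::rat. 0 \<le> q \<and> q \<le> 1 \<and> s + of_rat q *\<^sub>R (t - s) \<in> interior (convex hull {x, y, z})"
    by blast
next
  assume "\<exists>q::rat. 0 \<le> q \<and> q \<le> 1 \<and> s + of_rat q *\<^sub>R (t - s) \<in> interior (convex hull {x, y, z})"
  then obtain q :: rat where q: "0 \<le> q" "q \<le> 1" "s + of_rat q *\<^sub>R (t - s) \<in> interior (convex hull {x, y, z})" by blast
  have "s + of_rat q *\<^sub>R (t - s) \<in> closed_segment s t"
    unfolding in_segment using q by (intro exI[of _ "of_rat q"]) (simp add: algebra_simps)
  with q show "crosses x y z" unfolding crosses_def by blast
qed

end

section \<open>The integral over the shapes of triangles\<close>

lemma nn_integral_complex:
  fixes f :: "complex \<Rightarrow> ennreal"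
  assumes [measurable]: "f \<in> borel_measurable borel"
  shows "(\<integral>\<^sup>+z. f z \<partial>lborel) = (\<integral>\<^sup>+x. (\<integral>\<^sup>+y. f (Complex x y) \<partial>lborel) \<partial>lborel)"
proof -
  have m [measurable]: "(\<lambda>(x, y). Complex x y) \<in> borel_measurable (borel \<Otimes>\<^sub>M borel)"
    unfolding borel_prod by (intro borel_measurable_continuous_onI) (simp add: case_prod_beta' Complex_eq continuous_intros)
  have "lborel = distr (lborel \<Otimes>\<^sub>M lborel) borel (\<lambda>(x, y). Complex x y)"
  proof (rule lborel_eqI)
    fix l u :: complex
    assume lu: "\<And>b. b \<in> Basis \<Longrightarrow> l \<bullet> b \<le> u \<bullet> b"
    then have le: "Re l \<le> Re u" "Im l \<le> Im u"
      using lu[of 1] lu[of \<i>] by (simp_all add: Basis_complex_def inner_complex_def)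
    have "(\<lambda>(x, y). Complex x y) -` box l u \<inter> space (lborel \<Otimes>\<^sub>M lborel) = {Re l<..<Re u} \<times> {Im l<..<Im u}"
      by (auto simp: box_def Basis_complex_def inner_complex_def space_pair_measure)
    then have "emeasure (distr (lborel \<Otimes>\<^sub>M lborel) borel (\<lambda>(x, y). Complex x y)) (box l u) =
        emeasure (lborel \<Otimes>\<^sub>M lborel) ({Re l<..<Re u} \<times> {Im l<..<Im u})"
      by (subst emeasure_distr) simp_all
    also have "\<dots> = ennreal (Re u - Re l) * ennreal (Im u - Im l)"
      using le by (subst lborel.emeasure_pair_measure_Times) simp_all
    also have "\<dots> = ennreal (\<Prod>b\<in>Basis. (u - l) \<bullet> b)"
      using le by (simp add: Basis_complex_def inner_complex_def ennreal_mult)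
    finally show "emeasure (distr (lborel \<Otimes>\<^sub>M lborel) borel (\<lambda>(x, y). Complex x y)) (box l u) = (\<Prod>b\<in>Basis. (u - l) \<bullet> b)" .
  qed simp
  then have "(\<integral>\<^sup>+z. f z \<partial>lborel) = (\<integral>\<^sup>+z. f z \<partial>distr (lborel \<Otimes>\<^sub>M lborel) borel (\<lambda>(x, y). Complex x y))"
    by simp
  also have "\<dots> = (\<integral>\<^sup>+p. f (case p of (x, y) \<Rightarrow> Complex x y) \<partial>(lborel \<Otimes>\<^sub>M lborel))"
    by (rule nn_integral_distr) simp_all
  also have "\<dots> = (\<integral>\<^sup>+x. (\<integral>\<^sup>+y. f (Complex x y) \<partial>lborel) \<partial>lborel)"
    by (subst lborel.nn_integral_fst[symmetric]) simp_all
  finally show ?thesis .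
qed

lemma nn_integral_real_plane:
  fixes f :: "real^2 \<Rightarrow> ennreal"
  assumes [measurable]: "f \<in> borel_measurable borel"
  shows "(\<integral>\<^sup>+p. f p \<partial>lborel) = (\<integral>\<^sup>+z. f (vector [Re z, Im z]) \<partial>lborel)"
proof -
  let ?g = "\<lambda>z. vector [Re z, Im z] :: real^2"
  have ax: "(vector [a, b] :: real^2) = a *\<^sub>R axis 1 1 + b *\<^sub>R axis 2 1" for a b :: real
    by (simp add: vec_eq_iff forall_2 axis_def)
  have m [measurable]: "?g \<in> borel_measurable borel"
    unfolding ax by (intro borel_measurable_continuous_onI continuous_intros)
  have B: "(Basis :: (real^2) set) = {axis 1 1, axis 2 1}"
    by (auto simp: Basis_vec_def UNIV_2)
  have ne: "axis 1 1 \<noteq> (axis 2 1 :: real^2)" by (simp add: axis_eq_axis)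
  have "lborel = distr lborel borel ?g"
  proof (rule lborel_eqI)
    fix l u :: "real^2"
    assume lu: "\<And>b. b \<in> Basis \<Longrightarrow> l \<bullet> b \<le> u \<bullet> b"
    then have le: "l $ 1 \<le> u $ 1" "l $ 2 \<le> u $ 2"
      using lu[of "axis 1 1"] lu[of "axis 2 1"] unfolding B by (simp_all add: inner_axis)
    have "?g -` box l u \<inter> space lborel = box (Complex (l $ 1) (l $ 2)) (Complex (u $ 1) (u $ 2))"
      by (auto simp: box_def B inner_axis Basis_complex_def inner_complex_def)
    then have "emeasure (distr lborel borel ?g) (box l u) = emeasure lborel (box (Complex (l $ 1) (l $ 2)) (Complex (u $ 1) (u $ 2)))"
      by (subst emeasure_distr) simp_all
    also have "\<dots> = ennreal (\<Prod>b\<in>Basis. (u - l) \<bullet> b)"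
      using le by (subst emeasure_lborel_box) (auto simp: Basis_complex_def inner_complex_def B inner_axis ne)
    finally show "emeasure (distr lborel borel ?g) (box l u) = (\<Prod>b\<in>Basis. (u - l) \<bullet> b)" .
  qed simp
  then have "(\<integral>\<^sup>+p. f p \<partial>lborel) = (\<integral>\<^sup>+p. f p \<partial>distr lborel borel ?g)"
    by simp
  then show ?thesis
    by (subst (asm) nn_integral_distr) simp_all
qed

lemma nn_integral_translate:
  fixes f :: "'a::euclidean_space \<Rightarrow> ennreal"
  assumes [measurable]: "f \<in> borel_measurable borel"
  shows "(\<integral>\<^sup>+z. f z \<partial>lborel) = (\<integral>\<^sup>+z. f (c + z) \<partial>lborel)"
proof -
  have "(\<integral>\<^sup>+z. f z \<partial>lborel) = (\<integral>\<^sup>+z. f z \<partial>distr lborel borel ((+) c))"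
    by (simp add: lborel_distr_plus)
  then show ?thesis
    by (subst (asm) nn_integral_distr) simp_all
qed

lemma Complex_measurable [measurable (raw)]:
  "f \<in> borel_measurable M \<Longrightarrow> g \<in> borel_measurable M \<Longrightarrow> (\<lambda>x. Complex (f x) (g x)) \<in> borel_measurable M"
  by (simp add: borel_measurable_complex_iff)

lemma nn_integral_cnj:
  fixes f :: "complex \<Rightarrow> ennreal"
  assumes [measurable]: "f \<in> borel_measurable borel"
  shows "(\<integral>\<^sup>+z. f z \<partial>lborel) = (\<integral>\<^sup>+z. f (cnj z) \<partial>lborel)"
proof -
  have [measurable]: "cnj \<in> borel_measurable borel"
    by (intro borel_measurable_continuous_onI continuous_intros)
  have "(\<integral>\<^sup>+y. f (Complex x y) \<partial>lborel) = (\<integral>\<^sup>+y. f (Complex x (- y)) \<partial>lborel)" for x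
    using nn_integral_real_affine[of "\<lambda>y. f (Complex x y)" "-1" 0] by simp
  then show ?thesis
    by (simp add: nn_integral_complex complex_cnj)
qed

text \<open>Multiplication by a + i b is split into two affine substitutions, one in each
  coordinate, so that only one-dimensional substitutions and Tonelli are used. Their factors |c| and
  |a| multiply to a^2 + b^2.\<close>

lemma nn_integral_complex_mult:
  fixes f :: "complex \<Rightarrow> ennreal"
  assumes [measurable]: "f \<in> borel_measurable borel" and w: "w \<noteq> 0"
  shows "(\<integral>\<^sup>+z. f z \<partial>lborel) = ennreal ((norm w)\<^sup>2) * (\<integral>\<^sup>+z. f (w * z) \<partial>lborel)"
proof -
  obtain a b where wab: "w = Complex a b" by (cases w)
  have n: "(norm w)\<^sup>2 = a\<^sup>2 + b\<^sup>2" unfolding wab by (simp add: cmod_def)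
  have mult: "w * Complex x y = Complex (a * x - b * y) (b * x + a * y)" for x y
    unfolding wab by (simp add: complex_eq_iff algebra_simps)
  have rhs: "(\<integral>\<^sup>+z. f (w * z) \<partial>lborel) = (\<integral>\<^sup>+x. (\<integral>\<^sup>+y. f (Complex (a * x - b * y) (b * x + a * y)) \<partial>lborel) \<partial>lborel)"
    by (simp add: nn_integral_complex mult)
  have "(\<integral>\<^sup>+z. f z \<partial>lborel) = (\<integral>\<^sup>+x. (\<integral>\<^sup>+y. f (Complex x y) \<partial>lborel) \<partial>lborel)"
    by (simp add: nn_integral_complex)
  also have "\<dots> = ennreal (a\<^sup>2 + b\<^sup>2) * (\<integral>\<^sup>+x. (\<integral>\<^sup>+y. f (Complex (a * x - b * y) (b * x + a * y)) \<partial>lborel) \<partial>lborel)"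
  \<comment> \<open>The general splitting divides by a. For a = 0 the map merely exchanges the
    coordinates and scales each of them by b up to sign.\<close>
  proof (cases "a = 0")
    case True
    then have b: "b \<noteq> 0" using w by (auto simp: wab complex_eq_iff)
    have "(\<integral>\<^sup>+x. (\<integral>\<^sup>+y. f (Complex x y) \<partial>lborel) \<partial>lborel) =
        (\<integral>\<^sup>+x. ennreal \<bar>b\<bar> * (\<integral>\<^sup>+y. f (Complex x (b * y)) \<partial>lborel) \<partial>lborel)"
      using b by (subst nn_integral_real_affine[where t = 0 and c = b]) simp_all
    also have "\<dots> = ennreal \<bar>b\<bar> * (\<integral>\<^sup>+x. (\<integral>\<^sup>+y. f (Complex x (b * y)) \<partial>lborel) \<partial>lborel)"
      by (rule nn_integral_cmult) measurable
    also have "(\<integral>\<^sup>+x. (\<integral>\<^sup>+y. f (Complex x (b * y)) \<partial>lborel) \<partial>lborel) = (\<integral>\<^sup>+y. (\<integral>\<^sup>+x. f (Complex x (b * y)) \<partial>lborel) \<partial>lborel)"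
      by (rule lborel_pair.Fubini') measurable
    also have "\<dots> = (\<integral>\<^sup>+y. ennreal \<bar>b\<bar> * (\<integral>\<^sup>+x. f (Complex (- (b * x)) (b * y)) \<partial>lborel) \<partial>lborel)"
      using b by (subst nn_integral_real_affine[where t = 0 and c = "- b"]) simp_all
    also have "\<dots> = ennreal \<bar>b\<bar> * (\<integral>\<^sup>+y. (\<integral>\<^sup>+x. f (Complex (- (b * x)) (b * y)) \<partial>lborel) \<partial>lborel)"
      by (rule nn_integral_cmult) measurable
    finally show ?thesis
      using True by (simp add: mult.assoc[symmetric] ennreal_mult[symmetric] power2_eq_square)
  next
    case a: False
    define c where "c = (a\<^sup>2 + b\<^sup>2) / a"
    have c: "c \<noteq> 0" using a by (simp add: c_def sum_power2_eq_zero_iff)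
    have "(\<integral>\<^sup>+x. (\<integral>\<^sup>+y. f (Complex x y) \<partial>lborel) \<partial>lborel) =
        (\<integral>\<^sup>+x. ennreal \<bar>c\<bar> * (\<integral>\<^sup>+y. f (Complex x (b * x / a + c * y)) \<partial>lborel) \<partial>lborel)"
    proof (rule nn_integral_cong)
      show "(\<integral>\<^sup>+y. f (Complex x y) \<partial>lborel) = ennreal \<bar>c\<bar> * (\<integral>\<^sup>+y. f (Complex x (b * x / a + c * y)) \<partial>lborel)" for x
        by (rule nn_integral_real_affine[OF _ c]) measurable
    qed
    also have "\<dots> = ennreal \<bar>c\<bar> * (\<integral>\<^sup>+x. (\<integral>\<^sup>+y. f (Complex x (b * x / a + c * y)) \<partial>lborel) \<partial>lborel)"
      by (rule nn_integral_cmult) measurable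
    also have "(\<integral>\<^sup>+x. (\<integral>\<^sup>+y. f (Complex x (b * x / a + c * y)) \<partial>lborel) \<partial>lborel) =
        (\<integral>\<^sup>+y. (\<integral>\<^sup>+x. f (Complex x (b * x / a + c * y)) \<partial>lborel) \<partial>lborel)"
      by (rule lborel_pair.Fubini') measurable
    also have "\<dots> = (\<integral>\<^sup>+y. ennreal \<bar>a\<bar> * (\<integral>\<^sup>+x. f (Complex (a * x - b * y) (b * x + a * y)) \<partial>lborel) \<partial>lborel)"
    proof (rule nn_integral_cong)
      fix y
      have "(\<integral>\<^sup>+x. f (Complex x (b * x / a + c * y)) \<partial>lborel) =
          ennreal \<bar>a\<bar> * (\<integral>\<^sup>+x. f (Complex (- b * y + a * x) (b * (- b * y + a * x) / a + c * y)) \<partial>lborel)"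
        by (rule nn_integral_real_affine[OF _ a]) measurable
      moreover have "b * (- b * y + a * x) / a + c * y = b * x + a * y" for x
        using a by (simp add: c_def field_simps power2_eq_square)
      moreover have "- b * y + a * x = a * x - b * y" for x by simp
      ultimately show "(\<integral>\<^sup>+x. f (Complex x (b * x / a + c * y)) \<partial>lborel) =
          ennreal \<bar>a\<bar> * (\<integral>\<^sup>+x. f (Complex (a * x - b * y) (b * x + a * y)) \<partial>lborel)"
        by (simp only:)
    qed
    also have "\<dots> = ennreal \<bar>a\<bar> * (\<integral>\<^sup>+y. (\<integral>\<^sup>+x. f (Complex (a * x - b * y) (b * x + a * y)) \<partial>lborel) \<partial>lborel)"
      by (rule nn_integral_cmult) measurable
    also have "(\<integral>\<^sup>+y. (\<integral>\<^sup>+x. f (Complex (a * x - b * y) (b * x + a * y)) \<partial>lborel) \<partial>lborel) =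
        (\<integral>\<^sup>+x. (\<integral>\<^sup>+y. f (Complex (a * x - b * y) (b * x + a * y)) \<partial>lborel) \<partial>lborel)"
      by (rule lborel_pair.Fubini') measurable
    finally have eq: "(\<integral>\<^sup>+x. (\<integral>\<^sup>+y. f (Complex x y) \<partial>lborel) \<partial>lborel) = ennreal \<bar>c\<bar> * (ennreal \<bar>a\<bar> *
        (\<integral>\<^sup>+x. (\<integral>\<^sup>+y. f (Complex (a * x - b * y) (b * x + a * y)) \<partial>lborel) \<partial>lborel))" .
    have "\<bar>c\<bar> * \<bar>a\<bar> = a\<^sup>2 + b\<^sup>2"
      using a by (simp add: c_def abs_mult[symmetric])
    then have "ennreal \<bar>c\<bar> * ennreal \<bar>a\<bar> = ennreal (a\<^sup>2 + b\<^sup>2)"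
      by (simp add: ennreal_mult[symmetric])
    then show ?thesis unfolding eq mult.assoc[symmetric] by simp
  qed
  finally show ?thesis unfolding rhs n .
qed

section \<open>One-dimensional substitution and moments\<close>

lemma incseq_mult_indicator:
  assumes "\<And>k l. k \<le> l \<Longrightarrow> S k \<subseteq> S l"
  shows "incseq (\<lambda>k x. (f x :: ennreal) * indicator (S k) x)"
proof (intro monoI le_funI mult_left_mono)
  show "(indicator (S k) x :: ennreal) \<le> indicator (S l) x" if "k \<le> l" for k l x
    using assms[OF that] by (auto simp: indicator_def)
qed simp

lemma SUP_indicator: "(indicator (\<Union>k. S k) x :: ennreal) = (SUP k. indicator (S k) x)"
proof (cases "x \<in> (\<Union>k. S k)")
  case True
  then obtain k where k: "x \<in> S k" by blast
  have "(SUP k. indicator (S k) x :: ennreal) \<ge> 1"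
    by (rule SUP_upper2[of k]) (use k in simp_all)
  moreover have "(SUP k. indicator (S k) x :: ennreal) \<le> 1"
    by (rule SUP_least) (simp split: split_indicator)
  ultimately have "(SUP k. indicator (S k) x :: ennreal) = 1"
    by (intro antisym)
  then show ?thesis using True by simp
next
  case False
  then have "x \<notin> S k" for k by blast
  then show ?thesis using False by simp
qed

text \<open>The substitution may blow up at the ends of the interval, as the cotangent does. Compact
  subintervals exhaust the open one, and monotone convergence passes to the limit on both
  sides.\<close>

lemma nn_integral_substitution_open:
  fixes f g g' :: "real \<Rightarrow> real"
  assumes [measurable]: "f \<in> borel_measurable borel" and AB: "A < B"
    and der: "\<And>x. A < x \<Longrightarrow> x < B \<Longrightarrow> (g has_real_derivative g' x) (at x)"
    and cont: "continuous_on {A<..<B} g'" and nn: "\<And>x. A < x \<Longrightarrow> x < B \<Longrightarrow> 0 \<le> g' x"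
  shows "(\<integral>\<^sup>+y. ennreal (f y) * indicator (g ` {A<..<B}) y \<partial>lborel) =
    (\<integral>\<^sup>+x. ennreal (f (g x) * g' x) * indicator {A<..<B} x \<partial>lborel)"
proof -
  \<comment> \<open>One third of the length makes already the first interval [A + d, B - d]
    nonempty.\<close>
  define d where "d = (B - A) / 3"
  define a where "a = (\<lambda>k::nat. A + d / real (Suc k))"
  define b where "b = (\<lambda>k::nat. B - d / real (Suc k))"
  have d: "d > 0" using AB by (simp add: d_def)
  have dk: "0 < d / real (Suc k)" "d / real (Suc k) \<le> d" for k
    using d by (simp_all add: divide_le_eq)
  have ab: "A < a k" "b k < B" "a k \<le> b k" for k
  proof -
    have "3 * d = B - A" by (simp add: d_def)
    then show "A < a k" "b k < B" "a k \<le> b k"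
      using dk[of k] unfolding a_def b_def by linarith+
  qed
  have mono: "a l \<le> a k" "b k \<le> b l" if "k \<le> l" for k l
    using that d unfolding a_def b_def by (simp_all add: frac_le)
  have cg: "continuous_on {A<..<B} g"
    using der by (intro continuous_at_imp_continuous_on ballI) (auto intro: DERIV_isCont)
  have gm: "g x \<le> g y" if "A < x" "x \<le> y" "y < B" for x y
  proof (rule DERIV_nonneg_imp_nondecreasing[OF that(2)])
    fix w assume "x \<le> w" "w \<le> y"
    then have "A < w" "w < B" using that by simp_all
    with der nn show "\<exists>D. (g has_real_derivative D) (at w) \<and> 0 \<le> D" by blast
  qed
  have ex: "\<exists>k. a k \<le> x \<and> x \<le> b k" if "A < x" "x < B" for x
  proof -
    have pos: "min (x - A) (B - x) / d > 0" using that d by simp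
    obtain k where k: "inverse (real (Suc k)) < min (x - A) (B - x) / d"
      using reals_Archimedean[OF pos] by auto
    have "d / real (Suc k) = d * inverse (real (Suc k))" by (simp only: divide_inverse)
    also have "\<dots> < d * (min (x - A) (B - x) / d)" by (rule mult_strict_left_mono[OF k d])
    also have "\<dots> = min (x - A) (B - x)" using d by simp
    finally have "A + d / real (Suc k) \<le> x \<and> x \<le> B - d / real (Suc k)" by linarith
    then show ?thesis unfolding a_def b_def by (rule exI)
  qed
  have sub: "{a k..b k} \<subseteq> {A<..<B}" for k
    using ab[of k] by auto
  have U1: "(SUP k. indicator {a k..b k} x :: ennreal) = indicator {A<..<B} x" for x
  proof -
    have "(\<Union>k. {a k..b k}) = {A<..<B}"
      using ex sub by fastforce
    then show ?thesis by (simp only: SUP_indicator[symmetric])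
  qed
  have U2: "(SUP k. indicator {g (a k)..g (b k)} y :: ennreal) = indicator (g ` {A<..<B}) y" for y
  proof -
    have "y \<in> (\<Union>k. {g (a k)..g (b k)})" if "y \<in> g ` {A<..<B}" for y
    proof -
      from that obtain x where x: "A < x" "x < B" "y = g x" by auto
      from ex[OF x(1,2)] obtain k where k: "a k \<le> x" "x \<le> b k" by blast
      have "g (a k) \<le> g x" "g x \<le> g (b k)"
        by (rule gm; use k ab[of k] x in linarith)+
      then show ?thesis using x by auto
    qed
    moreover have "y \<in> g ` {A<..<B}" if y: "y \<in> {g (a k)..g (b k)}" for y k
    proof -
      have "\<exists>x\<ge>a k. x \<le> b k \<and> g x = y"
        by (rule IVT') (use y ab(3)[of k] continuous_on_subset[OF cg sub] in simp_all)
      then obtain x where "a k \<le> x" "x \<le> b k" "g x = y" by blast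
      then show ?thesis using ab[of k] by (intro image_eqI[of _ _ x]) simp_all
    qed
    ultimately have "(\<Union>k. {g (a k)..g (b k)}) = g ` {A<..<B}" by blast
    then show ?thesis by (simp only: SUP_indicator[symmetric])
  qed
  have [measurable]: "(\<lambda>x. ennreal (f (g x) * g' x) * indicator {A<..<B} x) \<in> borel_measurable borel"
  proof -
    have [measurable]: "(\<lambda>x. if x \<in> {A<..<B} then g x else 0) \<in> borel_measurable borel"
        "(\<lambda>x. if x \<in> {A<..<B} then g' x else 0) \<in> borel_measurable borel"
      by (rule borel_measurable_continuous_on_if; use cg cont in simp)+
    have "(\<lambda>x. ennreal (f (if x \<in> {A<..<B} then g x else 0) * (if x \<in> {A<..<B} then g' x else 0)) * indicator {A<..<B} x) \<in> borel_measurable borel"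
      by measurable
    also have "(\<lambda>x. ennreal (f (if x \<in> {A<..<B} then g x else 0) * (if x \<in> {A<..<B} then g' x else 0)) * indicator {A<..<B} x)
      = (\<lambda>x. ennreal (f (g x) * g' x) * indicator {A<..<B} x)"
      by (auto simp: indicator_def)
    finally show ?thesis .
  qed
  have gs: "{g (a k)..g (b k)} \<subseteq> {g (a l)..g (b l)}" if "k \<le> l" for k l
    using mono[OF that] gm[of "a l" "a k"] gm[of "b k" "b l"] ab[of k] ab[of l] by auto
  have as: "{a k..b k} \<subseteq> {a l..b l}" if "k \<le> l" for k l
    using mono[OF that] by auto
  have "(\<integral>\<^sup>+y. ennreal (f y) * indicator (g ` {A<..<B}) y \<partial>lborel) =
      (\<integral>\<^sup>+y. (SUP k. ennreal (f y) * indicator {g (a k)..g (b k)} y) \<partial>lborel)"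
    unfolding U2[symmetric] by (simp add: SUP_mult_left_ennreal)
  also have "\<dots> = (SUP k. \<integral>\<^sup>+y. ennreal (f y) * indicator {g (a k)..g (b k)} y \<partial>lborel)"
    by (rule nn_integral_monotone_convergence_SUP)
       (simp_all add: incseq_mult_indicator[OF gs])
  also have "\<dots> = (SUP k. \<integral>\<^sup>+x. (ennreal (f (g x) * g' x) * indicator {A<..<B} x) * indicator {a k..b k} x \<partial>lborel)"
  proof (rule SUP_cong[OF refl])
    fix k
    have "(\<integral>\<^sup>+y. ennreal (f y) * indicator {g (a k)..g (b k)} y \<partial>lborel) =
        (\<integral>\<^sup>+y. ennreal (f y * indicator {g (a k)..g (b k)} y) \<partial>lborel)"
      by (intro nn_integral_cong) (simp add: indicator_def)
    also have "\<dots> = (\<integral>\<^sup>+x. ennreal (f (g x) * g' x * indicator {a k..b k} x) \<partial>lborel)"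
      using ab[of k] der nn sub[of k]
      by (intro nn_integral_substitution continuous_on_subset[OF cont]) (auto simp: set_borel_measurable_def)
    also have "\<dots> = (\<integral>\<^sup>+x. (ennreal (f (g x) * g' x) * indicator {A<..<B} x) * indicator {a k..b k} x \<partial>lborel)"
      using ab[of k] by (intro nn_integral_cong) (auto simp: indicator_def)
    finally show "(\<integral>\<^sup>+y. ennreal (f y) * indicator {g (a k)..g (b k)} y \<partial>lborel) =
      (\<integral>\<^sup>+x. (ennreal (f (g x) * g' x) * indicator {A<..<B} x) * indicator {a k..b k} x \<partial>lborel)" .
  qed
  also have "\<dots> = (\<integral>\<^sup>+x. (SUP k. (ennreal (f (g x) * g' x) * indicator {A<..<B} x) * indicator {a k..b k} x) \<partial>lborel)"
    by (rule nn_integral_monotone_convergence_SUP[symmetric])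
       (simp_all add: incseq_mult_indicator[OF as])
  also have "\<dots> = (\<integral>\<^sup>+x. ennreal (f (g x) * g' x) * indicator {A<..<B} x \<partial>lborel)"
    unfolding SUP_mult_left_ennreal[symmetric] U1
    by (intro nn_integral_cong) (simp add: indicator_def)
  finally show ?thesis .
qed

lemma nn_integral_even:
  fixes f :: "real \<Rightarrow> ennreal"
  assumes [measurable]: "f \<in> borel_measurable borel" and even: "\<And>x. f (- x) = f x"
  shows "(\<integral>\<^sup>+x. f x \<partial>lborel) = 2 * (\<integral>\<^sup>+x. f x * indicator {0..} x \<partial>lborel)"
proof -
  have "(\<integral>\<^sup>+x. f x \<partial>lborel) = (\<integral>\<^sup>+x. f x * indicator {0..} x + f x * indicator {..<0} x \<partial>lborel)"
    by (intro nn_integral_cong) (auto simp: indicator_def)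
  also have "\<dots> = (\<integral>\<^sup>+x. f x * indicator {0..} x \<partial>lborel) + (\<integral>\<^sup>+x. f x * indicator {..<0} x \<partial>lborel)"
    by (rule nn_integral_add) measurable
  also have "(\<integral>\<^sup>+x. f x * indicator {..<0} x \<partial>lborel) = (\<integral>\<^sup>+x. f (- x) * indicator {..<0} (- x) \<partial>lborel)"
    by (subst nn_integral_real_affine[where c = "-1" and t = 0]) simp_all
  also have "\<dots> = (\<integral>\<^sup>+x. f x * indicator {0..} x \<partial>lborel)"
    using AE_lborel_singleton[of "0::real"]
    by (intro nn_integral_cong_AE) (auto simp: even indicator_def elim!: eventually_mono)
  finally show ?thesis by (simp add: mult_2)
qed

lemma gaussian_moment5:
  assumes l: "l > 0"
  shows "(\<integral>\<^sup>+y. ennreal (\<bar>y\<bar> ^ 5 * exp (- l * y\<^sup>2)) \<partial>lborel) = ennreal (2 / l ^ 3)"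
proof -
  \<comment> \<open>The antiderivative comes from the variable x = l y^2, in which y^5 dy = x^2 dx /
    (2 l^3).\<close>
  define F where "F = (\<lambda>y. - ((l * y\<^sup>2)\<^sup>2 / 2 + l * y\<^sup>2 + 1) / l ^ 3 * exp (- (l * y\<^sup>2)))"
  have "(\<integral>\<^sup>+y. ennreal (\<bar>y\<bar> ^ 5 * exp (- l * y\<^sup>2)) * indicator {0..} y \<partial>lborel) =
      (\<integral>\<^sup>+y. ennreal (y ^ 5 * exp (- l * y\<^sup>2)) * indicator {0..} y \<partial>lborel)"
    by (intro nn_integral_cong) (auto simp: indicator_def)
  also have "\<dots> = ennreal (0 - F 0)"
  proof (rule nn_integral_FTC_atLeast)
    fix y :: real assume "0 \<le> y"
    show "(F has_real_derivative y ^ 5 * exp (- l * y\<^sup>2)) (at y)"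
    proof -
      have "((\<lambda>x. - (x\<^sup>2 / 2 + x + 1) / l ^ 3 * exp (- x)) has_real_derivative x\<^sup>2 / 2 / l ^ 3 * exp (- x)) (at x)" for x
        using l by (auto intro!: derivative_eq_intros simp: field_simps power2_eq_square)
      moreover have "((\<lambda>y. l * y\<^sup>2) has_real_derivative 2 * l * y) (at y)"
        by (auto intro!: derivative_eq_intros)
      ultimately have "(F has_real_derivative (l * y\<^sup>2)\<^sup>2 / 2 / l ^ 3 * exp (- (l * y\<^sup>2)) * (2 * l * y)) (at y)"
        unfolding F_def by (rule DERIV_chain2)
      moreover have e: "(l * y\<^sup>2)\<^sup>2 / 2 / l ^ 3 * (2 * l * y) = y ^ 5"
        using l by (simp add: field_simps eval_nat_numeral)
      have "a * w * b = a * b * w" for a b w :: real by (simp only: mult_ac)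
      from this[of "(l * y\<^sup>2)\<^sup>2 / 2 / l ^ 3" "exp (- (l * y\<^sup>2))" "2 * l * y"]
      have "(l * y\<^sup>2)\<^sup>2 / 2 / l ^ 3 * exp (- (l * y\<^sup>2)) * (2 * l * y) = y ^ 5 * exp (- l * y\<^sup>2)"
        by (simp only: e mult_minus_left)
      ultimately show ?thesis by (simp only:)
    qed
    show "0 \<le> y ^ 5 * exp (- l * y\<^sup>2)" using \<open>0 \<le> y\<close> by simp
  next
    have "((\<lambda>x::real. - (x ^ 2 / exp x / 2 + x ^ 1 / exp x + x ^ 0 / exp x) / l ^ 3) \<longlongrightarrow> - (0 / 2 + 0 + 0) / l ^ 3) at_top"
      by (intro tendsto_intros tendsto_power_div_exp_0) (use l in auto)
    moreover have "filterlim (\<lambda>y. l * y\<^sup>2) at_top at_top"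
      by (intro filterlim_tendsto_pos_mult_at_top[OF tendsto_const l] filterlim_pow_at_top filterlim_ident) simp
    ultimately have "((\<lambda>y. - ((l * y\<^sup>2) ^ 2 / exp (l * y\<^sup>2) / 2 + (l * y\<^sup>2) ^ 1 / exp (l * y\<^sup>2) + (l * y\<^sup>2) ^ 0 / exp (l * y\<^sup>2)) / l ^ 3)
        \<longlongrightarrow> - (0 / 2 + 0 + 0) / l ^ 3) at_top"
      by (rule filterlim_compose)
    moreover have "F = (\<lambda>y. - ((l * y\<^sup>2) ^ 2 / exp (l * y\<^sup>2) / 2 + (l * y\<^sup>2) ^ 1 / exp (l * y\<^sup>2) + (l * y\<^sup>2) ^ 0 / exp (l * y\<^sup>2)) / l ^ 3)"
    proof
      have "- (a ^ 2 / 2 + a + 1) / l ^ 3 * inverse w = - (a ^ 2 / w / 2 + a ^ 1 / w + a ^ 0 / w) / l ^ 3" for a w :: real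
        by (cases "w = 0") (simp_all add: field_simps)
      then show "F y = - ((l * y\<^sup>2) ^ 2 / exp (l * y\<^sup>2) / 2 + (l * y\<^sup>2) ^ 1 / exp (l * y\<^sup>2) + (l * y\<^sup>2) ^ 0 / exp (l * y\<^sup>2)) / l ^ 3" for y
        unfolding F_def exp_minus .
    qed
    ultimately show "(F \<longlongrightarrow> 0) at_top" by (simp only:) simp
  qed measurable
  also have "0 - F 0 = 1 / l ^ 3" by (simp add: F_def)
  finally have h: "(\<integral>\<^sup>+y. ennreal (\<bar>y\<bar> ^ 5 * exp (- l * y\<^sup>2)) * indicator {0..} y \<partial>lborel) = ennreal (1 / l ^ 3)" .
  have "(\<integral>\<^sup>+y. ennreal (\<bar>y\<bar> ^ 5 * exp (- l * y\<^sup>2)) \<partial>lborel) = 2 * ennreal (1 / l ^ 3)"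
    unfolding h[symmetric] by (rule nn_integral_even) simp_all
  then show ?thesis using l by (simp add: ennreal_mult'[symmetric] flip: ennreal_numeral)
qed

lemma nn_integral_inverse_sqrt_cube:
  "(\<integral>\<^sup>+q. ennreal (1 / sqrt (1 + q\<^sup>2) ^ 3) \<partial>lborel) = ennreal 2"
proof -
  \<comment> \<open>The antiderivative q / sqrt(1 + q^2) is written as sin(arctan q), which makes
    its limit evident.\<close>
  have "(\<integral>\<^sup>+q. ennreal (1 / sqrt (1 + q\<^sup>2) ^ 3) * indicator {0..} q \<partial>lborel) = ennreal (1 - sin (arctan 0))"
  proof (rule nn_integral_FTC_atLeast)
    fix q :: real
    have s: "sqrt (1 + q\<^sup>2) ^ 3 = sqrt (1 + q\<^sup>2) * (1 + q\<^sup>2)"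
      by (simp add: power3_eq_cube)
    show "((\<lambda>q. sin (arctan q)) has_real_derivative 1 / sqrt (1 + q\<^sup>2) ^ 3) (at q)"
      by (rule derivative_eq_intros refl)+ (simp add: cos_arctan s divide_inverse)
    have "((\<lambda>q. sin (arctan q)) \<longlongrightarrow> sin (pi / 2)) at_top"
      by (intro tendsto_sin tendsto_arctan_at_top)
    then show "((\<lambda>q. sin (arctan q)) \<longlongrightarrow> 1) at_top" by simp
  qed (simp_all, measurable)
  then show ?thesis
    by (subst nn_integral_even) (simp_all flip: ennreal_numeral)
qed

text \<open>In place of polar coordinates, x = |y| q separates the variables: the integral over y is
  the fifth Gaussian moment with parameter k (1 + q^2), and the integral of (1 + q^2)^(-3/2)
  remains, which is 2.\<close>

lemma radial_moment:
  assumes k: "k > 0"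
  shows "(\<integral>\<^sup>+v. ennreal (norm v ^ 3 * exp (- k * (norm v)\<^sup>2) * \<bar>Im v\<bar>) \<partial>lborel) = ennreal (4 / k ^ 3)"
proof -
  let ?f = "\<lambda>v. ennreal (norm v ^ 3 * exp (- k * (norm v)\<^sup>2) * \<bar>Im v\<bar>)"
  have "(\<integral>\<^sup>+v. ?f v \<partial>lborel) = (\<integral>\<^sup>+x. (\<integral>\<^sup>+y. ?f (Complex x y) \<partial>lborel) \<partial>lborel)"
    by (rule nn_integral_complex) measurable
  also have "\<dots> = (\<integral>\<^sup>+y. (\<integral>\<^sup>+x. ?f (Complex x y) \<partial>lborel) \<partial>lborel)"
    by (rule lborel_pair.Fubini') measurable
  also have "\<dots> = (\<integral>\<^sup>+y. (\<integral>\<^sup>+q. ennreal (sqrt (1 + q\<^sup>2) ^ 3 * (\<bar>y\<bar> ^ 5 * exp (- (k * (1 + q\<^sup>2)) * y\<^sup>2))) \<partial>lborel) \<partial>lborel)"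
  proof (rule nn_integral_cong)
    fix y :: real
    show "(\<integral>\<^sup>+x. ?f (Complex x y) \<partial>lborel) = (\<integral>\<^sup>+q. ennreal (sqrt (1 + q\<^sup>2) ^ 3 * (\<bar>y\<bar> ^ 5 * exp (- (k * (1 + q\<^sup>2)) * y\<^sup>2))) \<partial>lborel)"
    \<comment> \<open>At y = 0 the substitution degenerates, but both integrands vanish
      there.\<close>
    proof (cases "y = 0")
      case False
      then have y0: "\<bar>y\<bar> \<noteq> 0" by simp
      have "(\<integral>\<^sup>+x. ?f (Complex x y) \<partial>lborel) = ennreal \<bar>\<bar>y\<bar>\<bar> * (\<integral>\<^sup>+q. ?f (Complex (0 + \<bar>y\<bar> * q) y) \<partial>lborel)"
        by (rule nn_integral_real_affine[OF _ y0]) measurable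
      also have "\<dots> = (\<integral>\<^sup>+q. ennreal \<bar>y\<bar> * ?f (Complex (\<bar>y\<bar> * q) y) \<partial>lborel)"
        by (subst nn_integral_cmult) simp_all
      also have "\<dots> = (\<integral>\<^sup>+q. ennreal (sqrt (1 + q\<^sup>2) ^ 3 * (\<bar>y\<bar> ^ 5 * exp (- (k * (1 + q\<^sup>2)) * y\<^sup>2))) \<partial>lborel)"
      proof (rule nn_integral_cong)
        fix q :: real
        have sq: "(\<bar>y\<bar> * q)\<^sup>2 + y\<^sup>2 = y\<^sup>2 * (1 + q\<^sup>2)" by (simp add: power_mult_distrib algebra_simps)
        have n: "norm (Complex (\<bar>y\<bar> * q) y) = \<bar>y\<bar> * sqrt (1 + q\<^sup>2)"
          unfolding cmod_def complex.sel sq by (simp add: real_sqrt_mult)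
        have n2: "(norm (Complex (\<bar>y\<bar> * q) y))\<^sup>2 = y\<^sup>2 * (1 + q\<^sup>2)"
          unfolding n by (simp add: power_mult_distrib)
        have "\<bar>y\<bar> * (norm (Complex (\<bar>y\<bar> * q) y) ^ 3 * exp (- k * (norm (Complex (\<bar>y\<bar> * q) y))\<^sup>2) * \<bar>y\<bar>) =
           sqrt (1 + q\<^sup>2) ^ 3 * (\<bar>y\<bar> ^ 5 * exp (- (k * (1 + q\<^sup>2)) * y\<^sup>2))"
          unfolding n2 unfolding n by (simp add: power_mult_distrib eval_nat_numeral mult_ac)
        then show "ennreal \<bar>y\<bar> * ?f (Complex (\<bar>y\<bar> * q) y) = ennreal (sqrt (1 + q\<^sup>2) ^ 3 * (\<bar>y\<bar> ^ 5 * exp (- (k * (1 + q\<^sup>2)) * y\<^sup>2)))"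
          by (simp only: ennreal_mult'[symmetric] abs_ge_zero complex.sel)
      qed
      finally show ?thesis .
    qed simp
  qed
  also have "\<dots> = (\<integral>\<^sup>+q. (\<integral>\<^sup>+y. ennreal (sqrt (1 + q\<^sup>2) ^ 3 * (\<bar>y\<bar> ^ 5 * exp (- (k * (1 + q\<^sup>2)) * y\<^sup>2))) \<partial>lborel) \<partial>lborel)"
    by (rule lborel_pair.Fubini') measurable
  also have "\<dots> = (\<integral>\<^sup>+q. ennreal (2 / k ^ 3) * ennreal (1 / sqrt (1 + q\<^sup>2) ^ 3) \<partial>lborel)"
  proof (rule nn_integral_cong)
    fix q :: real
    define r where "r = sqrt (1 + q\<^sup>2)"
    have r: "r > 0" "1 + q\<^sup>2 = r\<^sup>2" by (simp_all add: r_def add_pos_nonneg)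
    have "(\<integral>\<^sup>+y. ennreal (r ^ 3 * (\<bar>y\<bar> ^ 5 * exp (- (k * r\<^sup>2) * y\<^sup>2))) \<partial>lborel) =
        (\<integral>\<^sup>+y. ennreal (r ^ 3) * ennreal (\<bar>y\<bar> ^ 5 * exp (- (k * r\<^sup>2) * y\<^sup>2)) \<partial>lborel)"
      using r by (intro nn_integral_cong ennreal_mult') simp
    also have "\<dots> = ennreal (r ^ 3) * (\<integral>\<^sup>+y. ennreal (\<bar>y\<bar> ^ 5 * exp (- (k * r\<^sup>2) * y\<^sup>2)) \<partial>lborel)"
      by (rule nn_integral_cmult) measurable
    also have "\<dots> = ennreal (r ^ 3) * ennreal (2 / (k * r\<^sup>2) ^ 3)"
      using k r by (subst gaussian_moment5) simp_all
    also have "\<dots> = ennreal (r ^ 3 * (2 / (k * r\<^sup>2) ^ 3))"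
      using r by (intro ennreal_mult'[symmetric]) simp
    also have "r ^ 3 * (2 / (k * r\<^sup>2) ^ 3) = 2 / k ^ 3 * (1 / r ^ 3)"
      using r k by (simp add: field_simps eval_nat_numeral)
    also have "ennreal \<dots> = ennreal (2 / k ^ 3) * ennreal (1 / r ^ 3)"
      using k by (intro ennreal_mult') simp
    finally show "(\<integral>\<^sup>+y. ennreal (sqrt (1 + q\<^sup>2) ^ 3 * (\<bar>y\<bar> ^ 5 * exp (- (k * (1 + q\<^sup>2)) * y\<^sup>2))) \<partial>lborel) =
        ennreal (2 / k ^ 3) * ennreal (1 / sqrt (1 + q\<^sup>2) ^ 3)"
      unfolding r_def[symmetric] unfolding r(2) .
  qed
  also have "\<dots> = ennreal (2 / k ^ 3) * (\<integral>\<^sup>+q. ennreal (1 / sqrt (1 + q\<^sup>2) ^ 3) \<partial>lborel)"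
    by (rule nn_integral_cmult) measurable
  also have "\<dots> = ennreal (2 / k ^ 3 * 2)"
    unfolding nn_integral_inverse_sqrt_cube using k by (intro ennreal_mult'[symmetric]) simp
  finally show ?thesis by simp
qed

text \<open>Rotation by the unit number |z| / z turns Im(v z) into |z| Im v and leaves the radial
  factors unchanged.\<close>

lemma radial_moment_rotated:
  assumes k: "k > 0"
  shows "(\<integral>\<^sup>+v. ennreal (norm v ^ 3 * exp (- k * (norm v)\<^sup>2) * \<bar>Im (v * z)\<bar>) \<partial>lborel) = ennreal (norm z * (4 / k ^ 3))"
proof (cases "z = 0")
  case False
  define w where "w = of_real (norm z) / z"
  have w: "norm w = 1" "w \<noteq> 0" using False by (simp_all add: w_def norm_divide)
  have "w * v * z = of_real (norm z) * v" for v using False by (simp add: w_def)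
  then have im: "Im (w * v * z) = norm z * Im v" for v by (simp only: Re_complex_of_real Im_complex_of_real times_complex.sel)
  have "(\<integral>\<^sup>+v. ennreal (norm v ^ 3 * exp (- k * (norm v)\<^sup>2) * \<bar>Im (v * z)\<bar>) \<partial>lborel) =
     (\<integral>\<^sup>+v. ennreal (norm (w * v) ^ 3 * exp (- k * (norm (w * v))\<^sup>2) * \<bar>Im (w * v * z)\<bar>) \<partial>lborel)"
    using w by (subst nn_integral_complex_mult[of _ w]) (simp_all)
  also have "\<dots> = (\<integral>\<^sup>+v. ennreal (norm z) * ennreal (norm v ^ 3 * exp (- k * (norm v)\<^sup>2) * \<bar>Im v\<bar>) \<partial>lborel)"
    unfolding im by (intro nn_integral_cong) (simp add: norm_mult w abs_mult ennreal_mult'[symmetric] mult_ac)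
  also have "\<dots> = ennreal (norm z) * (\<integral>\<^sup>+v. ennreal (norm v ^ 3 * exp (- k * (norm v)\<^sup>2) * \<bar>Im v\<bar>) \<partial>lborel)"
    by (rule nn_integral_cmult) measurable
  finally show ?thesis by (simp only: radial_moment[OF k] ennreal_mult'[symmetric] norm_ge_zero)
qed simp

text \<open>
  The factor \<open>min (- Im (v * z)) (- Im (v * (z - 1)))\<close> is the length of the set of heights at which
  a copy of a triangle with sides \<open>v\<close> and \<open>v * z\<close> has the side \<open>v\<close> above and the opposite vertex below
  the line. Averaging over \<open>v\<close> and \<open>- v\<close> turns the minimum into absolute values.
\<close>

lemma radial_min_integral:
  assumes k: "k > 0"
  shows "(\<integral>\<^sup>+v. ennreal (norm v ^ 3 * exp (- k * (norm v)\<^sup>2) * min (- Im (v * z)) (- Im (v * (z - 1)))) \<partial>lborel) =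
    ennreal ((norm z + norm (z - 1) - 1) / k ^ 3)"
proof -
  define E where "E = (\<lambda>v::complex. norm v ^ 3 * exp (- k * (norm v)\<^sup>2))"
  have E0: "E v \<ge> 0" for v by (simp add: E_def)
  have [measurable]: "E \<in> borel_measurable borel" unfolding E_def by measurable
  have im [measurable]: "(\<lambda>v. Im (v * c)) \<in> borel_measurable borel" for c
    by measurable
  let ?I = "\<integral>\<^sup>+v. ennreal (E v * min (- Im (v * z)) (- Im (v * (z - 1)))) \<partial>lborel"
  have neg: "?I = (\<integral>\<^sup>+v. ennreal (E v * min (Im (v * z)) (Im (v * (z - 1)))) \<partial>lborel)"
    by (subst nn_integral_complex_mult[of _ "- 1"]) (simp_all add: E_def)
  \<comment> \<open>With a = Im(v z) and b = Im(v (z - 1)), the identity 2 (max 0 (min (-a) (-b)) +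
    max 0 (min a b)) + |a - b| = |a| + |b| is integrated; \<open>neg\<close> says that both minima
    have the same integral. Everything stays additive because the integrals are extended reals,
    until \<open>?I\<close> is known to be finite.\<close>
  have "4 * ?I + ennreal (4 / k ^ 3) = 2 * (?I + ?I) + ennreal (4 / k ^ 3)"
    unfolding mult_2[symmetric] mult.assoc[symmetric] by simp
  also have "\<dots> = 2 * (?I + (\<integral>\<^sup>+v. ennreal (E v * min (Im (v * z)) (Im (v * (z - 1)))) \<partial>lborel)) +
      (\<integral>\<^sup>+v. ennreal (E v * \<bar>Im v\<bar>) \<partial>lborel)"
    using neg radial_moment[OF k] by (simp only: E_def)
  also have "\<dots> = (\<integral>\<^sup>+v. 2 * (ennreal (E v * min (- Im (v * z)) (- Im (v * (z - 1)))) +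
      ennreal (E v * min (Im (v * z)) (Im (v * (z - 1))))) + ennreal (E v * \<bar>Im v\<bar>) \<partial>lborel)"
    by (subst nn_integral_add, measurable, subst nn_integral_cmult, measurable, subst nn_integral_add, measurable)
  also have "\<dots> = (\<integral>\<^sup>+v. ennreal (E v * \<bar>Im (v * z)\<bar>) + ennreal (E v * \<bar>Im (v * (z - 1))\<bar>) \<partial>lborel)"
  proof (rule nn_integral_cong)
    fix v :: complex
    define a b where "a = Im (v * z)" and "b = Im (v * (z - 1))"
    have ab: "Im v = a - b" by (simp add: a_def b_def algebra_simps)
    have m: "ennreal (E v * m) = ennreal (E v * max 0 m)" for m
    proof (cases "m \<ge> 0")
      case False
      then have "E v * m \<le> 0" using E0[of v] by (simp add: mult_nonneg_nonpos)
      with False show ?thesis by (simp add: ennreal_neg max_def)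
    qed (simp add: max_def)
    have "2 * (max 0 (min (- a) (- b)) + max 0 (min a b)) + \<bar>a - b\<bar> = \<bar>a\<bar> + \<bar>b\<bar>"
      by (cases "a \<le> b"; cases "0 \<le> a"; cases "0 \<le> b"; simp add: max_def min_def)
    from arg_cong[OF this, of "\<lambda>x. E v * x"]
    have "2 * (E v * max 0 (min (- a) (- b)) + E v * max 0 (min a b)) + E v * \<bar>a - b\<bar> = E v * \<bar>a\<bar> + E v * \<bar>b\<bar>"
      by (simp add: algebra_simps)
    from arg_cong[OF this, of ennreal]
    have "2 * (ennreal (E v * max 0 (min (- a) (- b))) + ennreal (E v * max 0 (min a b))) + ennreal (E v * \<bar>a - b\<bar>)
       = ennreal (E v * \<bar>a\<bar>) + ennreal (E v * \<bar>b\<bar>)"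
      using E0[of v] by (simp add: ennreal_mult)
    then show "2 * (ennreal (E v * min (- Im (v * z)) (- Im (v * (z - 1)))) +
      ennreal (E v * min (Im (v * z)) (Im (v * (z - 1))))) + ennreal (E v * \<bar>Im v\<bar>) =
      ennreal (E v * \<bar>Im (v * z)\<bar>) + ennreal (E v * \<bar>Im (v * (z - 1))\<bar>)"
      unfolding ab a_def[symmetric] b_def[symmetric] m[of "min _ _"] .
  qed
  also have "\<dots> = (\<integral>\<^sup>+v. ennreal (E v * \<bar>Im (v * z)\<bar>) \<partial>lborel) + (\<integral>\<^sup>+v. ennreal (E v * \<bar>Im (v * (z - 1))\<bar>) \<partial>lborel)"
    by (rule nn_integral_add) measurable
  also have "\<dots> = ennreal ((norm z + norm (z - 1)) * (4 / k ^ 3))"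
    unfolding E_def radial_moment_rotated[OF k] using k by (simp add: ennreal_plus[symmetric] distrib_right add_divide_distrib del: ennreal_plus)
  finally have eq: "4 * ?I + ennreal (4 / k ^ 3) = ennreal ((norm z + norm (z - 1)) * (4 / k ^ 3))" .
  have "?I \<noteq> \<infinity>"
  proof
    assume "?I = \<infinity>"
    with eq show False by (simp add: ennreal_mult_top)
  qed
  then obtain i where i: "i \<ge> 0" "?I = ennreal i" by (cases ?I) auto
  have "ennreal (4 * i + 4 / k ^ 3) = 4 * ?I + ennreal (4 / k ^ 3)"
    unfolding i(2) using i(1) k by (simp add: ennreal_mult flip: ennreal_numeral)
  also note eq
  finally have "4 * i + 4 / k ^ 3 = (norm z + norm (z - 1)) * (4 / k ^ 3)"
    using i(1) k by (subst (asm) ennreal_inj) simp_all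
  then have "i = (norm z + norm (z - 1) - 1) / k ^ 3"
    using k by (simp add: field_simps)
  with i(2) show ?thesis by (simp add: E_def)
qed


text \<open>In the triangle 0, 1, z the angle at z is \<open>\<phi>\<close>, that at 1 is
  \<open>A - \<phi>\<close> and that at 0 is pi - A. By the law of sines the last factor is sin
  \<phi> times |z| + |z - 1| - 1.\<close>

definition shape_inner :: "real \<Rightarrow> real \<Rightarrow> real" where
  "shape_inner A \<phi> = sin A * sin (A - \<phi>) * (sin \<phi>)\<^sup>2 * (sin A + sin (A - \<phi>) - sin \<phi>)"

text \<open>Obtained by expanding sin(A - \<phi>) into P q - R p and integrating the monomials in p
  and q by \<open>sin_cos_moment_derivs\<close>.\<close>

definition shape_inner_antideriv :: "real \<Rightarrow> real \<Rightarrow> real" where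
  "shape_inner_antideriv A \<phi> = (let P = sin A; R = cos A; p = sin \<phi>; q = cos \<phi> in
     P * (P\<^sup>2 * p ^ 3 / 3 - P * R * (- q + q ^ 3 / 3) + P\<^sup>2 * (\<phi> / 8 - p * q * (1 - 2 * p\<^sup>2) / 8)
       - P * R * p ^ 4 / 2 + R\<^sup>2 * (3 * \<phi> / 8 - p * q * (3 + 2 * p\<^sup>2) / 8) - P * p ^ 4 / 4
       + R * (3 * \<phi> / 8 - p * q * (3 + 2 * p\<^sup>2) / 8)))"

lemma sin_cos_moment_derivs:
  "((\<lambda>x. - cos x + cos x ^ 3 / 3) has_real_derivative sin x ^ 3) (at x)"
  "((\<lambda>x. sin x ^ 3 / 3) has_real_derivative cos x * (sin x)\<^sup>2) (at x)"
  "((\<lambda>x. sin x ^ 4 / 4) has_real_derivative cos x * sin x ^ 3) (at x)"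
  "((\<lambda>x. x / 8 - sin x * cos x * (1 - 2 * (sin x)\<^sup>2) / 8) has_real_derivative (cos x)\<^sup>2 * (sin x)\<^sup>2) (at x)"
  "((\<lambda>x. 3 * x / 8 - sin x * cos x * (3 + 2 * (sin x)\<^sup>2) / 8) has_real_derivative sin x ^ 4) (at x)"
  "((\<lambda>x. x / 2 - sin x * cos x / 2) has_real_derivative (sin x)\<^sup>2) (at x)"
proof -
  define p q where "p = sin x" and "q = cos x"
  have pq: "q\<^sup>2 = 1 - p\<^sup>2" unfolding p_def q_def by (simp add: cos_squared_eq)
  have q3: "q * q * w = (1 - p\<^sup>2) * w" for w using pq by (simp add: power2_eq_square)
  have "((\<lambda>x. - cos x + cos x ^ 3 / 3) has_real_derivative p - q\<^sup>2 * p) (at x)"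
    unfolding p_def q_def by (auto intro!: derivative_eq_intros)
  moreover have "p - q\<^sup>2 * p = p ^ 3" unfolding pq by (simp add: algebra_simps power2_eq_square power3_eq_cube)
  ultimately show "((\<lambda>x. - cos x + cos x ^ 3 / 3) has_real_derivative sin x ^ 3) (at x)"
    by (simp add: p_def)
  show "((\<lambda>x. sin x ^ 3 / 3) has_real_derivative cos x * (sin x)\<^sup>2) (at x)"
    by (auto intro!: derivative_eq_intros)
  show "((\<lambda>x. sin x ^ 4 / 4) has_real_derivative cos x * sin x ^ 3) (at x)"
    by (auto intro!: derivative_eq_intros)
  have d1: "((\<lambda>x. x / 8 - sin x * cos x * (1 - 2 * (sin x)\<^sup>2) / 8) has_real_derivative
      1 / 8 - ((q * q - p * p) * (1 - 2 * p\<^sup>2) + p * q * (- (4 * p * q))) / 8) (at x)"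
    unfolding p_def q_def by (auto intro!: derivative_eq_intros simp: field_simps)
  have "1 / 8 - ((q * q - p * p) * (1 - 2 * p\<^sup>2) + p * q * (- (4 * p * q))) / 8 =
      1 / 8 - ((q\<^sup>2 - p\<^sup>2) * (1 - 2 * p\<^sup>2) - 4 * p\<^sup>2 * q\<^sup>2) / 8"
    by (simp add: power2_eq_square)
  also have "\<dots> = q\<^sup>2 * p\<^sup>2" unfolding pq by (simp add: field_simps power2_eq_square)
  finally show "((\<lambda>x. x / 8 - sin x * cos x * (1 - 2 * (sin x)\<^sup>2) / 8) has_real_derivative (cos x)\<^sup>2 * (sin x)\<^sup>2) (at x)"
    using d1 by (simp only: p_def q_def)
  have d2: "((\<lambda>x. 3 * x / 8 - sin x * cos x * (3 + 2 * (sin x)\<^sup>2) / 8) has_real_derivative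
      3 / 8 - ((q * q - p * p) * (3 + 2 * p\<^sup>2) + p * q * (4 * p * q)) / 8) (at x)"
    unfolding p_def q_def by (auto intro!: derivative_eq_intros simp: field_simps)
  have "3 / 8 - ((q * q - p * p) * (3 + 2 * p\<^sup>2) + p * q * (4 * p * q)) / 8 =
      3 / 8 - ((q\<^sup>2 - p\<^sup>2) * (3 + 2 * p\<^sup>2) + 4 * p\<^sup>2 * q\<^sup>2) / 8"
    by (simp add: power2_eq_square)
  also have "\<dots> = p ^ 4" unfolding pq by (simp add: field_simps power2_eq_square power4_eq_xxxx)
  finally show "((\<lambda>x. 3 * x / 8 - sin x * cos x * (3 + 2 * (sin x)\<^sup>2) / 8) has_real_derivative sin x ^ 4) (at x)"
    using d2 by (simp only: p_def q_def)
  have "((\<lambda>x. x / 2 - sin x * cos x / 2) has_real_derivative 1 / 2 - (q * q - p * p) / 2) (at x)"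
    unfolding p_def q_def by (auto intro!: derivative_eq_intros simp: field_simps)
  moreover have "1 / 2 - (q * q - p * p) / 2 = p\<^sup>2"
    using pq by (simp add: field_simps power2_eq_square)
  ultimately show "((\<lambda>x. x / 2 - sin x * cos x / 2) has_real_derivative (sin x)\<^sup>2) (at x)"
    by (simp add: p_def)
qed

lemma shape_inner_deriv:
  "(shape_inner_antideriv A has_real_derivative shape_inner A \<phi>) (at \<phi>)"
proof -
  define P R p q where "P = sin A" and "R = cos A" and "p = sin \<phi>" and "q = cos \<phi>"
  have F: "shape_inner_antideriv A = (\<lambda>x. P * (P\<^sup>2 * (sin x ^ 3 / 3) - P * R * (- cos x + cos x ^ 3 / 3)
      + P\<^sup>2 * (x / 8 - sin x * cos x * (1 - 2 * (sin x)\<^sup>2) / 8) - 2 * P * R * (sin x ^ 4 / 4)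
      + R\<^sup>2 * (3 * x / 8 - sin x * cos x * (3 + 2 * (sin x)\<^sup>2) / 8) - P * (sin x ^ 4 / 4)
      + R * (3 * x / 8 - sin x * cos x * (3 + 2 * (sin x)\<^sup>2) / 8)))"
    unfolding shape_inner_antideriv_def Let_def P_def R_def by (rule ext) simp
  have d: "(shape_inner_antideriv A has_real_derivative P * (P\<^sup>2 * (q * p\<^sup>2) - P * R * p ^ 3
      + P\<^sup>2 * (q\<^sup>2 * p\<^sup>2) - 2 * P * R * (q * p ^ 3) + R\<^sup>2 * p ^ 4 - P * (q * p ^ 3) + R * p ^ 4)) (at \<phi>)"
    unfolding F p_def q_def
    by (intro DERIV_cmult DERIV_add DERIV_diff sin_cos_moment_derivs)
  have e: "P * (P\<^sup>2 * (q * p\<^sup>2) - P * R * p ^ 3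
      + P\<^sup>2 * (q\<^sup>2 * p\<^sup>2) - 2 * P * R * (q * p ^ 3) + R\<^sup>2 * p ^ 4 - P * (q * p ^ 3) + R * p ^ 4) =
      P * (P * q - R * p) * p\<^sup>2 * (P + (P * q - R * p) - p)"
    by (simp add: algebra_simps eval_nat_numeral)
  have s: "sin (A - \<phi>) = P * q - R * p" by (simp add: sin_diff P_def R_def p_def q_def)
  show ?thesis
    using d unfolding e shape_inner_def s P_def[symmetric] p_def[symmetric] .
qed

text \<open>The last factor is nonnegative by the triangle inequality, here in the form sin \<phi>
  \<le> sin A + sin(A - \<phi>).\<close>

lemma shape_inner_nonneg:
  assumes "0 \<le> \<phi>" "\<phi> \<le> A" "A \<le> pi"
  shows "0 \<le> shape_inner A \<phi>"
proof -
  have s: "0 \<le> sin A" "0 \<le> sin (A - \<phi>)" "0 \<le> sin \<phi>"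
    using assms by (auto intro!: sin_ge_zero)
  have "sin \<phi> = sin A * cos (A - \<phi>) - cos A * sin (A - \<phi>)"
    using sin_diff[of A "A - \<phi>"] by simp
  moreover have "sin A * cos (A - \<phi>) \<le> sin A * 1" "- cos A * sin (A - \<phi>) \<le> 1 * sin (A - \<phi>)"
    using s cos_ge_minus_one[of A] by (intro mult_left_mono mult_right_mono; simp)+
  ultimately have "sin \<phi> \<le> sin A + sin (A - \<phi>)" by simp
  then show ?thesis unfolding shape_inner_def using s by simp
qed

definition shape_outer :: "real \<Rightarrow> real" where
  "shape_outer A = shape_inner_antideriv A A - shape_inner_antideriv A 0"

lemma shape_outer_nonneg:
  assumes "0 \<le> A" "A \<le> pi"
  shows "0 \<le> shape_outer A"
proof -
  have "shape_inner_antideriv A 0 \<le> shape_inner_antideriv A A"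
    by (rule DERIV_nonneg_imp_nondecreasing[OF assms(1)])
       (use assms shape_inner_deriv shape_inner_nonneg in blast)
  then show ?thesis by (simp add: shape_outer_def)
qed

lemma nn_integral_shape_inner:
  assumes "0 \<le> A" "A \<le> pi"
  shows "(\<integral>\<^sup>+\<phi>. ennreal (shape_inner A \<phi>) * indicator {0..A} \<phi> \<partial>lborel) = ennreal (shape_outer A)"
  unfolding shape_outer_def
proof (rule nn_integral_FTC_Icc)
  show "shape_inner A \<in> borel_measurable borel"
    unfolding shape_inner_def[abs_def] by measurable
qed (use assms shape_inner_deriv shape_inner_nonneg in auto)

text \<open>Reducing by cos^2 = 1 - sin^2 leaves A outside the trigonometric functions only as one
  linear factor, so a single integration by parts settles the outer integral.\<close>

lemma shape_outer_eq:
  "shape_outer A = A * (sin A ^ 3 / 8 + 3 * sin A * (cos A)\<^sup>2 / 8 + 3 * sin A * cos A / 8)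
    + 7 / 24 * (sin A)\<^sup>2 - 5 / 24 * sin A ^ 4 - 25 / 24 * (sin A)\<^sup>2 * cos A"
proof -
  define P R where "P = sin A" and "R = cos A"
  have pr: "R\<^sup>2 = 1 - P\<^sup>2" unfolding P_def R_def by (simp add: cos_squared_eq)
  have r3: "R ^ 3 = R * (1 - P\<^sup>2)" using pr by (simp add: power3_eq_cube power2_eq_square)
  have r4: "R ^ 4 = (1 - P\<^sup>2)\<^sup>2" using pr by (simp add: power4_eq_xxxx power2_eq_square)
  have "shape_outer A = P * (P\<^sup>2 * P ^ 3 / 3 - P * R * (- R + R ^ 3 / 3) + P\<^sup>2 * (A / 8 - P * R * (1 - 2 * P\<^sup>2) / 8)
       - P * R * P ^ 4 / 2 + R\<^sup>2 * (3 * A / 8 - P * R * (3 + 2 * P\<^sup>2) / 8) - P * P ^ 4 / 4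
       + R * (3 * A / 8 - P * R * (3 + 2 * P\<^sup>2) / 8)) - P * (P * R * (2 / 3))"
    unfolding shape_outer_def shape_inner_antideriv_def Let_def P_def R_def by simp
  also have "\<dots> = A * (P ^ 3 / 8 + 3 * P * R\<^sup>2 / 8 + 3 * P * R / 8)
      + P ^ 6 / 12 + P\<^sup>2 * R\<^sup>2 - P\<^sup>2 * R ^ 4 / 3 - P ^ 4 * R * (1 - 2 * P\<^sup>2) / 8 - P ^ 6 * R / 2
      - P\<^sup>2 * R ^ 3 * (3 + 2 * P\<^sup>2) / 8 - P\<^sup>2 * R\<^sup>2 * (3 + 2 * P\<^sup>2) / 8 - P\<^sup>2 * R * (2 / 3)"
    by (simp add: field_simps eval_nat_numeral)
  also have "\<dots> = A * (P ^ 3 / 8 + 3 * P * R\<^sup>2 / 8 + 3 * P * R / 8)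
    + 7 / 24 * P\<^sup>2 - 5 / 24 * P ^ 4 - 25 / 24 * P\<^sup>2 * R"
  proof -
    have "P ^ 6 / 12 + P\<^sup>2 * R\<^sup>2 - P\<^sup>2 * R ^ 4 / 3 - P ^ 4 * R * (1 - 2 * P\<^sup>2) / 8 - P ^ 6 * R / 2
      - P\<^sup>2 * R ^ 3 * (3 + 2 * P\<^sup>2) / 8 - P\<^sup>2 * R\<^sup>2 * (3 + 2 * P\<^sup>2) / 8 - P\<^sup>2 * R * (2 / 3)
      = 7 / 24 * P\<^sup>2 - 5 / 24 * P ^ 4 - 25 / 24 * P\<^sup>2 * R"
      unfolding r3 r4 pr by (simp add: field_simps eval_nat_numeral)
    then show ?thesis by linarith
  qed
  finally show ?thesis by (simp add: P_def R_def)
qed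

lemma nn_integral_shape_outer:
  "(\<integral>\<^sup>+A. ennreal (shape_outer A) * indicator {0..pi} A \<partial>lborel) = ennreal (35 * pi / 192)"
proof -
  \<comment> \<open>\<open>W\<close> is an antiderivative of the factor of A in
    \<open>shape_outer_eq\<close> and \<open>V\<close> one of \<open>W\<close>, so
    \<open>x * W x - V x\<close> is the integration by parts.\<close>
  define W where "W = (\<lambda>x. - cos x / 8 - cos x ^ 3 / 12 + 3 / 16 * (sin x)\<^sup>2 :: real)"
  define V where "V = (\<lambda>x. - sin x / 8 - (sin x - sin x ^ 3 / 3) / 12 + 3 / 16 * (x / 2 - sin x * cos x / 2) :: real)"
  define E where "E = (\<lambda>x. x * W x - V x + 7 / 24 * (x / 2 - sin x * cos x / 2)
    - 5 / 24 * (3 * x / 8 - sin x * cos x * (3 + 2 * (sin x)\<^sup>2) / 8) - 25 / 24 * (sin x ^ 3 / 3))"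
  have W: "(W has_real_derivative sin x ^ 3 / 8 + 3 * sin x * (cos x)\<^sup>2 / 8 + 3 * sin x * cos x / 8) (at x)" for x
  proof -
    have "(W has_real_derivative sin x / 8 + (cos x)\<^sup>2 * sin x / 4 + 3 / 8 * sin x * cos x) (at x)"
      unfolding W_def by (auto intro!: derivative_eq_intros simp: field_simps)
    moreover have "sin x ^ 3 = sin x * (1 - (cos x)\<^sup>2)"
      by (simp add: power3_eq_cube power2_eq_square[symmetric] sin_squared_eq mult.assoc)
    then have "sin x / 8 + (cos x)\<^sup>2 * sin x / 4 + 3 / 8 * sin x * cos x =
      sin x ^ 3 / 8 + 3 * sin x * (cos x)\<^sup>2 / 8 + 3 * sin x * cos x / 8"
      by (simp add: field_simps)
    ultimately show ?thesis by simp
  qed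
  have V: "(V has_real_derivative W x) (at x)" for x
  proof -
    have "(V has_real_derivative - cos x / 8 - (cos x - cos x * (sin x)\<^sup>2) / 12 + 3 / 16 * (sin x)\<^sup>2) (at x)"
      unfolding V_def
      by (intro DERIV_add DERIV_diff DERIV_cmult DERIV_cdivide DERIV_minus sin_cos_moment_derivs DERIV_sin)
    moreover have "cos x - cos x * (sin x)\<^sup>2 = cos x ^ 3"
    proof -
      have "cos x - cos x * (sin x)\<^sup>2 = cos x * (1 - (sin x)\<^sup>2)" by (simp add: right_diff_distrib)
      then show ?thesis by (simp only: cos_squared_eq[symmetric]) (simp add: power2_eq_square power3_eq_cube)
    qed
    ultimately show ?thesis by (simp add: W_def)
  qed
  have E: "(E has_real_derivative shape_outer x) (at x)" for x
  proof -
    have "((\<lambda>x. x * W x) has_real_derivative 1 * W x + (sin x ^ 3 / 8 + 3 * sin x * (cos x)\<^sup>2 / 8 + 3 * sin x * cos x / 8) * x) (at x)"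
      by (rule DERIV_mult[OF DERIV_ident W])
    then have "(E has_real_derivative 1 * W x + (sin x ^ 3 / 8 + 3 * sin x * (cos x)\<^sup>2 / 8 + 3 * sin x * cos x / 8) * x
       - W x + 7 / 24 * (sin x)\<^sup>2 - 5 / 24 * (sin x ^ 4) - 25 / 24 * (cos x * (sin x)\<^sup>2)) (at x)"
      unfolding E_def
      by (intro DERIV_add DERIV_diff DERIV_cmult sin_cos_moment_derivs V)
    then show ?thesis unfolding shape_outer_eq by (simp add: mult_ac)
  qed
  have m: "shape_outer \<in> borel_measurable borel"
    unfolding shape_outer_eq[abs_def] by measurable
  have "(\<integral>\<^sup>+A. ennreal (shape_outer A) * indicator {0..pi} A \<partial>lborel) = ennreal (E pi - E 0)"
    by (rule nn_integral_FTC_Icc[OF m]) (use E shape_outer_nonneg in auto)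
  \<comment> \<open>Over the denominator 192, the terms with \<open>x * W x\<close>,
    \<open>V\<close>, sin^2 and sin^4 contribute 40, -18, 28 and -15 times pi; the sin^3 term
    vanishes.\<close>
  also have "E pi - E 0 = 35 * pi / 192"
    by (simp add: E_def W_def V_def field_simps)
  finally show ?thesis .
qed

text \<open>With r = (|z| |z - 1|)^2 / (4 (Im z)^2), the squared circumradius of 0, 1, z, this is
  (|z| + |z - 1| - 1) / r^3: the dependence on the shape that \<open>radial_min_integral\<close>
  leaves for k proportional to r.\<close>

definition shape_density :: "complex \<Rightarrow> real" where
  "shape_density z = 64 * Im z ^ 6 * (norm z + norm (z - 1) - 1) / (norm z * norm (z - 1)) ^ 6"

lemma shape_density_measurable [measurable]: "shape_density \<in> borel_measurable borel"
  unfolding shape_density_def[abs_def] by measurable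

text \<open>
  A point \<open>Complex (y * a) y\<close> with \<open>a = - cot A\<close> is seen from \<open>0\<close> under the angle \<open>A\<close> against the
  negative real axis; \<open>\<psi>\<close> and \<open>A - \<psi>\<close> are the angles of the triangle \<open>0, 1, z\<close> at \<open>1\<close> and at \<open>z\<close>.
\<close>

lemma nn_integral_shape_line:
  assumes A: "0 < A" "A < pi"
  shows "(\<integral>\<^sup>+y. ennreal (y * shape_density (Complex (y * (- cos A / sin A)) y)) * indicator {0<..} y \<partial>lborel) =
    ennreal (64 * (sin A)\<^sup>2 * shape_outer A)"
proof -
  \<comment> \<open>The height of z as a function of the angle \<open>\<psi>\<close> at 1: it is |z|
    sin A, and |z| is given by the law of sines.\<close>
  define g where "g = (\<lambda>\<psi>. sin A * sin \<psi> / sin (A - \<psi>))"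
  define g' where "g' = (\<lambda>\<psi>. (sin A)\<^sup>2 / (sin (A - \<psi>))\<^sup>2)"
  define f where "f = (\<lambda>y. y * shape_density (Complex (y * (- cos A / sin A)) y))"
  have sA: "sin A > 0" using A by (simp add: sin_gt_zero)
  have sp: "sin \<psi> > 0" "sin (A - \<psi>) > 0" if "0 < \<psi>" "\<psi> < A" for \<psi>
    using that A by (auto intro!: sin_gt_zero)
  have img: "g ` {0<..<A} = {0<..}"
  proof (intro equalityI subsetI)
    fix y assume "y \<in> g ` {0<..<A}"
    then show "y \<in> {0<..}" using sp sA by (auto simp: g_def)
  next
    fix y :: real assume "y \<in> {0<..}"
    then have y: "y > 0" by simp
    \<comment> \<open>The height y is attained where cot \<psi> = cot A + 1 / y. Passing to the
      complementary angles \<open>B\<close> of A and \<open>\<theta>\<close> of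
      \<open>\<psi>\<close> turns cotangents into tangents and allows the use of arctan.\<close>
    define B where "B = pi / 2 - A"
    define \<tau> where "\<tau> = cos A / sin A + 1 / y"
    define \<theta> where "\<theta> = arctan \<tau>"
    have B: "- (pi / 2) < B" "B < pi / 2" using A by (simp_all add: B_def)
    have tB: "tan B = cos A / sin A" by (simp add: tan_def B_def sin_diff cos_diff)
    have "B = arctan (tan B)" using B by (simp add: arctan_tan)
    also have "\<dots> < \<theta>" unfolding \<theta>_def arctan_less_iff tB \<tau>_def using y by simp
    finally have "B < \<theta>" .
    moreover have th: "\<theta> < pi / 2" unfolding \<theta>_def by (rule arctan_ubound)
    moreover define \<psi> where "\<psi> = pi / 2 - \<theta>"
    ultimately have psi: "0 < \<psi>" "\<psi> < A" by (simp_all add: B_def)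
    have ct: "cos \<theta> > 0" unfolding \<theta>_def by (simp add: cos_arctan add_pos_nonneg)
    have "sin \<theta> = \<tau> * cos \<theta>" unfolding \<theta>_def by (simp add: sin_arctan cos_arctan)
    then have "sin (A - \<psi>) = sin A * (\<tau> * cos \<theta>) - cos A * cos \<theta>"
      by (simp add: \<psi>_def sin_diff cos_diff)
    also have "\<dots> = cos \<theta> * sin A / y"
      using sA y by (simp add: \<tau>_def field_simps)
    finally have "g \<psi> = y"
      using sA y ct by (simp add: g_def \<psi>_def sin_diff)
    with psi show "y \<in> g ` {0<..<A}" by (intro image_eqI[of _ _ \<psi>]) simp_all
  qed
  have "(\<integral>\<^sup>+y. ennreal (f y) * indicator {0<..} y \<partial>lborel) = (\<integral>\<^sup>+y. ennreal (f y) * indicator (g ` {0<..<A}) y \<partial>lborel)"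
    unfolding img ..
  also have "\<dots> = (\<integral>\<^sup>+\<psi>. ennreal (f (g \<psi>) * g' \<psi>) * indicator {0<..<A} \<psi> \<partial>lborel)"
  proof (rule nn_integral_substitution_open)
    show "f \<in> borel_measurable borel" unfolding f_def by measurable
    show "(g has_real_derivative g' \<psi>) (at \<psi>)" if "0 < \<psi>" "\<psi> < A" for \<psi>
    proof -
      have n: "sin (A - \<psi>) \<noteq> 0" using sp[OF that] by simp
      have "(g has_real_derivative (sin A * cos \<psi> * sin (A - \<psi>) - sin A * sin \<psi> * (cos (A - \<psi>) * (- 1))) / (sin (A - \<psi>) * sin (A - \<psi>))) (at \<psi>)"
        unfolding g_def using n by (auto intro!: derivative_eq_intros)
      moreover have "sin A * cos \<psi> * sin (A - \<psi>) - sin A * sin \<psi> * (cos (A - \<psi>) * (- 1)) = sin A * sin A"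
      proof -
        have "sin A = sin \<psi> * cos (A - \<psi>) + cos \<psi> * sin (A - \<psi>)"
          using sin_add[of \<psi> "A - \<psi>"] by simp
        moreover have "a * c * p - a * k * (d * (- 1)) = a * (k * d + c * p)" for a c p k d :: real
          by (simp add: algebra_simps)
        ultimately show ?thesis by (simp only:)
      qed
      ultimately show ?thesis by (simp add: g'_def power2_eq_square)
    qed
    show "continuous_on {0<..<A} g'"
      unfolding g'_def
    proof (intro continuous_intros ballI)
      fix \<psi> assume "\<psi> \<in> {0<..<A}"
      then have "sin (A - \<psi>) > 0" using sp(2)[of \<psi>] by simp
      then show "(sin (A - \<psi>))\<^sup>2 \<noteq> 0" by simp
    qed
    show "0 \<le> g' \<psi>" for \<psi> by (simp add: g'_def)
  qed (use A in auto)
  also have "\<dots> = (\<integral>\<^sup>+\<psi>. ennreal (64 * (sin A)\<^sup>2 * shape_inner A (A - \<psi>)) * indicator {0<..<A} \<psi> \<partial>lborel)"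
  proof (rule nn_integral_cong)
    fix \<psi>
    show "ennreal (f (g \<psi>) * g' \<psi>) * indicator {0<..<A} \<psi> = ennreal (64 * (sin A)\<^sup>2 * shape_inner A (A - \<psi>)) * indicator {0<..<A} \<psi>"
    proof (cases "0 < \<psi> \<and> \<psi> < A")
      case True
      define P k p c where "P = sin A" and "k = sin \<psi>" and "p = sin (A - \<psi>)" and "c = cos \<psi>"
      have pos: "P > 0" "k > 0" "p > 0" using sA sp True by (simp_all add: P_def k_def p_def)
      have pe: "p = P * c - cos A * k" by (simp add: p_def P_def c_def k_def sin_diff)
      define z where "z = Complex (g \<psi> * (- cos A / sin A)) (g \<psi>)"
      have gp: "g \<psi> = P * k / p" by (simp add: g_def P_def k_def p_def)
      have re: "g \<psi> * (- cos A / sin A) = - cos A * k / p"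
        using pos by (simp add: gp P_def[symmetric])
      have re1: "g \<psi> * (- cos A / sin A) - 1 = - P * c / p"
      proof -
        have "- cos A * k / p - 1 = (- cos A * k - p) / p" using pos by (simp add: diff_divide_distrib)
        moreover have "- cos A * k - p = - P * c" by (simp add: pe)
        ultimately show ?thesis unfolding re by (simp only:)
      qed
      have "(norm z)\<^sup>2 = (k / p)\<^sup>2"
      proof -
        have "(norm z)\<^sup>2 = (- cos A * k / p)\<^sup>2 + (P * k / p)\<^sup>2"
          unfolding z_def cmod_power2 complex.sel re by (simp only: gp)
        also have "\<dots> = ((cos A)\<^sup>2 + P\<^sup>2) * (k / p)\<^sup>2" by (simp add: power_mult_distrib power_divide algebra_simps add_divide_distrib)
        finally show ?thesis by (simp add: P_def)
      qed
      then have nz: "norm z = k / p" using pos by (simp add: power2_eq_iff_nonneg)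
      have "(norm (z - 1))\<^sup>2 = (P / p)\<^sup>2"
      proof -
        have "(norm (z - 1))\<^sup>2 = (- P * c / p)\<^sup>2 + (P * k / p)\<^sup>2"
          unfolding cmod_power2 z_def minus_complex.sel complex.sel one_complex.sel re1 by (simp add: gp)
        also have "\<dots> = (c\<^sup>2 + k\<^sup>2) * (P / p)\<^sup>2" by (simp add: power_mult_distrib power_divide algebra_simps add_divide_distrib)
        finally show ?thesis by (simp add: c_def k_def)
      qed
      then have nz1: "norm (z - 1) = P / p" using pos by (simp add: power2_eq_iff_nonneg)
      have "f (g \<psi>) * g' \<psi> = (P * k / p) * (64 * (P * k / p) ^ 6 * (k / p + P / p - 1) / (k / p * (P / p)) ^ 6) * (P\<^sup>2 / p\<^sup>2)"
        unfolding f_def z_def[symmetric] shape_density_def nz nz1 g'_def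
        by (simp add: z_def gp P_def p_def)
      also have "\<dots> = 64 * P\<^sup>2 * (P * k * p\<^sup>2 * (P + k - p))"
      proof -
        have "(P * k / p) ^ 6 / (k / p * (P / p)) ^ 6 = p ^ 6"
          unfolding power_divide[symmetric] using pos by (intro arg_cong[where f = "\<lambda>x. x ^ 6"]) (simp add: field_simps)
        then have e: "64 * (P * k / p) ^ 6 * (k / p + P / p - 1) / (k / p * (P / p)) ^ 6 = 64 * p ^ 6 * (k / p + P / p - 1)"
          by (metis (no_types, lifting) mult.commute times_divide_eq_right)
        show ?thesis unfolding e using pos by (simp add: field_simps eval_nat_numeral)
      qed
      also have "\<dots> = 64 * (sin A)\<^sup>2 * shape_inner A (A - \<psi>)"
        by (simp add: shape_inner_def P_def k_def p_def)
      finally show ?thesis by simp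
    qed simp
  qed
  also have "\<dots> = (\<integral>\<^sup>+\<phi>. ennreal (64 * (sin A)\<^sup>2 * shape_inner A \<phi>) * indicator {0<..<A} (A - \<phi>) \<partial>lborel)"
  proof -
    have [measurable]: "shape_inner A \<in> borel_measurable borel"
      unfolding shape_inner_def[abs_def] by measurable
    show ?thesis
      by (subst nn_integral_real_affine[where t = A and c = "-1"]) simp_all
  qed
  also have "\<dots> = (\<integral>\<^sup>+\<phi>. ennreal (64 * (sin A)\<^sup>2) * (ennreal (shape_inner A \<phi>) * indicator {0..A} \<phi>) \<partial>lborel)"
  proof (rule nn_integral_cong)
    fix \<phi>
    \<comment> \<open>The integrand vanishes at both ends, so the change from the open to the closed
      interval is pointwise harmless.\<close>
    have "shape_inner A \<phi> = 0" if "\<phi> = 0 \<or> \<phi> = A" using that by (auto simp: shape_inner_def)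
    then show "ennreal (64 * (sin A)\<^sup>2 * shape_inner A \<phi>) * indicator {0<..<A} (A - \<phi>) =
       ennreal (64 * (sin A)\<^sup>2) * (ennreal (shape_inner A \<phi>) * indicator {0..A} \<phi>)"
      by (auto simp: indicator_def ennreal_mult')
  qed
  also have "\<dots> = ennreal (64 * (sin A)\<^sup>2) * ennreal (shape_outer A)"
  proof -
    have [measurable]: "shape_inner A \<in> borel_measurable borel"
      unfolding shape_inner_def[abs_def] by measurable
    show ?thesis using A by (subst nn_integral_cmult) (simp_all add: nn_integral_shape_inner)
  qed
  finally show ?thesis
    by (simp add: f_def ennreal_mult')
qed

text \<open>By conjugation symmetry the upper half plane carries one half. There x = a y with a = -
  cot A; the Jacobian y goes into the line integral \<open>\<Phi>\<close>, and da = dA / sin^2 A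
  cancels the factor sin^2 A of its value. This leaves 64 * 35 pi / 192 = 35 pi / 3 for each
  half.\<close>

lemma nn_integral_shape_density: "(\<integral>\<^sup>+z. ennreal (shape_density z) \<partial>lborel) = ennreal (70 * pi / 3)"
proof -
  define \<Phi> where "\<Phi> = (\<lambda>a. \<integral>\<^sup>+y. ennreal (y * shape_density (Complex (y * a) y)) * indicator {0<..} y \<partial>lborel)"
  have [measurable]: "\<Phi> \<in> borel_measurable borel" unfolding \<Phi>_def by measurable
  have cot: "\<exists>A. 0 < A \<and> A < pi \<and> a = - cos A / sin A" for a :: real
  proof (intro exI conjI)
    show "0 < arctan a + pi / 2" "arctan a + pi / 2 < pi"
      using arctan_lbound[of a] arctan_ubound[of a] by simp_all
    have "- cos (arctan a + pi / 2) / sin (arctan a + pi / 2) = tan (arctan a)"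
      by (simp add: cos_add sin_add tan_def)
    then show "a = - cos (arctan a + pi / 2) / sin (arctan a + pi / 2)" by (simp add: tan_arctan)
  qed
  have Phi: "\<Phi> (- cos A / sin A) = ennreal (64 * (sin A)\<^sup>2 * shape_outer A)" if "0 < A" "A < pi" for A
    unfolding \<Phi>_def by (rule nn_integral_shape_line[OF that])
  \<comment> \<open>The substitution lemma takes real integrands, so finiteness of
    \<open>\<Phi>\<close> is established first.\<close>
  have fin: "\<Phi> a = ennreal (enn2real (\<Phi> a))" for a
    using cot[of a] Phi by auto
  have "(\<integral>\<^sup>+a. \<Phi> a \<partial>lborel) = (\<integral>\<^sup>+a. ennreal (enn2real (\<Phi> a)) * indicator ((\<lambda>A. - cos A / sin A) ` {0<..<pi}) a \<partial>lborel)"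
  proof (rule nn_integral_cong)
    fix a
    have "a \<in> (\<lambda>A. - cos A / sin A) ` {0<..<pi}" using cot[of a] by auto
    then show "\<Phi> a = ennreal (enn2real (\<Phi> a)) * indicator ((\<lambda>A. - cos A / sin A) ` {0<..<pi}) a"
      by (simp flip: fin)
  qed
  also have "\<dots> = (\<integral>\<^sup>+A. ennreal (enn2real (\<Phi> (- cos A / sin A)) * (1 / (sin A)\<^sup>2)) * indicator {0<..<pi} A \<partial>lborel)"
  proof (rule nn_integral_substitution_open)
    show "((\<lambda>A. - cos A / sin A) has_real_derivative 1 / (sin A)\<^sup>2) (at A)" if "0 < A" "A < pi" for A
    proof -
      have n: "sin A \<noteq> 0" using that sin_gt_zero[of A] by simp
      have "((\<lambda>A. - cos A / sin A) has_real_derivative (- (- sin A) * sin A - - cos A * cos A) / (sin A * sin A)) (at A)"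
        by (rule DERIV_divide[OF DERIV_minus[OF DERIV_cos] DERIV_sin n])
      moreover have "- (- sin A) * sin A - - cos A * cos A = 1"
        using sin_cos_squared_add[of A] by (simp add: power2_eq_square)
      ultimately show ?thesis by (simp add: power2_eq_square)
    qed
    show "continuous_on {0<..<pi} (\<lambda>A. 1 / (sin A)\<^sup>2)"
    proof (intro continuous_intros ballI)
      fix A assume "A \<in> {0<..<pi}"
      then have "sin A > 0" using sin_gt_zero[of A] by simp
      then show "(sin A)\<^sup>2 \<noteq> 0" by simp
    qed
  qed simp_all
  also have "\<dots> = (\<integral>\<^sup>+A. 64 * (ennreal (shape_outer A) * indicator {0..pi} A) \<partial>lborel)"
  proof (rule nn_integral_cong)
    fix A
    have z: "shape_outer A = 0" if "A = 0 \<or> A = pi" using that by (auto simp: shape_outer_eq)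
    show "ennreal (enn2real (\<Phi> (- cos A / sin A)) * (1 / (sin A)\<^sup>2)) * indicator {0<..<pi} A =
       64 * (ennreal (shape_outer A) * indicator {0..pi} A)"
    proof (cases "0 < A \<and> A < pi")
      case True
      then have s: "sin A > 0" "shape_outer A \<ge> 0" by (simp_all add: sin_gt_zero shape_outer_nonneg)
      then have "enn2real (\<Phi> (- cos A / sin A)) * (1 / (sin A)\<^sup>2) = 64 * shape_outer A"
        using Phi True by simp
      then show ?thesis using True s by (simp add: ennreal_mult flip: ennreal_numeral)
    next
      case False
      then show ?thesis using z by (auto simp: indicator_def)
    qed
  qed
  also have "\<dots> = 64 * ennreal (35 * pi / 192)"
  proof -
    have [measurable]: "shape_outer \<in> borel_measurable borel"
      unfolding shape_outer_eq[abs_def] by measurable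
    show ?thesis by (subst nn_integral_cmult) (simp_all add: nn_integral_shape_outer)
  qed
  also have "\<dots> = ennreal (35 * pi / 3)"
    by (simp add: ennreal_mult'[symmetric] flip: ennreal_numeral)
  finally have half: "(\<integral>\<^sup>+a. \<Phi> a \<partial>lborel) = ennreal (35 * pi / 3)" .
  have "(\<integral>\<^sup>+z. ennreal (shape_density z) \<partial>lborel) = (\<integral>\<^sup>+x. (\<integral>\<^sup>+y. ennreal (shape_density (Complex x y)) \<partial>lborel) \<partial>lborel)"
    by (rule nn_integral_complex) measurable
  also have "\<dots> = (\<integral>\<^sup>+x. 2 * (\<integral>\<^sup>+y. ennreal (shape_density (Complex x y)) * indicator {0..} y \<partial>lborel) \<partial>lborel)"
  proof (intro nn_integral_cong nn_integral_even)
    have "Complex x (- y) = cnj (Complex x y)" "Complex x (- y) - 1 = cnj (Complex x y - 1)" for x y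
      by (simp_all add: complex_eq_iff)
    then have "norm (Complex x (- y)) = norm (Complex x y)" "norm (Complex x (- y) - 1) = norm (Complex x y - 1)" for x y
      by (simp_all only: complex_mod_cnj)
    then show "ennreal (shape_density (Complex x (- y))) = ennreal (shape_density (Complex x y))" for x y
      by (simp add: shape_density_def)
  qed measurable
  also have "\<dots> = 2 * (\<integral>\<^sup>+x. (\<integral>\<^sup>+y. ennreal (shape_density (Complex x y)) * indicator {0..} y \<partial>lborel) \<partial>lborel)"
    by (rule nn_integral_cmult) measurable
  also have "(\<integral>\<^sup>+x. (\<integral>\<^sup>+y. ennreal (shape_density (Complex x y)) * indicator {0..} y \<partial>lborel) \<partial>lborel) =
      (\<integral>\<^sup>+y. (\<integral>\<^sup>+x. ennreal (shape_density (Complex x y)) * indicator {0..} y \<partial>lborel) \<partial>lborel)"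
    by (rule lborel_pair.Fubini') measurable
  also have "\<dots> = (\<integral>\<^sup>+y. (\<integral>\<^sup>+a. ennreal (y * shape_density (Complex (y * a) y)) * indicator {0<..} y \<partial>lborel) \<partial>lborel)"
  proof (rule nn_integral_cong)
    fix y :: real
    consider "y < 0" | "y = 0" | "y > 0" by linarith
    then show "(\<integral>\<^sup>+x. ennreal (shape_density (Complex x y)) * indicator {0..} y \<partial>lborel) =
      (\<integral>\<^sup>+a. ennreal (y * shape_density (Complex (y * a) y)) * indicator {0<..} y \<partial>lborel)"
    proof cases
      case 3
      then have y: "y \<noteq> 0" by simp
      have "(\<integral>\<^sup>+x. ennreal (shape_density (Complex x y)) \<partial>lborel) = ennreal \<bar>y\<bar> * (\<integral>\<^sup>+a. ennreal (shape_density (Complex (0 + y * a) y)) \<partial>lborel)"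
        by (rule nn_integral_real_affine[OF _ y]) measurable
      also have "\<dots> = (\<integral>\<^sup>+a. ennreal \<bar>y\<bar> * ennreal (shape_density (Complex (0 + y * a) y)) \<partial>lborel)"
        by (rule nn_integral_cmult[symmetric]) measurable
      finally show ?thesis using 3 by (simp add: ennreal_mult')
    qed (simp_all add: shape_density_def)
  qed
  also have "\<dots> = (\<integral>\<^sup>+a. (\<integral>\<^sup>+y. ennreal (y * shape_density (Complex (y * a) y)) * indicator {0<..} y \<partial>lborel) \<partial>lborel)"
    by (rule lborel_pair.Fubini') measurable
  finally have "(\<integral>\<^sup>+z. ennreal (shape_density z) \<partial>lborel) = 2 * ennreal (35 * pi / 3)"
    unfolding \<Phi>_def[symmetric] half .
  then show ?thesis by (simp add: ennreal_mult'[symmetric] flip: ennreal_numeral)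
qed

section \<open>The main term\<close>

lemma gram_measurable [measurable (raw)]:
  fixes f g :: "'a \<Rightarrow> real^2"
  assumes [measurable]: "f \<in> borel_measurable M" "g \<in> borel_measurable M"
  shows "(\<lambda>x. gram (f x) (g x)) \<in> borel_measurable M"
  unfolding gram_def by measurable

lemma noncollinear_measurable [measurable (raw)]:
  fixes f g h :: "'a \<Rightarrow> real^2"
  assumes [measurable]: "f \<in> borel_measurable M" "g \<in> borel_measurable M" "h \<in> borel_measurable M"
  shows "Measurable.pred M (\<lambda>x. noncollinear (f x) (g x) (h x))"
  unfolding noncollinear_def by measurable

lemma circumcenter_measurable [measurable (raw)]:
  fixes f g h :: "'a \<Rightarrow> real^2"
  assumes [measurable]: "f \<in> borel_measurable M" "g \<in> borel_measurable M" "h \<in> borel_measurable M"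
  shows "(\<lambda>x. circumcenter (f x) (g x) (h x)) \<in> borel_measurable M"
  unfolding circumcenter_def Let_def by measurable

lemma circumradius_measurable [measurable (raw)]:
  fixes f g h :: "'a \<Rightarrow> real^2"
  assumes [measurable]: "f \<in> borel_measurable M" "g \<in> borel_measurable M" "h \<in> borel_measurable M"
  shows "(\<lambda>x. circumradius (f x) (g x) (h x)) \<in> borel_measurable M"
  unfolding circumradius_def by measurable

lemma bary_measurable [measurable (raw)]:
  fixes f g h :: "'a \<Rightarrow> real^2"
  assumes [measurable]: "f \<in> borel_measurable M" "g \<in> borel_measurable M" "h \<in> borel_measurable M"
  shows "(\<lambda>x. bary p (f x) (g x) (h x)) \<in> borel_measurable M"
  unfolding bary_def by measurable

context segment_frame
begin

lemma absc_measurable [measurable]: "absc \<in> borel_measurable borel"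
  and hgt_measurable [measurable]: "hgt \<in> borel_measurable borel"
  unfolding absc_def[abs_def] hgt_def[abs_def] by measurable

text \<open>Barycentric coordinates describe the interior only for noncollinear vertices, hence the
  conjunction; rational parameters keep it countable.\<close>

lemma crosses_measurable [measurable (raw)]:
  assumes [measurable]: "f \<in> borel_measurable M" "g \<in> borel_measurable M" "h \<in> borel_measurable M"
  shows "Measurable.pred M (\<lambda>x. noncollinear (f x) (g x) (h x) \<and> crosses (f x) (g x) (h x))"
proof -
  have eq: "noncollinear x y z \<and> crosses x y z \<longleftrightarrow> (\<exists>q::rat. (0 \<le> q \<and> q \<le> 1) \<and> noncollinear x y z \<and>
      0 < bary (s + of_rat q *\<^sub>R (t - s)) x y z \<and> 0 < bary (s + of_rat q *\<^sub>R (t - s)) x z y \<and>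
      bary (s + of_rat q *\<^sub>R (t - s)) x y z + bary (s + of_rat q *\<^sub>R (t - s)) x z y < 1)" for x y z
    unfolding crosses_iff_rational using interior_triangle_iff_bary[of x y z] by blast
  show ?thesis unfolding eq by measurable
qed

definition plane_pt :: "complex \<Rightarrow> real^2" where
  "plane_pt z = s + Re z *\<^sub>R dir + Im z *\<^sub>R u"

lemma plane_pt_measurable [measurable]: "plane_pt \<in> borel_measurable borel"
  unfolding plane_pt_def[abs_def] by measurable

lemma absc_plane_pt [simp]: "absc (plane_pt z) = Re z" and hgt_plane_pt [simp]: "hgt (plane_pt z) = Im z"
  by (simp_all add: absc_def hgt_def plane_pt_def inner_add_left frame_inner)

lemma dist_plane_pt: "dist (plane_pt z) (plane_pt w) = norm (z - w)"
proof -
  have "(dist (plane_pt z) (plane_pt w))\<^sup>2 = (norm (z - w))\<^sup>2"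
    by (simp add: dist_sq_frame cmod_power2)
  then show ?thesis by (simp add: power2_eq_iff_nonneg)
qed

lemma gram_plane_pt: "gram (plane_pt y - plane_pt x) (plane_pt z - plane_pt x) = (Im (cnj (y - x) * (z - x)))\<^sup>2"
proof -
  have i: "(plane_pt a - plane_pt b) \<bullet> dir = Re (a - b)" "(plane_pt a - plane_pt b) \<bullet> u = Im (a - b)" for a b
    by (simp_all add: plane_pt_def inner_diff_left inner_add_left frame_inner)
  show ?thesis
    unfolding gram_def inner_frame[of "plane_pt y - plane_pt x" "plane_pt y - plane_pt x"]
      inner_frame[of "plane_pt z - plane_pt x" "plane_pt z - plane_pt x"]
      inner_frame[of "plane_pt y - plane_pt x" "plane_pt z - plane_pt x"] i
    by (simp add: algebra_simps power2_eq_square)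
qed

text \<open>The frame coordinates arise from a translation, the rotation by \<open>dir\<close> read
  as the complex number \<open>e\<close> and, if \<open>dir\<close>, \<open>u\<close> is negatively
  oriented, a reflection. Each preserves Lebesgue measure; \<open>\<epsilon>\<close> is the
  determinant that decides the orientation.\<close>

lemma nn_integral_plane_pt:
  assumes [measurable]: "f \<in> borel_measurable borel"
  shows "(\<integral>\<^sup>+p. f p \<partial>lborel) = (\<integral>\<^sup>+z. f (plane_pt z) \<partial>lborel)"
proof -
  define V where "V = (\<lambda>z. vector [Re z, Im z] :: real^2)"
  have V1: "V z $ 1 = Re z" "V z $ 2 = Im z" for z by (simp_all add: V_def)
  have Vax: "V z = Re z *\<^sub>R axis 1 1 + Im z *\<^sub>R axis 2 1" for z
    by (simp add: V_def vec_eq_iff forall_2 axis_def)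
  have [measurable]: "V \<in> borel_measurable borel" unfolding Vax[abs_def] by measurable
  define c1 c2 \<epsilon> where "c1 = dir $ 1" and "c2 = dir $ 2" and "\<epsilon> = dir $ 1 * u $ 2 - dir $ 2 * u $ 1"
  have n1: "c1 * c1 + c2 * c2 = 1" and o: "c1 * u $ 1 + c2 * u $ 2 = 0"
    using frame_inner by (simp_all add: inner_real2 c1_def c2_def)
  have "\<epsilon>\<^sup>2 = 1" using gram_real2[of dir u] by (simp add: gram_def frame_inner \<epsilon>_def)
  then have eps: "\<epsilon> = 1 \<or> \<epsilon> = - 1" by (simp add: power2_eq_1_iff)
  have u1: "u $ 1 = - \<epsilon> * c2" and u2: "u $ 2 = \<epsilon> * c1"
  proof -
    have "- \<epsilon> * c2 = (c1 * c1 + c2 * c2) * u $ 1 - c1 * (c1 * u $ 1 + c2 * u $ 2)"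
      by (simp add: \<epsilon>_def c1_def[symmetric] c2_def[symmetric] algebra_simps)
    then show "u $ 1 = - \<epsilon> * c2" unfolding n1 o by simp
    have "\<epsilon> * c1 = (c1 * c1 + c2 * c2) * u $ 2 - c2 * (c1 * u $ 1 + c2 * u $ 2)"
      by (simp add: \<epsilon>_def c1_def[symmetric] c2_def[symmetric] algebra_simps)
    then show "u $ 2 = \<epsilon> * c1" unfolding n1 o by simp
  qed
  define e where "e = Complex c1 c2"
  have ne: "(norm e)\<^sup>2 = 1" "e \<noteq> 0"
    unfolding e_def cmod_power2 complex.sel using n1 by (auto simp: power2_eq_square complex_eq_iff)
  have "(\<integral>\<^sup>+p. f p \<partial>lborel) = (\<integral>\<^sup>+z. f (V z) \<partial>lborel)"
    unfolding V_def by (rule nn_integral_real_plane) measurable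
  also have "\<dots> = (\<integral>\<^sup>+z. f (V (Complex (s $ 1) (s $ 2) + z)) \<partial>lborel)"
    by (rule nn_integral_translate) measurable
  also have "\<dots> = ennreal ((norm e)\<^sup>2) * (\<integral>\<^sup>+z. f (V (Complex (s $ 1) (s $ 2) + e * z)) \<partial>lborel)"
    by (rule nn_integral_complex_mult[OF _ ne(2)]) measurable
  finally have *: "(\<integral>\<^sup>+p. f p \<partial>lborel) = (\<integral>\<^sup>+z. f (V (Complex (s $ 1) (s $ 2) + e * z)) \<partial>lborel)"
    by (simp add: ne)
  show ?thesis
  proof (cases "\<epsilon> = 1")
    case True
    have "V (Complex (s $ 1) (s $ 2) + e * z) = plane_pt z" for z
      by (simp add: vec_eq_iff forall_2 V1 plane_pt_def e_def u1 u2 True c1_def[symmetric] c2_def[symmetric] mult.commute)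
    then show ?thesis unfolding * by simp
  next
    case False
    then have eps: "\<epsilon> = - 1" using eps by blast
    have "V (Complex (s $ 1) (s $ 2) + e * cnj z) = plane_pt z" for z
      by (simp add: vec_eq_iff forall_2 V1 plane_pt_def e_def u1 u2 eps c1_def[symmetric] c2_def[symmetric] mult.commute)
    moreover have "(\<integral>\<^sup>+z. f (V (Complex (s $ 1) (s $ 2) + e * z)) \<partial>lborel) =
        (\<integral>\<^sup>+z. f (V (Complex (s $ 1) (s $ 2) + e * cnj z)) \<partial>lborel)"
      by (rule nn_integral_cnj) measurable
    ultimately show ?thesis unfolding * by simp
  qed
qed

text \<open>The crossing condition is replaced by one on the projection of \<open>x\<close> alone,
  so that the integral over its abscissa gives exactly the factor \<open>len\<close>. The two
  conditions differ only for triples near an end.\<close>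

definition main_weight :: "real^2 \<Rightarrow> real^2 \<Rightarrow> real^2 \<Rightarrow> ennreal" where
  "main_weight x y z = (if noncollinear x y z \<and> 0 < hgt x \<and> 0 < hgt y \<and> hgt z < 0 \<and> 0 \<le> absc x \<and> absc x \<le> len
     then ennreal (dist x y) else 0)"

text \<open>Edge length times void probability in terms of the edge vectors v = y - x and w = z - x,
  with the squared circumradius written by side lengths. The case distinction encodes
  noncollinearity.\<close>

definition tri_kernel :: "real \<Rightarrow> complex \<Rightarrow> complex \<Rightarrow> ennreal" where
  "tri_kernel n v w = (if Im (cnj v * w) \<noteq> 0 then ennreal (norm v *
     exp (- (n * pi * ((norm v)\<^sup>2 * (norm w)\<^sup>2 * (norm (v - w))\<^sup>2 / (4 * (Im (cnj v * w))\<^sup>2))))) else 0)"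

lemma cnj_measurable [measurable (raw)]:
  assumes [measurable]: "f \<in> borel_measurable M"
  shows "(\<lambda>x. cnj (f x)) \<in> borel_measurable M"
  by (simp add: borel_measurable_complex_iff)

lemma tri_kernel_measurable [measurable (raw)]:
  assumes [measurable]: "f \<in> borel_measurable M" "g \<in> borel_measurable M"
  shows "(\<lambda>x. tri_kernel n (f x) (g x)) \<in> borel_measurable M"
  unfolding tri_kernel_def by measurable

lemma main_weight_measurable [measurable (raw)]:
  assumes [measurable]: "f \<in> borel_measurable M" "g \<in> borel_measurable M" "h \<in> borel_measurable M"
  shows "(\<lambda>x. main_weight (f x) (g x) (h x)) \<in> borel_measurable M"
  unfolding main_weight_def by measurable

lemma main_weight_plane_pt:
  "main_weight (plane_pt x) (plane_pt y) (plane_pt z) *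
     ennreal (exp (- (n * pi * (circumradius (plane_pt x) (plane_pt y) (plane_pt z))\<^sup>2))) =
   (if 0 < Im x \<and> 0 < Im y \<and> Im z < 0 \<and> 0 \<le> Re x \<and> Re x \<le> len then tri_kernel n (y - x) (z - x) else 0)"
proof (cases "Im (cnj (y - x) * (z - x)) = 0")
  case True
  then have "\<not> noncollinear (plane_pt x) (plane_pt y) (plane_pt z)"
    by (simp add: noncollinear_def gram_plane_pt)
  then show ?thesis using True by (simp add: main_weight_def tri_kernel_def)
next
  case False
  define G where "G = Im (cnj (y - x) * (z - x))"
  have G: "G \<noteq> 0" using False by (simp add: G_def)
  then have nc: "noncollinear (plane_pt x) (plane_pt y) (plane_pt z)"
    by (simp add: noncollinear_def gram_plane_pt G_def)
  have d: "dist (plane_pt x) (plane_pt y) = norm (y - x)" "dist (plane_pt x) (plane_pt z) = norm (z - x)"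
    "dist (plane_pt y) (plane_pt z) = norm ((y - x) - (z - x))"
    by (simp_all add: dist_plane_pt norm_minus_commute)
  have "4 * G\<^sup>2 * (circumradius (plane_pt x) (plane_pt y) (plane_pt z))\<^sup>2 =
      (norm (y - x))\<^sup>2 * (norm (z - x))\<^sup>2 * (norm ((y - x) - (z - x)))\<^sup>2"
    using circumradius_formula[OF nc] unfolding gram_plane_pt d G_def .
  then have r: "(circumradius (plane_pt x) (plane_pt y) (plane_pt z))\<^sup>2 =
      (norm (y - x))\<^sup>2 * (norm (z - x))\<^sup>2 * (norm ((y - x) - (z - x)))\<^sup>2 / (4 * G\<^sup>2)"
    using G by (simp add: eq_divide_eq mult.commute)
  show ?thesis
    unfolding main_weight_def tri_kernel_def r G_def[symmetric] d(1) using nc G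
    by (simp add: ennreal_mult')
qed

text \<open>The abscissa of x ranges over [0, len] and its height over the interval from max 0 (- Im
  v) to - Im w, whose length is the minimum. A negative minimum means an empty interval, and
  \<open>ennreal\<close> sends it to 0.\<close>

lemma nn_integral_heights:
  "(\<integral>\<^sup>+x. (if 0 < Im x \<and> 0 < Im x + Im v \<and> Im x + Im w < 0 \<and> 0 \<le> Re x \<and> Re x \<le> len then a else 0) \<partial>lborel) =
    a * (ennreal len * ennreal (min (- Im w) (Im v - Im w)))"
proof -
  define l where "l = max 0 (- Im v)"
  have "(\<integral>\<^sup>+x. (if 0 < Im x \<and> 0 < Im x + Im v \<and> Im x + Im w < 0 \<and> 0 \<le> Re x \<and> Re x \<le> len then a else 0) \<partial>lborel) =
     (\<integral>\<^sup>+p. (\<integral>\<^sup>+q. (if 0 < q \<and> 0 < q + Im v \<and> q + Im w < 0 \<and> 0 \<le> p \<and> p \<le> len then a else 0) \<partial>lborel) \<partial>lborel)"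
    by (subst nn_integral_complex) simp_all
  also have "\<dots> = (\<integral>\<^sup>+p. (\<integral>\<^sup>+q. a * indicator {0..len} p * indicator {l<..<- Im w} q \<partial>lborel) \<partial>lborel)"
    by (intro nn_integral_cong) (auto simp: indicator_def l_def)
  also have "\<dots> = (\<integral>\<^sup>+p. (a * emeasure lborel {l<..<- Im w}) * indicator {0..len} p \<partial>lborel)"
    by (intro nn_integral_cong) (subst nn_integral_cmult_indicator, simp_all add: mult_ac)
  also have "\<dots> = (a * emeasure lborel {l<..<- Im w}) * ennreal len"
    using len_pos by (subst nn_integral_cmult_indicator) simp_all
  also have "emeasure lborel {l<..<- Im w} = ennreal (min (- Im w) (Im v - Im w))"
  proof (cases "l \<le> - Im w")
    case True
    then have "emeasure lborel {l<..<- Im w} = ennreal (- Im w - l)" by simp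
    also have "- Im w - l = min (- Im w) (Im v - Im w)" by (simp add: l_def min_def max_def)
    finally show ?thesis .
  next
    case False
    then have "min (- Im w) (Im v - Im w) \<le> 0" "{l<..<- Im w} = {}" by (auto simp: l_def min_def max_def split: if_splits)
    then show ?thesis by (simp add: ennreal_neg)
  qed
  finally show ?thesis by (simp add: mult_ac)
qed

lemma Im_cnj_mult_mult: "Im (cnj v * (v * z)) = (norm v)\<^sup>2 * Im z"
proof -
  have "cnj v * (v * z) = (v * cnj v) * z" by (simp only: mult_ac)
  also have "\<dots> = of_real ((norm v)\<^sup>2) * z" by (simp only: complex_norm_square)
  finally have "Im (cnj v * (v * z)) = Im (of_real ((norm v)\<^sup>2) * z)" by (simp only:)
  moreover have "Im (of_real r * z) = r * Im z" for r by simp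
  ultimately show ?thesis by (simp only:)
qed

lemma tri_kernel_mult:
  assumes "v \<noteq> 0" "Im z \<noteq> 0"
  shows "tri_kernel n v (v * z) = ennreal (norm v * exp (- (n * pi * ((norm z)\<^sup>2 * (norm (z - 1))\<^sup>2 / (4 * (Im z)\<^sup>2))) * (norm v)\<^sup>2))"
proof -
  note im = Im_cnj_mult_mult[of v z]
  have "v - v * z = v * (1 - z)" by (simp add: algebra_simps)
  then have nd: "norm (v - v * z) = norm v * norm (z - 1)" by (simp add: norm_mult norm_minus_commute)
  define N a b c where "N = norm v" and "a = norm z" and "b = norm (z - 1)" and "c = Im z"
  have pos: "N > 0" "c \<noteq> 0" using assms by (simp_all add: N_def c_def)
  have "N\<^sup>2 * (N * a)\<^sup>2 * (N * b)\<^sup>2 / (4 * (N\<^sup>2 * c)\<^sup>2) = a\<^sup>2 * b\<^sup>2 / (4 * c\<^sup>2) * N\<^sup>2"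
    using pos by (simp add: field_simps power_mult_distrib eval_nat_numeral)
  then have "n * pi * (N\<^sup>2 * (N * a)\<^sup>2 * (N * b)\<^sup>2 / (4 * (N\<^sup>2 * c)\<^sup>2)) = n * pi * (a\<^sup>2 * b\<^sup>2 / (4 * c\<^sup>2)) * N\<^sup>2"
    by (simp only: mult.assoc)
  then show ?thesis
    unfolding tri_kernel_def im nd norm_mult N_def[symmetric] a_def[symmetric] b_def[symmetric] c_def[symmetric]
    using pos by simp
qed

text \<open>Substituting w = v z gives the Jacobian |v|^2 and the squared radius |v|^2 r, with r
  depending only on the shape z. After exchanging the integrals, \<open>radial_min_integral\<close>
  with k = n pi r treats v, and the remaining function of z is \<open>shape_density\<close>.\<close>

lemma nn_integral_tri_kernel:
  assumes n: "n > 0"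
  shows "(\<integral>\<^sup>+v. (\<integral>\<^sup>+w. tri_kernel n v w * (ennreal len * ennreal (min (- Im w) (Im v - Im w))) \<partial>lborel) \<partial>lborel) =
    ennreal (len * (70 * pi / 3) / (n * pi) ^ 3)"
proof -
  have "(\<integral>\<^sup>+v. (\<integral>\<^sup>+w. tri_kernel n v w * (ennreal len * ennreal (min (- Im w) (Im v - Im w))) \<partial>lborel) \<partial>lborel) =
    (\<integral>\<^sup>+v. (\<integral>\<^sup>+z. ennreal ((norm v)\<^sup>2) * (tri_kernel n v (v * z) *
       (ennreal len * ennreal (min (- Im (v * z)) (Im v - Im (v * z))))) \<partial>lborel) \<partial>lborel)"
  proof (rule nn_integral_cong)
    fix v :: complex
    show "(\<integral>\<^sup>+w. tri_kernel n v w * (ennreal len * ennreal (min (- Im w) (Im v - Im w))) \<partial>lborel) =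
      (\<integral>\<^sup>+z. ennreal ((norm v)\<^sup>2) * (tri_kernel n v (v * z) *
       (ennreal len * ennreal (min (- Im (v * z)) (Im v - Im (v * z))))) \<partial>lborel)"
    proof (cases "v = 0")
      case True
      then show ?thesis by (simp add: tri_kernel_def)
    next
      case False
      have "(\<integral>\<^sup>+w. tri_kernel n v w * (ennreal len * ennreal (min (- Im w) (Im v - Im w))) \<partial>lborel) =
        ennreal ((norm v)\<^sup>2) * (\<integral>\<^sup>+z. tri_kernel n v (v * z) * (ennreal len * ennreal (min (- Im (v * z)) (Im v - Im (v * z)))) \<partial>lborel)"
        by (rule nn_integral_complex_mult[OF _ False]) measurable
      also have "\<dots> = (\<integral>\<^sup>+z. ennreal ((norm v)\<^sup>2) * (tri_kernel n v (v * z) *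
       (ennreal len * ennreal (min (- Im (v * z)) (Im v - Im (v * z))))) \<partial>lborel)"
        by (rule nn_integral_cmult[symmetric]) measurable
      finally show ?thesis .
    qed
  qed
  also have "\<dots> = (\<integral>\<^sup>+z. (\<integral>\<^sup>+v. ennreal ((norm v)\<^sup>2) * (tri_kernel n v (v * z) *
       (ennreal len * ennreal (min (- Im (v * z)) (Im v - Im (v * z))))) \<partial>lborel) \<partial>lborel)"
    by (rule lborel_pair.Fubini') measurable
  also have "\<dots> = (\<integral>\<^sup>+z. ennreal (len / (n * pi) ^ 3) * ennreal (shape_density z) \<partial>lborel)"
  proof (rule nn_integral_cong)
    fix z :: complex
    show "(\<integral>\<^sup>+v. ennreal ((norm v)\<^sup>2) * (tri_kernel n v (v * z) *
       (ennreal len * ennreal (min (- Im (v * z)) (Im v - Im (v * z))))) \<partial>lborel) =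
       ennreal (len / (n * pi) ^ 3) * ennreal (shape_density z)"
    proof (cases "Im z = 0")
      case True
      have "Im (cnj v * (v * z)) = 0" for v
        unfolding Im_cnj_mult_mult using True by simp
      then show ?thesis using True by (simp add: tri_kernel_def shape_density_def)
    next
      case False
      define r where "r = (norm z)\<^sup>2 * (norm (z - 1))\<^sup>2 / (4 * (Im z)\<^sup>2)"
      have "z \<noteq> 0" "z \<noteq> 1" using False by auto
      then have r: "r > 0" using False by (simp add: r_def)
      have k: "n * pi * r > 0" using n r by simp
      have "(\<integral>\<^sup>+v. ennreal ((norm v)\<^sup>2) * (tri_kernel n v (v * z) *
       (ennreal len * ennreal (min (- Im (v * z)) (Im v - Im (v * z))))) \<partial>lborel) =
       (\<integral>\<^sup>+v. ennreal len * ennreal (norm v ^ 3 * exp (- (n * pi * r) * (norm v)\<^sup>2) * min (- Im (v * z)) (- Im (v * (z - 1)))) \<partial>lborel)"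
      proof (rule nn_integral_cong)
        fix v :: complex
        define m where "m = min (- Im (v * z)) (- Im (v * (z - 1)))"
        have m: "min (- Im (v * z)) (Im v - Im (v * z)) = m" by (simp add: m_def algebra_simps)
        show "ennreal ((norm v)\<^sup>2) * (tri_kernel n v (v * z) * (ennreal len * ennreal (min (- Im (v * z)) (Im v - Im (v * z))))) =
          ennreal len * ennreal (norm v ^ 3 * exp (- (n * pi * r) * (norm v)\<^sup>2) * min (- Im (v * z)) (- Im (v * (z - 1))))"
        proof (cases "v = 0")
          case v: False
          have "tri_kernel n v (v * z) = ennreal (norm v * exp (- (n * pi * r) * (norm v)\<^sup>2))"
            unfolding tri_kernel_mult[OF v False] r_def ..
          moreover have "norm v ^ 3 * exp (- (n * pi * r) * (norm v)\<^sup>2) = (norm v)\<^sup>2 * (norm v * exp (- (n * pi * r) * (norm v)\<^sup>2))"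
            by (simp add: power2_eq_square power3_eq_cube)
          moreover have "ennreal a * (ennreal b * (c * ennreal m)) = c * ennreal (a * b * m)" if "0 \<le> a" "0 \<le> b" for a b c
            using that by (simp add: ennreal_mult' mult_ac)
          from this[of "(norm v)\<^sup>2" "norm v * exp (- (n * pi * r) * (norm v)\<^sup>2)"]
          have "ennreal ((norm v)\<^sup>2) * (ennreal (norm v * exp (- (n * pi * r) * (norm v)\<^sup>2)) * (c * ennreal m)) =
            c * ennreal ((norm v)\<^sup>2 * (norm v * exp (- (n * pi * r) * (norm v)\<^sup>2)) * m)" for c
            by simp
          ultimately show ?thesis
            unfolding m m_def[symmetric] by (simp only:)
        qed simp
      qed
      also have "\<dots> = ennreal len * (\<integral>\<^sup>+v. ennreal (norm v ^ 3 * exp (- (n * pi * r) * (norm v)\<^sup>2) * min (- Im (v * z)) (- Im (v * (z - 1)))) \<partial>lborel)"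
        by (rule nn_integral_cmult) measurable
      also have "\<dots> = ennreal (len * ((norm z + norm (z - 1) - 1) / (n * pi * r) ^ 3))"
        unfolding radial_min_integral[OF k] using len_pos by (intro ennreal_mult'[symmetric]) simp
      also have "len * ((norm z + norm (z - 1) - 1) / (n * pi * r) ^ 3) = len / (n * pi) ^ 3 * shape_density z"
      proof -
        have "r ^ 3 = (norm z * norm (z - 1)) ^ 6 / (64 * Im z ^ 6)"
          unfolding r_def by (simp add: power_divide power_mult_distrib power_mult[symmetric])
        then show ?thesis
          unfolding shape_density_def power_mult_distrib[of "n * pi" r] by (simp add: mult_ac)
      qed
      also have "ennreal \<dots> = ennreal (len / (n * pi) ^ 3) * ennreal (shape_density z)"
        using n len_pos by (intro ennreal_mult') simp
      finally show ?thesis .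
    qed
  qed
  also have "\<dots> = ennreal (len / (n * pi) ^ 3) * (\<integral>\<^sup>+z. ennreal (shape_density z) \<partial>lborel)"
    by (rule nn_integral_cmult) measurable
  also have "\<dots> = ennreal (len / (n * pi) ^ 3 * (70 * pi / 3))"
    unfolding nn_integral_shape_density using n len_pos by (intro ennreal_mult'[symmetric]) simp
  also have "len / (n * pi) ^ 3 * (70 * pi / 3) = len * (70 * pi / 3) / (n * pi) ^ 3"
    by simp
  finally show ?thesis .
qed

text \<open>The intensity drops out: n^3 from the three points meets 1 / (n pi)^3 from the scaling,
  and 70 pi / (3 pi^3) remains.\<close>

lemma nn_integral_main_weight:
  assumes n: "n > 0"
  shows "ennreal n ^ 3 * (\<integral>\<^sup>+x. (\<integral>\<^sup>+y. (\<integral>\<^sup>+z. main_weight x y z * ennreal (exp (- (n * pi * (circumradius x y z)\<^sup>2)))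
      \<partial>lborel) \<partial>lborel) \<partial>lborel) = ennreal (70 / (3 * pi\<^sup>2) * len)"
proof -
  define G where "G = (\<lambda>x y z. main_weight x y z * ennreal (exp (- (n * pi * (circumradius x y z)\<^sup>2))))"
  have Gm: "(\<lambda>z. G x y z) \<in> borel_measurable borel" "(\<lambda>y. \<integral>\<^sup>+z. G x y z \<partial>lborel) \<in> borel_measurable borel"
    "(\<lambda>x. \<integral>\<^sup>+y. (\<integral>\<^sup>+z. G x y z \<partial>lborel) \<partial>lborel) \<in> borel_measurable borel" for x y
    unfolding G_def by measurable
  have "(\<integral>\<^sup>+x. (\<integral>\<^sup>+y. (\<integral>\<^sup>+z. G x y z \<partial>lborel) \<partial>lborel) \<partial>lborel) =
      (\<integral>\<^sup>+x. (\<integral>\<^sup>+y. (\<integral>\<^sup>+z. G (plane_pt x) (plane_pt y) (plane_pt z) \<partial>lborel) \<partial>lborel) \<partial>lborel)"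
  proof -
    have "(\<integral>\<^sup>+x. (\<integral>\<^sup>+y. (\<integral>\<^sup>+z. G x y z \<partial>lborel) \<partial>lborel) \<partial>lborel) =
        (\<integral>\<^sup>+x. (\<integral>\<^sup>+y. (\<integral>\<^sup>+z. G (plane_pt x) y z \<partial>lborel) \<partial>lborel) \<partial>lborel)"
      by (rule nn_integral_plane_pt[OF Gm(3)])
    also have "\<dots> = (\<integral>\<^sup>+x. (\<integral>\<^sup>+y. (\<integral>\<^sup>+z. G (plane_pt x) (plane_pt y) z \<partial>lborel) \<partial>lborel) \<partial>lborel)"
      by (intro nn_integral_cong nn_integral_plane_pt Gm(2))
    also have "\<dots> = (\<integral>\<^sup>+x. (\<integral>\<^sup>+y. (\<integral>\<^sup>+z. G (plane_pt x) (plane_pt y) (plane_pt z) \<partial>lborel) \<partial>lborel) \<partial>lborel)"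
      by (intro nn_integral_cong nn_integral_plane_pt Gm(1))
    finally show ?thesis .
  qed
  also have "\<dots> = (\<integral>\<^sup>+x. (\<integral>\<^sup>+y. (\<integral>\<^sup>+z.
      (if 0 < Im x \<and> 0 < Im y \<and> Im z < 0 \<and> 0 \<le> Re x \<and> Re x \<le> len then tri_kernel n (y - x) (z - x) else 0)
        \<partial>lborel) \<partial>lborel) \<partial>lborel)"
    unfolding G_def main_weight_plane_pt ..
  also have "\<dots> = (\<integral>\<^sup>+x. (\<integral>\<^sup>+v. (\<integral>\<^sup>+w.
      (if 0 < Im x \<and> 0 < Im x + Im v \<and> Im x + Im w < 0 \<and> 0 \<le> Re x \<and> Re x \<le> len then tri_kernel n v w else 0)
        \<partial>lborel) \<partial>lborel) \<partial>lborel)"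
  proof (rule nn_integral_cong)
    fix x :: complex
    let ?h = "\<lambda>y z. if 0 < Im x \<and> 0 < Im y \<and> Im z < 0 \<and> 0 \<le> Re x \<and> Re x \<le> len then tri_kernel n (y - x) (z - x) else 0"
    have "(\<integral>\<^sup>+y. (\<integral>\<^sup>+z. ?h y z \<partial>lborel) \<partial>lborel) = (\<integral>\<^sup>+v. (\<integral>\<^sup>+z. ?h (x + v) z \<partial>lborel) \<partial>lborel)"
      by (rule nn_integral_translate) measurable
    also have "\<dots> = (\<integral>\<^sup>+v. (\<integral>\<^sup>+w. ?h (x + v) (x + w) \<partial>lborel) \<partial>lborel)"
      by (intro nn_integral_cong nn_integral_translate) measurable
    finally show "(\<integral>\<^sup>+y. (\<integral>\<^sup>+z. ?h y z \<partial>lborel) \<partial>lborel) = (\<integral>\<^sup>+v. (\<integral>\<^sup>+w.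
      (if 0 < Im x \<and> 0 < Im x + Im v \<and> Im x + Im w < 0 \<and> 0 \<le> Re x \<and> Re x \<le> len then tri_kernel n v w else 0)
        \<partial>lborel) \<partial>lborel)" by (simp cong: if_cong)
  qed
  \<comment> \<open>The kernel depends only on the edge vectors, so the position x is moved to the
    innermost integral.\<close>
  also have "\<dots> = (\<integral>\<^sup>+v. (\<integral>\<^sup>+x. (\<integral>\<^sup>+w.
      (if 0 < Im x \<and> 0 < Im x + Im v \<and> Im x + Im w < 0 \<and> 0 \<le> Re x \<and> Re x \<le> len then tri_kernel n v w else 0)
        \<partial>lborel) \<partial>lborel) \<partial>lborel)"
    by (rule lborel_pair.Fubini') measurable
  also have "\<dots> = (\<integral>\<^sup>+v. (\<integral>\<^sup>+w. (\<integral>\<^sup>+x.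
      (if 0 < Im x \<and> 0 < Im x + Im v \<and> Im x + Im w < 0 \<and> 0 \<le> Re x \<and> Re x \<le> len then tri_kernel n v w else 0)
        \<partial>lborel) \<partial>lborel) \<partial>lborel)"
    by (intro nn_integral_cong lborel_pair.Fubini') measurable
  also have "\<dots> = ennreal (len * (70 * pi / 3) / (n * pi) ^ 3)"
    unfolding nn_integral_heights nn_integral_tri_kernel[OF n] ..
  finally have "ennreal n ^ 3 * (\<integral>\<^sup>+x. (\<integral>\<^sup>+y. (\<integral>\<^sup>+z. G x y z \<partial>lborel) \<partial>lborel) \<partial>lborel) =
      ennreal (n ^ 3) * ennreal (len * (70 * pi / 3) / (n * pi) ^ 3)"
    using n by (simp add: ennreal_power)
  also have "\<dots> = ennreal (n ^ 3 * (len * (70 * pi / 3) / (n * pi) ^ 3))"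
    using n by (intro ennreal_mult'[symmetric]) simp
  also have "n ^ 3 * (len * (70 * pi / 3) / (n * pi) ^ 3) = 70 / (3 * pi\<^sup>2) * len"
    using n by (simp add: field_simps eval_nat_numeral)
  finally show ?thesis unfolding G_def .
qed

end

section \<open>Comparison of the path length with the main term\<close>

lemma nn_integral_gaussian_line:
  assumes k: "k > 0"
  shows "(\<integral>\<^sup>+x. ennreal (exp (- k * x\<^sup>2)) \<partial>lborel) = ennreal (sqrt (pi / k))"
proof -
  define \<sigma> where "\<sigma> = 1 / sqrt (2 * k)"
  have s: "\<sigma> > 0" "2 * \<sigma>\<^sup>2 = 1 / k" using k by (simp_all add: \<sigma>_def power_divide)
  have nd: "exp (- k * x\<^sup>2) = sqrt (pi / k) * normal_density 0 \<sigma> x" for x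
  proof -
    have "normal_density 0 \<sigma> x = 1 / sqrt (pi * (2 * \<sigma>\<^sup>2)) * exp (- (x\<^sup>2 / (2 * \<sigma>\<^sup>2)))"
      unfolding normal_density_def by (simp add: mult_ac)
    also have "\<dots> = 1 / sqrt (pi / k) * exp (- k * x\<^sup>2)"
      unfolding s(2) using k by (simp add: mult.commute)
    finally show ?thesis using k by simp
  qed
  interpret N: prob_space "density lborel (normal_density 0 \<sigma>)"
    by (rule prob_space_normal_density[OF s(1)])
  have one: "(\<integral>\<^sup>+x. ennreal (normal_density 0 \<sigma> x) \<partial>lborel) = 1"
    using N.emeasure_space_1 by (simp add: emeasure_density)
  have "(\<integral>\<^sup>+x. ennreal (exp (- k * x\<^sup>2)) \<partial>lborel) = (\<integral>\<^sup>+x. ennreal (sqrt (pi / k)) * ennreal (normal_density 0 \<sigma> x) \<partial>lborel)"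
    unfolding nd using k by (intro nn_integral_cong ennreal_mult') simp
  also have "\<dots> = ennreal (sqrt (pi / k)) * (\<integral>\<^sup>+x. ennreal (normal_density 0 \<sigma> x) \<partial>lborel)"
    by (rule nn_integral_cmult) measurable
  finally show ?thesis by (simp add: one)
qed

lemma nn_integral_gaussian_plane:
  fixes a :: "real^2"
  assumes k: "k > 0"
  shows "(\<integral>\<^sup>+x. ennreal (exp (- k * (dist a x)\<^sup>2)) \<partial>lborel) = ennreal (pi / k)"
proof -
  have nv: "(norm (vector [Re z, Im z] :: real^2))\<^sup>2 = (Re z)\<^sup>2 + (Im z)\<^sup>2" for z
    unfolding power2_norm_eq_inner inner_real2 by (simp add: power2_eq_square)
  have "(\<integral>\<^sup>+x. ennreal (exp (- k * (dist a x)\<^sup>2)) \<partial>lborel) = (\<integral>\<^sup>+x. ennreal (exp (- k * (dist a (a + x))\<^sup>2)) \<partial>lborel)"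
    by (rule nn_integral_translate) measurable
  also have "\<dots> = (\<integral>\<^sup>+x. ennreal (exp (- k * (norm (x :: real^2))\<^sup>2)) \<partial>lborel)"
    by (simp add: dist_norm)
  also have "\<dots> = (\<integral>\<^sup>+z. ennreal (exp (- k * ((Re z)\<^sup>2 + (Im z)\<^sup>2))) \<partial>lborel)"
    by (subst nn_integral_real_plane) (simp_all add: nv)
  also have "\<dots> = (\<integral>\<^sup>+x. (\<integral>\<^sup>+y. ennreal (exp (- k * (x\<^sup>2 + y\<^sup>2))) \<partial>lborel) \<partial>lborel)"
    by (subst nn_integral_complex) simp_all
  also have "\<dots> = (\<integral>\<^sup>+x. ennreal (exp (- k * x\<^sup>2)) * ennreal (sqrt (pi / k)) \<partial>lborel)"
  proof (rule nn_integral_cong)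
    fix x :: real
    have "exp (- k * (x\<^sup>2 + y\<^sup>2)) = exp (- k * x\<^sup>2) * exp (- k * y\<^sup>2)" for y
      by (simp add: distrib_left exp_diff exp_minus divide_inverse)
    then have "(\<integral>\<^sup>+y. ennreal (exp (- k * (x\<^sup>2 + y\<^sup>2))) \<partial>lborel) =
       (\<integral>\<^sup>+y. ennreal (exp (- k * x\<^sup>2)) * ennreal (exp (- k * y\<^sup>2)) \<partial>lborel)"
      by (simp only: ennreal_mult' exp_ge_zero)
    also have "\<dots> = ennreal (exp (- k * x\<^sup>2)) * (\<integral>\<^sup>+y. ennreal (exp (- k * y\<^sup>2)) \<partial>lborel)"
      by (rule nn_integral_cmult) measurable
    finally show "(\<integral>\<^sup>+y. ennreal (exp (- k * (x\<^sup>2 + y\<^sup>2))) \<partial>lborel) = ennreal (exp (- k * x\<^sup>2)) * ennreal (sqrt (pi / k))"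
      unfolding nn_integral_gaussian_line[OF k] .
  qed
  also have "\<dots> = (\<integral>\<^sup>+x. ennreal (exp (- k * x\<^sup>2)) \<partial>lborel) * ennreal (sqrt (pi / k))"
    by (rule nn_integral_multc) measurable
  also have "\<dots> = ennreal (sqrt (pi / k) * sqrt (pi / k))"
    unfolding nn_integral_gaussian_line[OF k] using k by (intro ennreal_mult'[symmetric]) simp
  also have "sqrt (pi / k) * sqrt (pi / k) = pi / k" using k by simp
  finally show ?thesis .
qed

section \<open>Sums over sets of triples\<close>

lemma nn_count_restrict:
  "(\<integral>\<^sup>+x. (if P x then g x else 0) \<partial>count_space A) = (\<integral>\<^sup>+x. g x \<partial>count_space {x \<in> A. P x})"
proof -
  have "(\<integral>\<^sup>+x. (if P x then g x else 0) \<partial>count_space A) = (\<integral>\<^sup>+x. (if P x then g x else 0) * indicator A x \<partial>count_space UNIV)"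
    by (rule nn_integral_count_space_indicator) simp
  also have "\<dots> = (\<integral>\<^sup>+x. g x * indicator {x \<in> A. P x} x \<partial>count_space UNIV)"
    by (intro nn_integral_cong) (simp add: indicator_def)
  also have "\<dots> = (\<integral>\<^sup>+x. g x \<partial>count_space {x \<in> A. P x})"
    by (rule nn_integral_count_space_indicator[symmetric]) simp
  finally show ?thesis .
qed

lemma nn_count_subset:
  assumes "A \<subseteq> B"
  shows "(\<integral>\<^sup>+x. g x \<partial>count_space A) \<le> (\<integral>\<^sup>+x. (g x :: ennreal) \<partial>count_space B)"
proof -
  have eq: "(\<integral>\<^sup>+x. g x \<partial>count_space C) = (\<integral>\<^sup>+x. g x * indicator C x \<partial>count_space UNIV)" for C
    by (rule nn_integral_count_space_indicator) simp
  show ?thesis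
    unfolding eq by (intro nn_integral_mono mult_left_mono) (use assms in \<open>auto simp: indicator_def\<close>)
qed

lemma nn_count_Un:
  "(\<integral>\<^sup>+x. g x \<partial>count_space (A \<union> B)) \<le> (\<integral>\<^sup>+x. g x \<partial>count_space A) + (\<integral>\<^sup>+x. (g x :: ennreal) \<partial>count_space B)"
proof -
  have eq: "(\<integral>\<^sup>+x. g x \<partial>count_space C) = (\<integral>\<^sup>+x. g x * indicator C x \<partial>count_space UNIV)" for C
    by (rule nn_integral_count_space_indicator) simp
  have "(\<integral>\<^sup>+x. g x * indicator (A \<union> B) x \<partial>count_space UNIV) \<le>
      (\<integral>\<^sup>+x. g x * indicator A x + g x * indicator B x \<partial>count_space UNIV)"
    by (intro nn_integral_mono) (auto simp: indicator_def)
  also have "\<dots> = (\<integral>\<^sup>+x. g x * indicator A x \<partial>count_space UNIV) + (\<integral>\<^sup>+x. g x * indicator B x \<partial>count_space UNIV)"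
    by (rule nn_integral_add) simp_all
  finally show ?thesis unfolding eq .
qed

lemma nn_count_image:
  assumes "inj_on f A"
  shows "(\<integral>\<^sup>+x. (g x :: ennreal) \<partial>count_space (f ` A)) = (\<integral>\<^sup>+x. g (f x) \<partial>count_space A)"
  by (rule nn_integral_bij_count_space[symmetric]) (use assms in \<open>simp add: bij_betw_def\<close>)

lemma nn_count_one_eq_0: "(\<integral>\<^sup>+x. (1 :: ennreal) \<partial>count_space A) = 0 \<longleftrightarrow> A = {}"
  by (subst nn_integral_0_iff_AE) (auto simp: AE_count_space)

lemma nn_count_one_less_top: "(\<integral>\<^sup>+x. (1 :: ennreal) \<partial>count_space A) < \<infinity> \<longleftrightarrow> finite A"
  by (cases "finite A") (simp_all add: of_nat_less_top)

text \<open>Triangles with one prescribed vertex; \<open>point_sum\<close> prescribes two. The ends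
  of the segment are not Poisson points, so for these triangles the Mecke formula runs over fewer
  points.\<close>

definition pair_sum :: "(real \<Rightarrow> ennreal) \<Rightarrow> real^2 \<Rightarrow> (real^2) set \<Rightarrow> ennreal" where
  "pair_sum w a = empty_sum2 (\<lambda>y z. if noncollinear a y z then w (circumradius a y z) else 0)
     (circumcenter a) (circumradius a)"

definition point_sum :: "(real \<Rightarrow> ennreal) \<Rightarrow> real^2 \<Rightarrow> real^2 \<Rightarrow> (real^2) set \<Rightarrow> ennreal" where
  "point_sum w a b = empty_sum1 (\<lambda>z. if noncollinear a b z then w (circumradius a b z) else 0)
     (circumcenter a b) (circumradius a b)"

text \<open>The set tested for emptiness need not contain the vertices. This admits \<open>s\<close>
  and \<open>t\<close> as vertices of triangles that are tested against the Poisson points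
  only.\<close>

definition empty_triangle :: "(real^2) set \<Rightarrow> (real^2) \<times> (real^2) \<times> (real^2) \<Rightarrow> bool" where
  "empty_triangle \<phi> = (\<lambda>(x, y, z). noncollinear x y z \<and> \<phi> \<inter> ball (circumcenter x y z) (circumradius x y z) = {})"

definition radius_weight :: "(real \<Rightarrow> ennreal) \<Rightarrow> (real^2) \<times> (real^2) \<times> (real^2) \<Rightarrow> ennreal" where
  "radius_weight w = (\<lambda>(x, y, z). w (circumradius x y z))"

lemma radius_weight_one: "radius_weight (\<lambda>_. 1) = (\<lambda>_. 1)"
  by (simp add: radius_weight_def fun_eq_iff split_paired_all)

lemma empty_triangle_perm:
  "empty_triangle \<phi> (x, y, z) \<Longrightarrow> empty_triangle \<phi> (y, x, z) \<and> radius_weight w (y, x, z) = radius_weight w (x, y, z)"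
  "empty_triangle \<phi> (x, y, z) \<Longrightarrow> empty_triangle \<phi> (z, y, x) \<and> radius_weight w (z, y, x) = radius_weight w (x, y, z)"
  "empty_triangle \<phi> (x, y, z) \<Longrightarrow> empty_triangle \<phi> (x, z, y) \<and> radius_weight w (x, z, y) = radius_weight w (x, y, z)"
  using noncollinear_perm[of x y z] circumcenter_perm[of x y z]
  by (simp_all add: empty_triangle_def radius_weight_def)

lemma pair_sum_eq: "pair_sum w a \<phi> = (\<integral>\<^sup>+p. radius_weight w (a, p) \<partial>count_space {p \<in> \<phi> \<times> \<phi>. empty_triangle \<phi> (a, p)})"
proof -
  have "pair_sum w a \<phi> = (\<integral>\<^sup>+p. (if empty_triangle \<phi> (a, p) then radius_weight w (a, p) else 0) \<partial>count_space (\<phi> \<times> \<phi>))"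
    unfolding pair_sum_def empty_sum2_def
    by (intro nn_integral_cong) (simp only: empty_triangle_def radius_weight_def prod.case split: prod.split if_split, blast)
  then show ?thesis unfolding nn_count_restrict .
qed

lemma point_sum_eq: "point_sum w a b \<phi> = (\<integral>\<^sup>+z. radius_weight w (a, b, z) \<partial>count_space {z \<in> \<phi>. empty_triangle \<phi> (a, b, z)})"
proof -
  have "point_sum w a b \<phi> = (\<integral>\<^sup>+z. (if empty_triangle \<phi> (a, b, z) then radius_weight w (a, b, z) else 0) \<partial>count_space \<phi>)"
    unfolding point_sum_def empty_sum1_def by (intro nn_integral_cong) (auto simp: empty_triangle_def radius_weight_def)
  then show ?thesis unfolding nn_count_restrict .
qed

lemma empty_sum3_eq:
  assumes "\<And>x y z. f x y z = (if noncollinear x y z \<and> P (x, y, z) then g (x, y, z) else 0)"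
  shows "empty_sum3 f circumcenter circumradius \<phi> = (\<integral>\<^sup>+q. g q \<partial>count_space {q \<in> \<phi> \<times> \<phi> \<times> \<phi>. empty_triangle \<phi> q \<and> P q})"
proof -
  have "empty_sum3 f circumcenter circumradius \<phi> = (\<integral>\<^sup>+q. (if empty_triangle \<phi> q \<and> P q then g q else 0) \<partial>count_space (\<phi> \<times> \<phi> \<times> \<phi>))"
    unfolding empty_sum3_def
    by (intro nn_integral_cong) (simp only: empty_triangle_def assms prod.case split: prod.split if_split, blast)
  then show ?thesis unfolding nn_count_restrict .
qed

context segment_frame
begin

definition first_end :: "(real^2) set \<Rightarrow> ((real^2) \<times> (real^2) \<times> (real^2)) set" where
  "first_end \<phi> = {(a, y, z). a \<in> {s, t} \<and> y \<in> \<phi> \<union> {s, t} \<and> z \<in> \<phi> \<union> {s, t} \<and> empty_triangle \<phi> (a, y, z)}"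

text \<open>The factor 4 counts the orderings of a triangle \<open>s\<close>, \<open>t\<close>, z
  that begin with \<open>s\<close> or \<open>t\<close>.\<close>

definition end_sum :: "(real \<Rightarrow> ennreal) \<Rightarrow> (real^2) set \<Rightarrow> ennreal" where
  "end_sum w \<phi> = pair_sum w s \<phi> + pair_sum w t \<phi> + 4 * point_sum w s t \<phi>"

lemma first_end_bound: "(\<integral>\<^sup>+q. radius_weight w q \<partial>count_space (first_end \<phi>)) \<le> end_sum w \<phi>"
proof -
  let ?I = "\<lambda>A. \<integral>\<^sup>+q. radius_weight w q \<partial>count_space A"
  define P where "P = (\<lambda>a. (\<lambda>p. (a, p)) ` {p \<in> \<phi> \<times> \<phi>. empty_triangle \<phi> (a, p)})"
  define Z where "Z = {z \<in> \<phi>. empty_triangle \<phi> (s, t, z)}"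
  have sub: "first_end \<phi> \<subseteq> (P s \<union> P t) \<union> (((\<lambda>z. (s, t, z)) ` Z \<union> (\<lambda>z. (s, z, t)) ` Z) \<union>
      ((\<lambda>z. (t, s, z)) ` Z \<union> (\<lambda>z. (t, z, s)) ` Z))"
  proof
    fix q assume "q \<in> first_end \<phi>"
    then obtain a y z where q: "q = (a, y, z)" "a = s \<or> a = t" "y \<in> \<phi> \<or> y = s \<or> y = t" "z \<in> \<phi> \<or> z = s \<or> z = t"
      "empty_triangle \<phi> (a, y, z)" by (auto simp: first_end_def)
    then have d: "a \<noteq> y" "a \<noteq> z" "y \<noteq> z"
      using noncollinear_distinct by (auto simp: empty_triangle_def)
    consider "y \<in> \<phi>" "z \<in> \<phi>" | "y \<notin> \<phi>" "z \<in> \<phi>" | "y \<in> \<phi>" "z \<notin> \<phi>" | "y \<notin> \<phi>" "z \<notin> \<phi>" by blast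
    then show "q \<in> (P s \<union> P t) \<union> (((\<lambda>z. (s, t, z)) ` Z \<union> (\<lambda>z. (s, z, t)) ` Z) \<union>
      ((\<lambda>z. (t, s, z)) ` Z \<union> (\<lambda>z. (t, z, s)) ` Z))"
    proof cases
      case 1
      then show ?thesis using q by (auto simp: P_def)
    next
      case 2
      then have "(a = s \<and> y = t) \<or> (a = t \<and> y = s)" using q d by auto
      then show ?thesis
      proof
        assume "a = s \<and> y = t"
        then show ?thesis using q 2 by (auto simp: Z_def)
      next
        assume a: "a = t \<and> y = s"
        then have "empty_triangle \<phi> (s, t, z)" using q(5) empty_triangle_perm(1) by blast
        then show ?thesis using q 2 a by (auto simp: Z_def)
      qed
    next
      case 3
      then have "(a = s \<and> z = t) \<or> (a = t \<and> z = s)" using q d by auto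
      then show ?thesis
      proof
        assume a: "a = s \<and> z = t"
        then have "empty_triangle \<phi> (s, t, y)" using q(5) empty_triangle_perm(3) by blast
        then show ?thesis using q 3 a by (auto simp: Z_def)
      next
        assume a: "a = t \<and> z = s"
        then have "empty_triangle \<phi> (t, s, y)" using q(5) empty_triangle_perm(3) by blast
        then have "empty_triangle \<phi> (s, t, y)" using empty_triangle_perm(1) by blast
        then show ?thesis using q 3 a by (auto simp: Z_def)
      qed
    next
      case 4
      then show ?thesis using q d by auto
    qed
  qed
  have z1: "radius_weight w (s, z, t) = radius_weight w (s, t, z)" "radius_weight w (t, s, z) = radius_weight w (s, t, z)"
    "radius_weight w (t, z, s) = radius_weight w (s, t, z)" if "z \<in> Z" for z
  proof -
    have e: "empty_triangle \<phi> (s, t, z)" using that by (simp add: Z_def)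
    show "radius_weight w (s, z, t) = radius_weight w (s, t, z)" using empty_triangle_perm(3)[OF e] by blast
    have e2: "empty_triangle \<phi> (t, s, z)" and *: "radius_weight w (t, s, z) = radius_weight w (s, t, z)"
      using empty_triangle_perm(1)[OF e] by blast+
    show "radius_weight w (t, s, z) = radius_weight w (s, t, z)" by (rule *)
    show "radius_weight w (t, z, s) = radius_weight w (s, t, z)" using empty_triangle_perm(3)[OF e2] * by metis
  qed
  have pts: "?I ((\<lambda>z. (s, t, z)) ` Z) = point_sum w s t \<phi>" "?I ((\<lambda>z. (s, z, t)) ` Z) = point_sum w s t \<phi>"
    "?I ((\<lambda>z. (t, s, z)) ` Z) = point_sum w s t \<phi>" "?I ((\<lambda>z. (t, z, s)) ` Z) = point_sum w s t \<phi>"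
    unfolding point_sum_eq Z_def[symmetric]
    by (subst nn_count_image, simp add: inj_on_def, rule nn_integral_cong, simp add: z1)+
  have prs: "?I (P a) = pair_sum w a \<phi>" for a
    unfolding P_def pair_sum_eq by (subst nn_count_image) (simp_all add: inj_on_def)
  have "?I (first_end \<phi>) \<le> ?I ((P s \<union> P t) \<union> (((\<lambda>z. (s, t, z)) ` Z \<union> (\<lambda>z. (s, z, t)) ` Z) \<union>
      ((\<lambda>z. (t, s, z)) ` Z \<union> (\<lambda>z. (t, z, s)) ` Z)))"
    by (rule nn_count_subset[OF sub])
  also have "\<dots> \<le> (?I (P s) + ?I (P t)) + ((?I ((\<lambda>z. (s, t, z)) ` Z) + ?I ((\<lambda>z. (s, z, t)) ` Z)) +
     (?I ((\<lambda>z. (t, s, z)) ` Z) + ?I ((\<lambda>z. (t, z, s)) ` Z)))"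
    by (intro order_trans[OF nn_count_Un] add_mono nn_count_Un)
  also have "\<dots> = end_sum w \<phi>"
  proof -
    have "(x + x) + (x + x) = 4 * x" for x :: ennreal
      by (metis (no_types, opaque_lifting) mult.assoc mult_2 numeral_Bit0 numeral_times_numeral one_add_one)
    then show ?thesis unfolding pts prs end_sum_def by simp
  qed
  finally show ?thesis .
qed

text \<open>Emptiness is required only with respect to \<open>\<phi>\<close>. This can only enlarge
  the set, which suits an upper bound and lets the Poisson sums apply.\<close>

definition mixed :: "(real^2) set \<Rightarrow> ((real^2) \<times> (real^2) \<times> (real^2)) set" where
  "mixed \<phi> = {q \<in> (\<phi> \<union> {s, t}) \<times> (\<phi> \<union> {s, t}) \<times> (\<phi> \<union> {s, t}). q \<notin> \<phi> \<times> \<phi> \<times> \<phi> \<and> empty_triangle \<phi> q}"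

text \<open>The end of the segment may stand at three places of the triple; a transposition, which
  preserves circle and radius, brings it to the first one.\<close>

lemma mixed_bound: "(\<integral>\<^sup>+q. radius_weight w q \<partial>count_space (mixed \<phi>)) \<le> 3 * end_sum w \<phi>"
proof -
  let ?I = "\<lambda>A. \<integral>\<^sup>+q. radius_weight w q \<partial>count_space A"
  let ?s2 = "\<lambda>(x, y, z). (y, x, z) :: (real^2) \<times> (real^2) \<times> (real^2)"
  let ?s3 = "\<lambda>(x, y, z). (z, y, x) :: (real^2) \<times> (real^2) \<times> (real^2)"
  have sub: "mixed \<phi> \<subseteq> first_end \<phi> \<union> (?s2 ` first_end \<phi> \<union> ?s3 ` first_end \<phi>)"
  proof
    fix q assume q: "q \<in> mixed \<phi>"
    obtain x y z where xyz: "q = (x, y, z)" by (cases q)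
    have e: "empty_triangle \<phi> (x, y, z)" and m: "x \<in> \<phi> \<union> {s, t}" "y \<in> \<phi> \<union> {s, t}" "z \<in> \<phi> \<union> {s, t}"
      and ex: "x \<in> {s, t} \<or> y \<in> {s, t} \<or> z \<in> {s, t}"
      using q unfolding mixed_def xyz by auto
    from ex show "q \<in> first_end \<phi> \<union> (?s2 ` first_end \<phi> \<union> ?s3 ` first_end \<phi>)"
    proof (elim disjE)
      assume "x \<in> {s, t}"
      then show ?thesis using e m by (auto simp: first_end_def xyz)
    next
      assume "y \<in> {s, t}"
      then have "(y, x, z) \<in> first_end \<phi>" using empty_triangle_perm(1)[OF e] m by (auto simp: first_end_def)
      then have "?s2 (y, x, z) \<in> ?s2 ` first_end \<phi>" by (rule imageI)
      then show ?thesis by (simp add: xyz)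
    next
      assume "z \<in> {s, t}"
      then have "(z, y, x) \<in> first_end \<phi>" using empty_triangle_perm(2)[OF e] m by (auto simp: first_end_def)
      then have "?s3 (z, y, x) \<in> ?s3 ` first_end \<phi>" by (rule imageI)
      then show ?thesis by (simp add: xyz)
    qed
  qed
  have s2: "?I (?s2 ` first_end \<phi>) = ?I (first_end \<phi>)"
  proof -
    have "?I (?s2 ` first_end \<phi>) = (\<integral>\<^sup>+q. radius_weight w (?s2 q) \<partial>count_space (first_end \<phi>))"
      by (rule nn_count_image) (auto simp: inj_on_def)
    also have "\<dots> = ?I (first_end \<phi>)"
      by (intro nn_integral_cong) (auto simp: first_end_def dest: empty_triangle_perm(1)[where w = w])
    finally show ?thesis .
  qed
  have s3: "?I (?s3 ` first_end \<phi>) = ?I (first_end \<phi>)"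
  proof -
    have "?I (?s3 ` first_end \<phi>) = (\<integral>\<^sup>+q. radius_weight w (?s3 q) \<partial>count_space (first_end \<phi>))"
      by (rule nn_count_image) (auto simp: inj_on_def)
    also have "\<dots> = ?I (first_end \<phi>)"
      by (intro nn_integral_cong) (auto simp: first_end_def dest: empty_triangle_perm(2)[where w = w])
    finally show ?thesis .
  qed
  have "?I (mixed \<phi>) \<le> ?I (first_end \<phi> \<union> (?s2 ` first_end \<phi> \<union> ?s3 ` first_end \<phi>))"
    by (rule nn_count_subset[OF sub])
  also have "\<dots> \<le> ?I (first_end \<phi>) + (?I (?s2 ` first_end \<phi>) + ?I (?s3 ` first_end \<phi>))"
    by (intro order_trans[OF nn_count_Un] add_mono nn_count_Un order_refl)
  also have "\<dots> = 3 * ?I (first_end \<phi>)"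
  proof -
    have "x + (x + x) = 3 * x" for x :: ennreal
    proof -
      have "3 * x = (1 + 2) * x" by simp
      then show ?thesis by (simp only: distrib_right mult_2 mult_1_left)
    qed
    then show ?thesis unfolding s2 s3 .
  qed
  also have "\<dots> \<le> 3 * end_sum w \<phi>"
    by (intro mult_left_mono first_end_bound) simp
  finally show ?thesis .
qed

definition near_weight :: "real^2 \<Rightarrow> real^2 \<Rightarrow> real^2 \<Rightarrow> ennreal" where
  "near_weight x y z = (if noncollinear x y z \<and> near_end x y z then ennreal (2 * circumradius x y z) else 0)"

text \<open>Its sum serves only to show that almost surely finitely many triples of Poisson points
  cross the segment; no uniformity in n is claimed.\<close>

definition cross_count :: "real^2 \<Rightarrow> real^2 \<Rightarrow> real^2 \<Rightarrow> ennreal" where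
  "cross_count x y z = (if noncollinear x y z \<and> crosses x y z then 1 else 0)"

abbreviation main_sum :: "(real^2) set \<Rightarrow> ennreal" where
  "main_sum \<equiv> empty_sum3 main_weight circumcenter circumradius"

abbreviation near_sum :: "(real^2) set \<Rightarrow> ennreal" where
  "near_sum \<equiv> empty_sum3 near_weight circumcenter circumradius"

abbreviation diam_weight :: "real \<Rightarrow> ennreal" where
  "diam_weight \<equiv> \<lambda>r. ennreal (2 * r)"

text \<open>Three sources of discrepancy: triples near an end, triples with \<open>s\<close> or
  \<open>t\<close> as a vertex, and the case in which the path is [s, t] itself, whose doubled
  length is at most two circumdiameters.\<close>

definition error_sum :: "(real^2) set \<Rightarrow> ennreal" where
  "error_sum \<phi> = near_sum \<phi> + 3 * end_sum diam_weight \<phi> + 2 * point_sum diam_weight s t \<phi>"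

abbreviation up_length :: "(real^2) set \<Rightarrow> real" where
  "up_length \<phi> \<equiv> path_length (upper_path (\<phi> \<union> {s, t}) s t u)"

definition main_cond :: "(real^2) \<times> (real^2) \<times> (real^2) \<Rightarrow> bool" where
  "main_cond = (\<lambda>(x, y, z). 0 < hgt x \<and> 0 < hgt y \<and> hgt z < 0 \<and> 0 \<le> absc x \<and> absc x \<le> len)"

definition edge_weight :: "(real^2) \<times> (real^2) \<times> (real^2) \<Rightarrow> ennreal" where
  "edge_weight = (\<lambda>(x, y, z). ennreal (dist x y))"

lemma edge_le_radius: "empty_triangle \<phi> q \<Longrightarrow> edge_weight q \<le> radius_weight diam_weight q"
proof (cases q)
  case (fields x y z)
  assume "empty_triangle \<phi> q"
  then have nc: "noncollinear x y z" by (simp add: empty_triangle_def fields)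
  have "dist x y \<le> 2 * circumradius x y z"
    using dist_triangle[of x y "circumcenter x y z"] dist_circumcenter[OF nc] by (simp add: dist_commute)
  then show ?thesis by (simp add: fields edge_weight_def radius_weight_def ennreal_leI)
qed

lemma main_sum_eq: "main_sum \<phi> = (\<integral>\<^sup>+q. edge_weight q \<partial>count_space {q \<in> \<phi> \<times> \<phi> \<times> \<phi>. empty_triangle \<phi> q \<and> main_cond q})"
  by (rule empty_sum3_eq) (simp add: main_weight_def main_cond_def edge_weight_def)

lemma near_sum_eq: "near_sum \<phi> = (\<integral>\<^sup>+q. radius_weight diam_weight q
    \<partial>count_space {q \<in> \<phi> \<times> \<phi> \<times> \<phi>. empty_triangle \<phi> q \<and> (case q of (x, y, z) \<Rightarrow> near_end x y z)})"
  by (rule empty_sum3_eq) (simp add: near_weight_def radius_weight_def)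

lemma cross_sum_eq: "empty_sum3 cross_count circumcenter circumradius \<phi> = (\<integral>\<^sup>+q. 1
    \<partial>count_space {q \<in> \<phi> \<times> \<phi> \<times> \<phi>. empty_triangle \<phi> q \<and> (case q of (x, y, z) \<Rightarrow> crosses x y z)})"
  by (rule empty_sum3_eq) (simp add: cross_count_def)

lemma up_triplesD: "(x, y, z) \<in> up_triples \<psi> \<Longrightarrow> x \<in> \<psi> \<and> y \<in> \<psi> \<and> z \<in> \<psi> \<and> noncollinear x y z \<and>
    crosses x y z \<and> 0 \<le> hgt x \<and> 0 \<le> hgt y"
  by (simp add: up_triples_def)

lemma up_triples_empty: "q \<in> up_triples (\<phi> \<union> {s, t}) \<Longrightarrow> empty_triangle \<phi> q"
  by (cases q) (auto simp: up_triples_def empty_triangle_def)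

lemma finite_up_triples:
  assumes "empty_sum3 cross_count circumcenter circumradius \<phi> < \<infinity>" "end_sum (\<lambda>_. 1) \<phi> < \<infinity>"
  shows "finite (up_triples (\<phi> \<union> {s, t}))"
proof (rule nn_count_one_less_top[THEN iffD1])
  let ?C = "{q \<in> \<phi> \<times> \<phi> \<times> \<phi>. empty_triangle \<phi> q \<and> (case q of (x, y, z) \<Rightarrow> crosses x y z)}"
  have "up_triples (\<phi> \<union> {s, t}) \<subseteq> ?C \<union> mixed \<phi>"
  proof
    fix q assume q: "q \<in> up_triples (\<phi> \<union> {s, t})"
    obtain x y z where xyz: "q = (x, y, z)" by (cases q)
    note e = up_triples_empty[OF q]
    have "x \<in> \<phi> \<union> {s, t}" "y \<in> \<phi> \<union> {s, t}" "z \<in> \<phi> \<union> {s, t}" "crosses x y z"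
      using up_triplesD[OF q[unfolded xyz]] by (simp_all only:)
    then show "q \<in> ?C \<union> mixed \<phi>"
      using e unfolding xyz mixed_def Un_iff mem_Collect_eq prod.case mem_Sigma_iff by blast
  qed
  then have "(\<integral>\<^sup>+q. 1 \<partial>count_space (up_triples (\<phi> \<union> {s, t}))) \<le> (\<integral>\<^sup>+q. 1 \<partial>count_space (?C \<union> mixed \<phi>))"
    by (rule nn_count_subset)
  also have "\<dots> \<le> (\<integral>\<^sup>+q. 1 \<partial>count_space ?C) + (\<integral>\<^sup>+q. 1 \<partial>count_space (mixed \<phi>))"
    by (rule nn_count_Un)
  also have "\<dots> \<le> empty_sum3 cross_count circumcenter circumradius \<phi> + 3 * end_sum (\<lambda>_. 1) \<phi>"
    using mixed_bound[where w = "\<lambda>_. 1" and \<phi> = \<phi>]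
    unfolding cross_sum_eq radius_weight_one by (simp only: add_left_mono)
  also have "\<dots> < \<infinity>"
    using assms by (simp add: ennreal_mult_less_top)
  finally show "(\<integral>\<^sup>+q. 1 \<partial>count_space (up_triples (\<phi> \<union> {s, t}))) < \<infinity>" .
qed

lemma far_if_not_near:
  assumes "\<not> near_end x y z"
  shows "circumradius x y z < dist (circumcenter x y z) s" "circumradius x y z < dist (circumcenter x y z) t"
  using assms circumradius_nonneg[of x y z] unfolding near_end_def de_Morgan_disj not_le by linarith+

text \<open>Away from the ends the triangle crosses by \<open>not_crosses_near\<close>, and its disk
  contains neither \<open>s\<close> nor \<open>t\<close>, so it stays empty in the enlarged
  configuration.\<close>

lemma main_cond_near_or_crosses:
  assumes "empty_triangle \<phi> q" "q \<in> \<phi> \<times> \<phi> \<times> \<phi>" "main_cond q" "\<not> (case q of (x, y, z) \<Rightarrow> near_end x y z)"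
  shows "q \<in> up_triples (\<phi> \<union> {s, t})"
proof (cases q)
  case (fields x y z)
  have nc: "noncollinear x y z" and e: "\<phi> \<inter> ball (circumcenter x y z) (circumradius x y z) = {}"
    using assms(1) by (simp_all add: empty_triangle_def fields)
  have nn: "\<not> near_end x y z" using assms(4) by (simp add: fields)
  have "crosses x y z"
    using not_crosses_near[OF nc] assms(3) nn unfolding main_cond_def fields by auto
  moreover have "s \<notin> ball (circumcenter x y z) (circumradius x y z)" "t \<notin> ball (circumcenter x y z) (circumradius x y z)"
    using far_if_not_near[OF nn] by simp_all
  ultimately show ?thesis
    using assms(2,3) nc e unfolding fields up_triples_def main_cond_def by auto
qed

lemma main_sum_le_near:
  assumes "{q \<in> \<phi> \<times> \<phi> \<times> \<phi>. empty_triangle \<phi> q \<and> main_cond q} \<subseteq>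
      A \<union> {q \<in> \<phi> \<times> \<phi> \<times> \<phi>. empty_triangle \<phi> q \<and> (case q of (x, y, z) \<Rightarrow> near_end x y z)}"
  shows "main_sum \<phi> \<le> (\<integral>\<^sup>+q. edge_weight q \<partial>count_space A) + near_sum \<phi>"
proof -
  let ?N = "{q \<in> \<phi> \<times> \<phi> \<times> \<phi>. empty_triangle \<phi> q \<and> (case q of (x, y, z) \<Rightarrow> near_end x y z)}"
  have "main_sum \<phi> \<le> (\<integral>\<^sup>+q. edge_weight q \<partial>count_space A) + (\<integral>\<^sup>+q. edge_weight q \<partial>count_space ?N)"
    unfolding main_sum_eq by (rule order_trans[OF nn_count_subset[OF assms] nn_count_Un])
  also have "(\<integral>\<^sup>+q. edge_weight q \<partial>count_space ?N) \<le> near_sum \<phi>"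
    unfolding near_sum_eq by (rule nn_integral_mono) (auto intro: edge_le_radius)
  finally show ?thesis by (simp add: add_left_mono)
qed

text \<open>Outside the Delaunay edge case, both bounds are inclusions of index sets: an upper
  triple is a main triple, near an end or mixed, and a main triple is an upper triple or near an
  end. Off the line \<open>h\<close> makes the heights of Poisson vertices strict. Exceptional edges
  are bounded by circumdiameters.\<close>

lemma up_length_bounds:
  assumes fin: "finite (up_triples (\<phi> \<union> {s, t}))" and h: "\<And>x. x \<in> \<phi> \<Longrightarrow> hgt x \<noteq> 0"
  shows "ennreal (2 * up_length \<phi>) \<le> main_sum \<phi> + error_sum \<phi>"
    and "main_sum \<phi> \<le> ennreal (2 * up_length \<phi>) + error_sum \<phi>"
proof -
  let ?\<psi> = "\<phi> \<union> {s, t}"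
  let ?N = "{q \<in> \<phi> \<times> \<phi> \<times> \<phi>. empty_triangle \<phi> q \<and> (case q of (x, y, z) \<Rightarrow> near_end x y z)}"
  let ?K = "{q \<in> \<phi> \<times> \<phi> \<times> \<phi>. empty_triangle \<phi> q \<and> main_cond q}"
  have near_le: "near_sum \<phi> \<le> error_sum \<phi>" unfolding error_sum_def by (simp add: add.assoc)
  have "ennreal (2 * up_length \<phi>) \<le> main_sum \<phi> + error_sum \<phi> \<and> main_sum \<phi> \<le> ennreal (2 * up_length \<phi>) + error_sum \<phi>"
  \<comment> \<open>If [s, t] is a Delaunay edge, the path ignores the upper triples, so the main
    sum itself has to be absorbed by the error: every main triple is shown to be near an
    end.\<close>
  proof (cases "closed_segment s t \<in> delaunay_edges ?\<psi>")
    case True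
    then have L: "up_length \<phi> = dist s t" by (simp add: path_length_eq)
    from True obtain z where z: "z \<in> ?\<psi>" "noncollinear s t z" "?\<psi> \<inter> ball (circumcenter s t z) (circumradius s t z) = {}"
      unfolding segment_delaunay_iff by blast
    have zp: "z \<in> \<phi>" using z(1) noncollinear_distinct[OF z(2)] by auto
    have ez: "empty_triangle \<phi> (s, t, z)" using z by (auto simp: empty_triangle_def)
    have "edge_weight (s, t, z) \<le> radius_weight diam_weight (s, t, z)" by (rule edge_le_radius[OF ez])
    also have "\<dots> = (\<integral>\<^sup>+z. radius_weight diam_weight (s, t, z) \<partial>count_space {z})"
      by (simp add: nn_integral_count_space_finite)
    also have "\<dots> \<le> point_sum diam_weight s t \<phi>"
      unfolding point_sum_eq by (rule nn_count_subset) (use zp ez in simp)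
    finally have "ennreal (dist s t) \<le> point_sum diam_weight s t \<phi>" by (simp add: edge_weight_def)
    then have "2 * ennreal (dist s t) \<le> 2 * point_sum diam_weight s t \<phi>" by (rule mult_left_mono) simp
    then have "ennreal (2 * up_length \<phi>) \<le> 2 * point_sum diam_weight s t \<phi>"
      unfolding L by (simp add: ennreal_mult)
    also have "\<dots> \<le> main_sum \<phi> + error_sum \<phi>"
      unfolding error_sum_def add.assoc[symmetric] by (rule add_increasing) simp_all
    finally have 1: "ennreal (2 * up_length \<phi>) \<le> main_sum \<phi> + error_sum \<phi>" .
    have "?K \<subseteq> {} \<union> ?N"
    proof
      fix q assume q: "q \<in> ?K"
      show "q \<in> {} \<union> ?N"
      proof (rule ccontr)
        assume "q \<notin> {} \<union> ?N"
        then have nn: "\<not> (case q of (x, y, z) \<Rightarrow> near_end x y z)" using q by blast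
        obtain a b c where abc: "q = (a, b, c)" by (cases q)
        have "(a, b, c) \<in> up_triples ?\<psi>"
          using main_cond_near_or_crosses[OF _ _ _ nn, of \<phi>] q unfolding abc by blast
        from up_triplesD[OF this] have nc: "noncollinear a b c" and cr: "crosses a b c"
          and m: "a \<in> ?\<psi>" "b \<in> ?\<psi>" "c \<in> ?\<psi>"
          by (simp_all only:)
        \<comment> \<open>The empty circle through \<open>s\<close>, \<open>t\<close>, z has
          \<open>a\<close>, \<open>b\<close>, \<open>c\<close> on or outside it; this is the circle
          that \<open>no_crossing_of_edge\<close> plays off against the one of the triple.\<close>
        have "circumradius s t z \<le> dist (circumcenter s t z) p" if "p \<in> ?\<psi>" for p
          using that z(3) by (force simp: disjoint_iff)
        then have out: "circumradius s t z \<le> dist (circumcenter s t z) a" "circumradius s t z \<le> dist (circumcenter s t z) b"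
          "circumradius s t z \<le> dist (circumcenter s t z) c" using m by blast+
        have "circumradius a b c < dist (circumcenter a b c) s" "circumradius a b c < dist (circumcenter a b c) t"
          using far_if_not_near[of a b c] nn unfolding abc by simp_all
        then show False
          using no_crossing_of_edge[OF nc cr dist_circumcenter(1,2)[OF z(2)] out] by blast
      qed
    qed
    from main_sum_le_near[OF this] have "main_sum \<phi> \<le> near_sum \<phi>" by (simp add: nn_integral_empty)
    also have "\<dots> \<le> ennreal (2 * up_length \<phi>) + error_sum \<phi>"
      using near_le by (rule order_trans) simp
    finally show ?thesis using 1 by blast
  next
    case False
    have L0: "2 * up_length \<phi> = (\<Sum>q\<in>up_triples ?\<psi>. (case q of (x, y, z) \<Rightarrow> dist x y))"
      using False fin by (simp add: path_length_eq)
    have L: "ennreal (2 * up_length \<phi>) = (\<integral>\<^sup>+q. edge_weight q \<partial>count_space (up_triples ?\<psi>))"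
    proof -
      have "(\<integral>\<^sup>+q. edge_weight q \<partial>count_space (up_triples ?\<psi>)) = (\<Sum>q\<in>up_triples ?\<psi>. ennreal (case q of (x, y, z) \<Rightarrow> dist x y))"
        using fin by (subst nn_integral_count_space_finite) (auto simp: edge_weight_def case_prod_beta')
      also have "\<dots> = ennreal (\<Sum>q\<in>up_triples ?\<psi>. (case q of (x, y, z) \<Rightarrow> dist x y))"
        by (rule sum_ennreal) auto
      finally show ?thesis by (simp only: L0)
    qed
    have "up_triples ?\<psi> \<subseteq> (?K \<union> ?N) \<union> mixed \<phi>"
    proof
      fix q assume q: "q \<in> up_triples ?\<psi>"
      obtain x y z where xyz: "q = (x, y, z)" by (cases q)
      note e = up_triples_empty[OF q]
      have u: "x \<in> ?\<psi>" "y \<in> ?\<psi>" "z \<in> ?\<psi>" "noncollinear x y z" "crosses x y z" "0 \<le> hgt x" "0 \<le> hgt y"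
        using up_triplesD[OF q[unfolded xyz]] by (simp_all only:)
      show "q \<in> (?K \<union> ?N) \<union> mixed \<phi>"
      proof (cases "q \<in> \<phi> \<times> \<phi> \<times> \<phi>")
        case False
        then show ?thesis using u(1,2,3) e unfolding xyz mixed_def Un_iff mem_Collect_eq mem_Sigma_iff by blast
      next
        case True
        then have "hgt x \<noteq> 0" "hgt y \<noteq> 0" using h unfolding xyz by blast+
        then have hh: "0 < hgt x" "0 < hgt y" "hgt z < 0"
          using u(6,7) crosses_heights[OF u(4,5,6,7)] by simp_all
        show ?thesis
          using True e hh crosses_absc[OF u(4,5)]
          unfolding xyz main_cond_def Un_iff mem_Collect_eq prod.case by blast
      qed
    qed
    then have "(\<integral>\<^sup>+q. edge_weight q \<partial>count_space (up_triples ?\<psi>)) \<le> (\<integral>\<^sup>+q. edge_weight q \<partial>count_space ((?K \<union> ?N) \<union> mixed \<phi>))"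
      by (rule nn_count_subset)
    also have "\<dots> \<le> ((\<integral>\<^sup>+q. edge_weight q \<partial>count_space ?K) + (\<integral>\<^sup>+q. edge_weight q \<partial>count_space ?N)) +
        (\<integral>\<^sup>+q. edge_weight q \<partial>count_space (mixed \<phi>))"
      by (intro order_trans[OF nn_count_Un] add_mono nn_count_Un order_refl)
    also have "\<dots> \<le> (main_sum \<phi> + near_sum \<phi>) + 3 * end_sum diam_weight \<phi>"
    proof (intro add_mono)
      show "(\<integral>\<^sup>+q. edge_weight q \<partial>count_space ?K) \<le> main_sum \<phi>" by (simp add: main_sum_eq)
      show "(\<integral>\<^sup>+q. edge_weight q \<partial>count_space ?N) \<le> near_sum \<phi>"
        unfolding near_sum_eq by (rule nn_integral_mono) (auto intro: edge_le_radius)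
      have "(\<integral>\<^sup>+q. edge_weight q \<partial>count_space (mixed \<phi>)) \<le> (\<integral>\<^sup>+q. radius_weight diam_weight q \<partial>count_space (mixed \<phi>))"
        by (rule nn_integral_mono) (auto simp: mixed_def intro: edge_le_radius)
      also have "\<dots> \<le> 3 * end_sum diam_weight \<phi>" by (rule mixed_bound)
      finally show "(\<integral>\<^sup>+q. edge_weight q \<partial>count_space (mixed \<phi>)) \<le> 3 * end_sum diam_weight \<phi>" .
    qed
    also have "\<dots> \<le> main_sum \<phi> + error_sum \<phi>"
      unfolding error_sum_def add.assoc by (intro add_left_mono) simp
    finally have 1: "ennreal (2 * up_length \<phi>) \<le> main_sum \<phi> + error_sum \<phi>" unfolding L .
    have "?K \<subseteq> up_triples ?\<psi> \<union> ?N"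
      using main_cond_near_or_crosses[of \<phi>] by blast
    from main_sum_le_near[OF this] have "main_sum \<phi> \<le> ennreal (2 * up_length \<phi>) + near_sum \<phi>" unfolding L .
    also have "\<dots> \<le> ennreal (2 * up_length \<phi>) + error_sum \<phi>" using near_le by (rule add_left_mono)
    finally show ?thesis using 1 by blast
  qed
  then show "ennreal (2 * up_length \<phi>) \<le> main_sum \<phi> + error_sum \<phi>"
    and "main_sum \<phi> \<le> ennreal (2 * up_length \<phi>) + error_sum \<phi>" by blast+
qed

end

section \<open>The error term\<close>

text \<open>The two differences vanish at 0 and have the derivatives y^8 / (1 + y^2) and y^6 / (1 +
  y^2).\<close>

lemma arctan_poly_bounds:
  fixes x :: real
  assumes "x \<ge> 0"
  shows "x - x ^ 3 / 3 + x ^ 5 / 5 - x ^ 7 / 7 \<le> arctan x" "arctan x \<le> x - x ^ 3 / 3 + x ^ 5 / 5"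
proof -
  have pos: "1 + y\<^sup>2 > 0" for y :: real by (rule add_pos_nonneg) simp_all
  let ?f = "\<lambda>y. arctan y - (y - y ^ 3 / 3 + y ^ 5 / 5 - y ^ 7 / 7)"
  let ?g = "\<lambda>y. y - y ^ 3 / 3 + y ^ 5 / 5 - arctan y"
  have f: "(?f has_real_derivative y ^ 8 / (1 + y\<^sup>2)) (at y)" for y
    by (auto intro!: derivative_eq_intros) (use pos[of y] in \<open>simp add: field_simps power2_eq_square power_numeral_reduce\<close>)
  have g: "(?g has_real_derivative y ^ 6 / (1 + y\<^sup>2)) (at y)" for y
    by (auto intro!: derivative_eq_intros) (use pos[of y] in \<open>simp add: field_simps power2_eq_square power_numeral_reduce\<close>)
  have "?f 0 \<le> ?f x"
    by (rule DERIV_nonneg_imp_nondecreasing[OF assms]) (use f pos less_imp_le in fastforce)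
  then show "x - x ^ 3 / 3 + x ^ 5 / 5 - x ^ 7 / 7 \<le> arctan x" by simp
  have "?g 0 \<le> ?g x"
    by (rule DERIV_nonneg_imp_nondecreasing[OF assms]) (use g pos less_imp_le in fastforce)
  then show "arctan x \<le> x - x ^ 3 / 3 + x ^ 5 / 5" by simp
qed

text \<open>Machin's formula pi / 4 = 4 arctan(1/5) - arctan(1/239), evaluated with the polynomial
  bounds.\<close>

lemma pi_bounds: "3.1415 < pi" "pi < 3.1417"
  using machin arctan_poly_bounds[of "1/5"] arctan_poly_bounds[of "1/239"]
  by (simp_all add: field_simps eval_nat_numeral)

text \<open>The approximate value 1.182 is read as rounding to three decimals, hence the
  tolerance.\<close>

lemma constant_bounds: "\<bar>35 / (3 * pi\<^sup>2) - 1.182\<bar> < 0.0005"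
proof -
  have "3.1415\<^sup>2 < pi\<^sup>2" "pi\<^sup>2 < 3.1417\<^sup>2"
    using pi_bounds by (auto intro!: power_strict_mono)
  then have b: "9.869 < pi\<^sup>2" "pi\<^sup>2 < 9.8703" by (simp_all add: power2_eq_square)
  have "35 / (3 * pi\<^sup>2) < 1.1825" "1.1815 < 35 / (3 * pi\<^sup>2)"
    using b by (simp_all add: field_simps)
  moreover have "\<bar>x - 1.182\<bar> < 0.0005" if "x < 1.1825" "1.1815 < x" for x :: real
    by (rule abs_less_iff[THEN iffD2]) (use that in simp)
  ultimately show ?thesis by blast
qed

section \<open>Measurability of the sums\<close>

lemma measurable_empty_sum2:
  fixes f :: "'a::euclidean_space \<Rightarrow> 'a \<Rightarrow> ennreal"
  assumes m: "(\<lambda>(x, y). f x y) \<in> borel_measurable (borel \<Otimes>\<^sub>M borel)"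
    "(\<lambda>(x, y). c x y) \<in> borel_measurable (borel \<Otimes>\<^sub>M borel)"
    "(\<lambda>(x, y). r x y) \<in> borel_measurable (borel \<Otimes>\<^sub>M borel)"
    and d: "\<And>x y. f x y \<noteq> 0 \<Longrightarrow> x \<noteq> y \<and> x \<notin> ball (c x y) (r x y) \<and> y \<notin> ball (c x y) (r x y)"
  shows "empty_sum2 f c r \<in> borel_measurable config_space"
proof -
  let ?g = "\<lambda>(x, y, \<phi>). if \<phi> \<inter> ball (c x y) (r x y) = {} then f x y else 0"
  have g [measurable]: "?g \<in> borel_measurable (borel \<Otimes>\<^sub>M borel \<Otimes>\<^sub>M config_space)"
    by (rule measurable_void_if2[OF m])
  define G where "G = (\<lambda>(p, \<phi>). \<integral>\<^sup>+z. ?g (p, z, \<phi> - {z}) \<partial>count_space \<phi>)"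
  have G: "G \<in> borel_measurable (borel \<Otimes>\<^sub>M config_space)"
    unfolding G_def by (rule measurable_nn_sum_config[OF g])
  have "empty_sum2 f c r = (\<lambda>\<phi>. \<integral>\<^sup>+x. G (x, \<phi> - {x}) \<partial>count_space \<phi>)"
    by (rule ext) (simp add: empty_sum2_nested[OF d] G_def cong: if_cong)
  then show ?thesis
    using measurable_nn_sum_config'[OF G] by simp
qed

lemma measurable_empty_sum1:
  fixes f :: "'a::euclidean_space \<Rightarrow> ennreal"
  assumes m: "f \<in> borel_measurable borel" "c \<in> borel_measurable borel" "r \<in> borel_measurable borel"
    and d: "\<And>x. f x \<noteq> 0 \<Longrightarrow> x \<notin> ball (c x) (r x)"
  shows "empty_sum1 f c r \<in> borel_measurable config_space"
proof -
  have "empty_sum1 f c r = (\<lambda>\<phi>. \<integral>\<^sup>+x. (\<lambda>(x, \<phi>). if \<phi> \<inter> ball (c x) (r x) = {} then f x else 0) (x, \<phi> - {x}) \<partial>count_space \<phi>)"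
    by (rule ext) (simp add: empty_sum1_nested[OF d] cong: if_cong)
  then show ?thesis
    using measurable_nn_sum_config'[OF measurable_void_if1[OF m]] by simp
qed

lemma circumscribed_not_inside:
  fixes x y z :: "real^2"
  assumes "noncollinear x y z"
  shows "x \<noteq> y \<and> x \<noteq> z \<and> y \<noteq> z \<and>
    x \<notin> ball (circumcenter x y z) (circumradius x y z) \<and> y \<notin> ball (circumcenter x y z) (circumradius x y z) \<and>
    z \<notin> ball (circumcenter x y z) (circumradius x y z)"
  using noncollinear_distinct[OF assms] dist_circumcenter[OF assms] by simp

lemma circum_measurable3:
  "(\<lambda>(x, y, z). circumcenter x y z :: real^2) \<in> borel_measurable (borel \<Otimes>\<^sub>M borel \<Otimes>\<^sub>M borel)"
  "(\<lambda>(x, y, z). circumradius x y (z :: real^2)) \<in> borel_measurable (borel \<Otimes>\<^sub>M borel \<Otimes>\<^sub>M borel)"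
  by measurable

lemma measurable_circum_sum:
  fixes f :: "real^2 \<Rightarrow> real^2 \<Rightarrow> real^2 \<Rightarrow> ennreal"
  assumes "(\<lambda>(x, y, z). f x y z) \<in> borel_measurable (borel \<Otimes>\<^sub>M borel \<Otimes>\<^sub>M borel)"
    and "\<And>x y z. f x y z \<noteq> 0 \<Longrightarrow> noncollinear x y z"
  shows "empty_sum3 f circumcenter circumradius \<in> borel_measurable config_space"
  by (rule measurable_empty_sum3[OF assms(1) circum_measurable3 circumscribed_not_inside[OF assms(2)]])

lemma measurable_point_sum:
  assumes [measurable]: "w \<in> borel_measurable borel"
  shows "point_sum w a b \<in> borel_measurable config_space"
  unfolding point_sum_def
proof (rule measurable_empty_sum1)
  show "z \<notin> ball (circumcenter a b z) (circumradius a b z)"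
    if "(if noncollinear a b z then w (circumradius a b z) else 0) \<noteq> 0" for z
    using that circumscribed_not_inside[of a b z] by (auto split: if_splits)
qed measurable

lemma measurable_pair_sum:
  assumes [measurable]: "w \<in> borel_measurable borel"
  shows "pair_sum w a \<in> borel_measurable config_space"
  unfolding pair_sum_def
proof (rule measurable_empty_sum2)
  show "y \<noteq> z \<and> y \<notin> ball (circumcenter a y z) (circumradius a y z) \<and> z \<notin> ball (circumcenter a y z) (circumradius a y z)"
    if "(if noncollinear a y z then w (circumradius a y z) else 0) \<noteq> 0" for y z
    using that circumscribed_not_inside[of a y z] by (auto split: if_splits)
qed measurable

context poisson_process
begin

lemma expected_circum_sum:
  fixes f :: "real^2 \<Rightarrow> real^2 \<Rightarrow> real^2 \<Rightarrow> ennreal"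
  assumes "(\<lambda>(x, y, z). f x y z) \<in> borel_measurable (borel \<Otimes>\<^sub>M borel \<Otimes>\<^sub>M borel)"
    and "\<And>x y z. f x y z \<noteq> 0 \<Longrightarrow> noncollinear x y z"
  shows "(\<integral>\<^sup>+\<omega>. empty_sum3 f circumcenter circumradius (X \<omega>) \<partial>M) =
    ennreal n ^ 3 * (\<integral>\<^sup>+x. (\<integral>\<^sup>+y. (\<integral>\<^sup>+z. f x y z * ennreal (exp (- (n * pi * (circumradius x y z)\<^sup>2))) \<partial>lborel) \<partial>lborel) \<partial>lborel)"
  by (rule expected_empty_sum3[OF assms(1) circum_measurable3 circumradius_nonneg circumscribed_not_inside[OF assms(2)]])

text \<open>54 = 2 * 27: one half of the exponent n pi R^2 is available, and three vertices within 3
  R of \<open>a\<close> have squared distances with sum at most 27 R^2. The integral is 54 / n, so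
  each factor n of the Mecke formula becomes the constant 54.\<close>

definition gauss :: "real^2 \<Rightarrow> real^2 \<Rightarrow> ennreal" where
  "gauss a x = ennreal (exp (- (n * pi / 54) * (dist a x)\<^sup>2))"

lemma gauss_measurable [measurable]: "gauss a \<in> borel_measurable borel"
  unfolding gauss_def[abs_def] by measurable

lemma gauss_integral: "(\<integral>\<^sup>+x. gauss a x \<partial>lborel) = ennreal (54 / n)"
  unfolding gauss_def using intensity_pos by (subst nn_integral_gaussian_plane) simp_all

lemma intensity_cancel: "ennreal n * ennreal (54 / n) = 54"
  using intensity_pos by (simp flip: ennreal_mult')

lemma gauss_integral1: "ennreal n * (\<integral>\<^sup>+x. C * gauss a x \<partial>lborel) = C * 54"
  by (simp add: nn_integral_cmult gauss_integral) (metis intensity_cancel mult.assoc mult.commute)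

lemma gauss_integral2: "ennreal n ^ 2 * (\<integral>\<^sup>+x. (\<integral>\<^sup>+y. C * (gauss a x * gauss a y) \<partial>lborel) \<partial>lborel) = C * 54 ^ 2"
proof -
  have "(\<integral>\<^sup>+x. (\<integral>\<^sup>+y. C * (gauss a x * gauss a y) \<partial>lborel) \<partial>lborel) = C * (ennreal (54 / n) * ennreal (54 / n))"
    by (simp add: nn_integral_cmult nn_integral_multc gauss_integral)
  then show ?thesis unfolding power2_eq_square intensity_cancel[symmetric] by (simp only: mult_ac)
qed

lemma gauss_integral3: "ennreal n ^ 3 * (\<integral>\<^sup>+x. (\<integral>\<^sup>+y. (\<integral>\<^sup>+z. C * (gauss a x * (gauss a y * gauss a z)) \<partial>lborel) \<partial>lborel) \<partial>lborel) = C * 54 ^ 3"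
proof -
  have "(\<integral>\<^sup>+x. (\<integral>\<^sup>+y. (\<integral>\<^sup>+z. C * (gauss a x * (gauss a y * gauss a z)) \<partial>lborel) \<partial>lborel) \<partial>lborel)
      = C * (ennreal (54 / n) * (ennreal (54 / n) * ennreal (54 / n)))"
    by (simp add: nn_integral_cmult nn_integral_multc gauss_integral)
  then show ?thesis unfolding power3_eq_cube intensity_cancel[symmetric] by (simp only: mult_ac)
qed

lemma gauss_mult:
  "gauss a x * gauss a y = ennreal (exp (- (n * pi / 54) * ((dist a x)\<^sup>2 + (dist a y)\<^sup>2)))"
  "gauss a x * (gauss a y * gauss a z) = ennreal (exp (- (n * pi / 54) * ((dist a x)\<^sup>2 + (dist a y)\<^sup>2 + (dist a z)\<^sup>2)))"
  unfolding gauss_def by (simp_all flip: ennreal_mult' exp_add add: algebra_simps)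

text \<open>
  One half of the exponent absorbs the weight, the other half is left to dominate the density by a
  Gaussian in the distances of the vertices from a fixed point.
\<close>

definition tame :: "ennreal \<Rightarrow> (real \<Rightarrow> ennreal) \<Rightarrow> bool" where
  "tame C w \<longleftrightarrow> (\<forall>R\<ge>0. w R * ennreal (exp (- (n * pi * R\<^sup>2))) \<le> C * ennreal (exp (- (n * pi * R\<^sup>2 / 2))))"

lemma tame_one: "tame 1 (\<lambda>_. 1)"
  unfolding tame_def using intensity_pos by (auto intro!: ennreal_leI)

text \<open>The origin of the rate n^(-1/2): for y = sqrt(n) R, the estimate y \<le> 1 + y^2 \<le>
  exp(y^2) gives R \<le> exp(n pi R^2 / 2) / sqrt(n), at the price of one half of the
  exponent.\<close>

lemma tame_diam: "tame (ennreal (2 / sqrt n)) (\<lambda>r. ennreal (2 * r))"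
  unfolding tame_def
proof (intro allI impI)
  fix R :: real assume R: "R \<ge> 0"
  define y where "y = sqrt n * R"
  have y2: "y\<^sup>2 = n * R\<^sup>2" using intensity_pos by (simp add: y_def power_mult_distrib)
  have "0 \<le> (y - 1)\<^sup>2" by simp
  then have "2 * y \<le> 1 + y\<^sup>2" by (simp add: power2_eq_square algebra_simps)
  then have "y \<le> 1 + y\<^sup>2" using zero_le_power2[of y] by linarith
  also have "\<dots> \<le> exp (y\<^sup>2)" by (rule exp_ge_add_one_self)
  also have "\<dots> \<le> exp (n * pi * R\<^sup>2 / 2)"
    using pi_ge_two intensity_pos mult_right_mono[of 2 pi "n * R\<^sup>2"] by (simp add: y2 mult_ac)
  finally have "R \<le> exp (n * pi * R\<^sup>2 / 2) / sqrt n"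
    using intensity_pos by (simp add: y_def pos_le_divide_eq mult.commute)
  then have "2 * R * exp (- (n * pi * R\<^sup>2)) \<le> 2 * (exp (n * pi * R\<^sup>2 / 2) / sqrt n) * exp (- (n * pi * R\<^sup>2))"
    by (intro mult_right_mono mult_left_mono) simp_all
  also have "\<dots> = 2 / sqrt n * (exp (n * pi * R\<^sup>2 / 2) * exp (- (n * pi * R\<^sup>2)))" by simp
  also have "exp (n * pi * R\<^sup>2 / 2) * exp (- (n * pi * R\<^sup>2)) = exp (- (n * pi * R\<^sup>2 / 2))"
    by (simp flip: exp_add)
  finally show "ennreal (2 * R) * ennreal (exp (- (n * pi * R\<^sup>2))) \<le> ennreal (2 / sqrt n) * ennreal (exp (- (n * pi * R\<^sup>2 / 2)))"
    using R intensity_pos by (simp flip: ennreal_mult add: ennreal_leI)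
qed

text \<open>\<open>D\<close> will be a sum of squared distances of vertices from a fixed point; 27
  R^2 is its largest bound, attained in the estimate for triples near an end.\<close>

lemma tame_bound:
  assumes "tame C w" "R \<ge> 0" "D \<le> 27 * R\<^sup>2"
  shows "w R * ennreal (exp (- (n * pi * R\<^sup>2))) \<le> C * ennreal (exp (- (n * pi / 54) * D))"
proof -
  have "n * pi / 54 * D \<le> n * pi / 54 * (27 * R\<^sup>2)"
    using assms(3) intensity_pos by (intro mult_left_mono) simp_all
  then have "ennreal (exp (- (n * pi * R\<^sup>2 / 2))) \<le> ennreal (exp (- (n * pi / 54) * D))"
    by (intro ennreal_leI) simp
  then have "C * ennreal (exp (- (n * pi * R\<^sup>2 / 2))) \<le> C * ennreal (exp (- (n * pi / 54) * D))"
    by (rule mult_left_mono) simp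
  moreover have "w R * ennreal (exp (- (n * pi * R\<^sup>2))) \<le> C * ennreal (exp (- (n * pi * R\<^sup>2 / 2)))"
    using assms(1,2) unfolding tame_def by blast
  ultimately show ?thesis by (rule order_trans[rotated])
qed

lemma dist_le_twice:
  assumes "dist c a = R" "dist c x = (R :: real)"
  shows "(dist a x)\<^sup>2 \<le> 4 * R\<^sup>2"
proof -
  have "dist a x \<le> 2 * R" using dist_triangle[of a x c] assms by (simp add: dist_commute)
  then have "(dist a x)\<^sup>2 \<le> (2 * R)\<^sup>2" by (intro power_mono) simp_all
  then show ?thesis by (simp add: power2_eq_square)
qed

lemma expected_point_sum:
  assumes [measurable]: "w \<in> borel_measurable borel" and w: "tame C w"
  shows "(\<integral>\<^sup>+\<omega>. point_sum w a b (X \<omega>) \<partial>M) \<le> C * 54"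
proof -
  have "(\<integral>\<^sup>+\<omega>. point_sum w a b (X \<omega>) \<partial>M) = ennreal n * (\<integral>\<^sup>+z. (if noncollinear a b z then w (circumradius a b z) else 0) *
      ennreal (exp (- (n * pi * (circumradius a b z)\<^sup>2))) \<partial>lborel)"
    unfolding point_sum_def
  proof (rule expected_empty_sum1[OF _ _ _ circumradius_nonneg])
    show "z \<notin> ball (circumcenter a b z) (circumradius a b z)"
      if "(if noncollinear a b z then w (circumradius a b z) else 0) \<noteq> 0" for z
      using that circumscribed_not_inside[of a b z] by (auto split: if_splits)
  qed measurable
  also have "\<dots> \<le> ennreal n * (\<integral>\<^sup>+z. C * gauss a z \<partial>lborel)"
  proof (intro mult_left_mono nn_integral_mono)
    fix z
    show "(if noncollinear a b z then w (circumradius a b z) else 0) *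
      ennreal (exp (- (n * pi * (circumradius a b z)\<^sup>2))) \<le> C * gauss a z"
    proof (cases "noncollinear a b z")
      case True
      note d = dist_circumcenter[OF True]
      have "(dist a z)\<^sup>2 \<le> 27 * (circumradius a b z)\<^sup>2"
        using dist_le_twice[OF d(1) d(3)] zero_le_power2[of "circumradius a b z"] by linarith
      from tame_bound[OF w circumradius_nonneg this] show ?thesis using True by (simp add: gauss_def)
    qed simp
  qed simp
  finally show ?thesis unfolding gauss_integral1 .
qed

lemma expected_pair_sum:
  assumes [measurable]: "w \<in> borel_measurable borel" and w: "tame C w"
  shows "(\<integral>\<^sup>+\<omega>. pair_sum w a (X \<omega>) \<partial>M) \<le> C * 54 ^ 2"
proof -
  have "(\<integral>\<^sup>+\<omega>. pair_sum w a (X \<omega>) \<partial>M) = ennreal n ^ 2 * (\<integral>\<^sup>+y. (\<integral>\<^sup>+z. (if noncollinear a y z then w (circumradius a y z) else 0) *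
      ennreal (exp (- (n * pi * (circumradius a y z)\<^sup>2))) \<partial>lborel) \<partial>lborel)"
    unfolding pair_sum_def
  proof (rule expected_empty_sum2[OF _ _ _ circumradius_nonneg])
    show "y \<noteq> z \<and> y \<notin> ball (circumcenter a y z) (circumradius a y z) \<and> z \<notin> ball (circumcenter a y z) (circumradius a y z)"
      if "(if noncollinear a y z then w (circumradius a y z) else 0) \<noteq> 0" for y z
      using that circumscribed_not_inside[of a y z] by (auto split: if_splits)
  qed measurable
  also have "\<dots> \<le> ennreal n ^ 2 * (\<integral>\<^sup>+y. (\<integral>\<^sup>+z. C * (gauss a y * gauss a z) \<partial>lborel) \<partial>lborel)"
  proof (intro mult_left_mono nn_integral_mono)
    fix y z
    show "(if noncollinear a y z then w (circumradius a y z) else 0) *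
      ennreal (exp (- (n * pi * (circumradius a y z)\<^sup>2))) \<le> C * (gauss a y * gauss a z)"
    proof (cases "noncollinear a y z")
      case True
      note d = dist_circumcenter[OF True]
      have "(dist a y)\<^sup>2 + (dist a z)\<^sup>2 \<le> 27 * (circumradius a y z)\<^sup>2"
        using dist_le_twice[OF d(1) d(2)] dist_le_twice[OF d(1) d(3)] zero_le_power2[of "circumradius a y z"] by linarith
      from tame_bound[OF w circumradius_nonneg this] show ?thesis using True by (simp add: gauss_mult)
    qed simp
  qed simp
  finally show ?thesis unfolding gauss_integral2 .
qed

end

locale segment_process = segment_frame s t u + poisson_process M n X
  for s t u :: "real^2" and M :: "'w measure" and n :: real and X :: "'w \<Rightarrow> (real^2) set"
begin

lemma near_weight_measurable: "(\<lambda>(x, y, z). near_weight x y z) \<in> borel_measurable (borel \<Otimes>\<^sub>M borel \<Otimes>\<^sub>M borel)"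
  unfolding near_weight_def near_end_def by measurable

lemma cross_count_measurable: "(\<lambda>(x, y, z). cross_count x y z) \<in> borel_measurable (borel \<Otimes>\<^sub>M borel \<Otimes>\<^sub>M borel)"
  unfolding cross_count_def by measurable

lemma near_weight_support: "near_weight x y z \<noteq> 0 \<Longrightarrow> noncollinear x y z"
  by (simp add: near_weight_def split: if_splits)

lemma cross_count_support: "cross_count x y z \<noteq> 0 \<Longrightarrow> noncollinear x y z"
  by (simp add: cross_count_def split: if_splits)

lemma main_weight_support: "main_weight x y z \<noteq> 0 \<Longrightarrow> noncollinear x y z"
  by (simp add: main_weight_def split: if_splits)

lemma main_weight_measurable3: "(\<lambda>(x, y, z). main_weight x y z) \<in> borel_measurable (borel \<Otimes>\<^sub>M borel \<Otimes>\<^sub>M borel)"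
  by measurable

lemma expected_main_sum: "(\<integral>\<^sup>+\<omega>. main_sum (X \<omega>) \<partial>M) = ennreal (70 / (3 * pi\<^sup>2) * len)"
  by (rule trans[OF expected_circum_sum[OF main_weight_measurable3 main_weight_support] nn_integral_main_weight[OF intensity_pos]])

text \<open>The centre is within 2 R of \<open>a\<close> and at distance R from each vertex, so each
  vertex is within 3 R of \<open>a\<close>; three times 9 R^2 is 27 R^2.\<close>

lemma near_dist_bound:
  assumes "noncollinear x y z" "dist (circumcenter x y z) a \<le> 2 * circumradius x y z"
  shows "(dist a x)\<^sup>2 + (dist a y)\<^sup>2 + (dist a z)\<^sup>2 \<le> 27 * (circumradius x y z)\<^sup>2"
proof -
  let ?R = "circumradius x y z"
  have "(dist a p)\<^sup>2 \<le> 9 * ?R\<^sup>2" if "dist (circumcenter x y z) p = ?R" for p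
  proof -
    have "dist a p \<le> 3 * ?R" using dist_triangle[of a p "circumcenter x y z"] that assms(2) by (simp add: dist_commute)
    then have "(dist a p)\<^sup>2 \<le> (3 * ?R)\<^sup>2" by (intro power_mono) simp_all
    then show ?thesis by (simp add: power2_eq_square)
  qed
  from this[OF dist_circumcenter(1)[OF assms(1)]] this[OF dist_circumcenter(2)[OF assms(1)]]
    this[OF dist_circumcenter(3)[OF assms(1)]]
  show ?thesis by linarith
qed

lemma expected_near_sum: "(\<integral>\<^sup>+\<omega>. near_sum (X \<omega>) \<partial>M) \<le> ennreal (2 / sqrt n) * (2 * 54 ^ 3)"
proof -
  let ?C = "ennreal (2 / sqrt n)"
  let ?G = "\<lambda>a x y z. ?C * (gauss a x * (gauss a y * gauss a z))"
  have "(\<integral>\<^sup>+\<omega>. near_sum (X \<omega>) \<partial>M) = ennreal n ^ 3 * (\<integral>\<^sup>+x. (\<integral>\<^sup>+y. (\<integral>\<^sup>+z. near_weight x y z *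
      ennreal (exp (- (n * pi * (circumradius x y z)\<^sup>2))) \<partial>lborel) \<partial>lborel) \<partial>lborel)"
    by (rule expected_circum_sum[OF near_weight_measurable near_weight_support])
  \<comment> \<open>A triple may be near either end; the sum of the Gaussian bounds centred at
    \<open>s\<close> and at \<open>t\<close> covers both possibilities.\<close>
  also have "\<dots> \<le> ennreal n ^ 3 * (\<integral>\<^sup>+x. (\<integral>\<^sup>+y. (\<integral>\<^sup>+z. ?G s x y z + ?G t x y z \<partial>lborel) \<partial>lborel) \<partial>lborel)"
  proof (intro mult_left_mono nn_integral_mono)
    fix x y z
    show "near_weight x y z * ennreal (exp (- (n * pi * (circumradius x y z)\<^sup>2))) \<le> ?G s x y z + ?G t x y z"
    proof (cases "noncollinear x y z \<and> near_end x y z")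
      case True
      then have nc: "noncollinear x y z" by simp
      have le: "near_weight x y z * ennreal (exp (- (n * pi * (circumradius x y z)\<^sup>2))) \<le> ?G a x y z"
        if "dist (circumcenter x y z) a \<le> 2 * circumradius x y z" for a
        using tame_bound[OF tame_diam circumradius_nonneg near_dist_bound[OF nc that]] True
        by (simp add: near_weight_def gauss_mult(2))
      from True have "dist (circumcenter x y z) s \<le> 2 * circumradius x y z \<or> dist (circumcenter x y z) t \<le> 2 * circumradius x y z"
        by (simp add: near_end_def)
      then show ?thesis
      proof
        assume "dist (circumcenter x y z) s \<le> 2 * circumradius x y z"
        from le[OF this] show ?thesis by (rule add_increasing2[rotated]) simp
      next
        assume "dist (circumcenter x y z) t \<le> 2 * circumradius x y z"
        from le[OF this] show ?thesis by (rule add_increasing[rotated]) simp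
      qed
    qed (auto simp: near_weight_def)
  qed simp
  also have "(\<integral>\<^sup>+x. (\<integral>\<^sup>+y. (\<integral>\<^sup>+z. ?G s x y z + ?G t x y z \<partial>lborel) \<partial>lborel) \<partial>lborel) =
      (\<integral>\<^sup>+x. (\<integral>\<^sup>+y. (\<integral>\<^sup>+z. ?G s x y z \<partial>lborel) \<partial>lborel) \<partial>lborel) + (\<integral>\<^sup>+x. (\<integral>\<^sup>+y. (\<integral>\<^sup>+z. ?G t x y z \<partial>lborel) \<partial>lborel) \<partial>lborel)"
    by (simp add: nn_integral_add)
  finally show ?thesis
    unfolding distrib_left gauss_integral3 by (simp only: mult_2 distrib_left)
qed

text \<open>Through a common point of triangle and segment, each vertex is within len + 2 R of
  \<open>s\<close>, and (len + 2 R)^2 \<le> 2 len^2 + 8 R^2.\<close>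

lemma crosses_dist_bound:
  assumes nc: "noncollinear x y z" and "crosses x y z"
  shows "(dist s x)\<^sup>2 + (dist s y)\<^sup>2 + (dist s z)\<^sup>2 \<le> 6 * len\<^sup>2 + 24 * (circumradius x y z)\<^sup>2"
proof -
  let ?R = "circumradius x y z" and ?c = "circumcenter x y z"
  obtain p where p: "p \<in> interior (convex hull {x, y, z})" "p \<in> closed_segment s t"
    using assms(2) unfolding crosses_def by blast
  have pc: "dist ?c p \<le> ?R" by (rule dist_circumcenter_interior[OF nc p(1)])
  have "dist s p \<le> len"
    using p(2) dist_le_absc_hgt[of s p] unfolding on_segment_iff by simp
  then have b: "(dist s q)\<^sup>2 \<le> 2 * len\<^sup>2 + 8 * ?R\<^sup>2" if "dist ?c q = ?R" for q
  proof -
    have "dist s q \<le> len + 2 * ?R"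
      using dist_triangle[of s q p] dist_triangle[of p q ?c] pc that \<open>dist s p \<le> len\<close> by (simp add: dist_commute)
    then have "(dist s q)\<^sup>2 \<le> (len + 2 * ?R)\<^sup>2" by (intro power_mono) simp_all
    also have "\<dots> \<le> 2 * len\<^sup>2 + 8 * ?R\<^sup>2"
      using zero_le_power2[of "len - 2 * ?R"] by (simp add: power2_eq_square algebra_simps)
    finally show ?thesis .
  qed
  from b[OF dist_circumcenter(1)[OF nc]] b[OF dist_circumcenter(2)[OF nc]] b[OF dist_circumcenter(3)[OF nc]]
  show ?thesis by linarith
qed

lemma expected_cross_count: "(\<integral>\<^sup>+\<omega>. empty_sum3 cross_count circumcenter circumradius (X \<omega>) \<partial>M) < \<infinity>"
proof -
  \<comment> \<open>Since 6 len^2 / 54 = len^2 / 9, this constant pays for the part of the distance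
    bound that does not shrink with the radius. It grows with n, which is harmless for a claim of
    finiteness.\<close>
  let ?K = "ennreal (exp (n * pi * len\<^sup>2 / 9))"
  have "(\<integral>\<^sup>+\<omega>. empty_sum3 cross_count circumcenter circumradius (X \<omega>) \<partial>M) = ennreal n ^ 3 * (\<integral>\<^sup>+x. (\<integral>\<^sup>+y. (\<integral>\<^sup>+z. cross_count x y z *
      ennreal (exp (- (n * pi * (circumradius x y z)\<^sup>2))) \<partial>lborel) \<partial>lborel) \<partial>lborel)"
    by (rule expected_circum_sum[OF cross_count_measurable cross_count_support])
  also have "\<dots> \<le> ennreal n ^ 3 * (\<integral>\<^sup>+x. (\<integral>\<^sup>+y. (\<integral>\<^sup>+z. ?K * (gauss s x * (gauss s y * gauss s z)) \<partial>lborel) \<partial>lborel) \<partial>lborel)"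
  proof (intro mult_left_mono nn_integral_mono)
    fix x y z
    show "cross_count x y z * ennreal (exp (- (n * pi * (circumradius x y z)\<^sup>2))) \<le> ?K * (gauss s x * (gauss s y * gauss s z))"
    proof (cases "noncollinear x y z \<and> crosses x y z")
      case True
      let ?D = "(dist s x)\<^sup>2 + (dist s y)\<^sup>2 + (dist s z)\<^sup>2"
      have "n * pi / 54 * ?D \<le> n * pi / 54 * (6 * len\<^sup>2 + 54 * (circumradius x y z)\<^sup>2)"
        using crosses_dist_bound[of x y z] True intensity_pos zero_le_power2[of "circumradius x y z"]
        by (intro mult_left_mono) (linarith, simp)
      then have "- (n * pi * (circumradius x y z)\<^sup>2) \<le> n * pi * len\<^sup>2 / 9 + - (n * pi / 54) * ?D"
        by (simp add: algebra_simps)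
      then have "exp (- (n * pi * (circumradius x y z)\<^sup>2)) \<le> exp (n * pi * len\<^sup>2 / 9) * exp (- (n * pi / 54) * ?D)"
        by (simp flip: exp_add)
      then have "ennreal (exp (- (n * pi * (circumradius x y z)\<^sup>2))) \<le> ?K * ennreal (exp (- (n * pi / 54) * ?D))"
        by (simp flip: ennreal_mult' add: ennreal_leI)
      then show ?thesis using True by (simp add: cross_count_def gauss_mult(2))
    qed (auto simp: cross_count_def)
  qed simp
  also have "\<dots> < \<infinity>" unfolding gauss_integral3 by (simp add: ennreal_mult_less_top power_less_top_ennreal)
  finally show ?thesis .
qed

lemma error_measurable [measurable]:
  "near_sum \<in> borel_measurable config_space" "main_sum \<in> borel_measurable config_space"
  "empty_sum3 cross_count circumcenter circumradius \<in> borel_measurable config_space"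
  "pair_sum diam_weight a \<in> borel_measurable config_space" "point_sum diam_weight a b \<in> borel_measurable config_space"
  "pair_sum (\<lambda>_. 1) a \<in> borel_measurable config_space" "point_sum (\<lambda>_. 1) a b \<in> borel_measurable config_space"
  by (rule measurable_circum_sum[OF near_weight_measurable near_weight_support]
    measurable_circum_sum[OF main_weight_measurable3 main_weight_support]
    measurable_circum_sum[OF cross_count_measurable cross_count_support]
    measurable_pair_sum measurable_point_sum; measurable)+

lemma end_sum_measurable [measurable]:
  "end_sum diam_weight \<in> borel_measurable config_space" "end_sum (\<lambda>_. 1) \<in> borel_measurable config_space"
  "error_sum \<in> borel_measurable config_space"
  unfolding error_sum_def[abs_def] end_sum_def[abs_def] by measurable

lemma expected_end_sum:
  assumes [measurable]: "w \<in> borel_measurable borel" and w: "tame C w"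
  shows "(\<integral>\<^sup>+\<omega>. end_sum w (X \<omega>) \<partial>M) \<le> C * (2 * 54 ^ 2 + 4 * 54)"
proof -
  note [measurable] = measurable_pair_sum[OF assms(1)] measurable_point_sum[OF assms(1)]
  have "(\<integral>\<^sup>+\<omega>. end_sum w (X \<omega>) \<partial>M) = (\<integral>\<^sup>+\<omega>. pair_sum w s (X \<omega>) \<partial>M) + (\<integral>\<^sup>+\<omega>. pair_sum w t (X \<omega>) \<partial>M) +
      4 * (\<integral>\<^sup>+\<omega>. point_sum w s t (X \<omega>) \<partial>M)"
    unfolding end_sum_def by (simp add: nn_integral_add nn_integral_cmult)
  also have "\<dots> \<le> C * 54 ^ 2 + C * 54 ^ 2 + 4 * (C * 54)"
    by (intro add_mono mult_left_mono expected_pair_sum expected_point_sum assms) simp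
  also have "\<dots> = C * (2 * 54 ^ 2 + 4 * 54)"
    by (simp only: distrib_left mult_2 mult_ac)
  finally show ?thesis .
qed

lemma expected_error_sum:
  "(\<integral>\<^sup>+\<omega>. error_sum (X \<omega>) \<partial>M) \<le> ennreal (2 / sqrt n) * (2 * 54 ^ 3 + 3 * (2 * 54 ^ 2 + 4 * 54) + 2 * 54)"
proof -
  let ?C = "ennreal (2 / sqrt n)"
  have "(\<integral>\<^sup>+\<omega>. error_sum (X \<omega>) \<partial>M) = (\<integral>\<^sup>+\<omega>. near_sum (X \<omega>) \<partial>M) + 3 * (\<integral>\<^sup>+\<omega>. end_sum diam_weight (X \<omega>) \<partial>M) +
      2 * (\<integral>\<^sup>+\<omega>. point_sum diam_weight s t (X \<omega>) \<partial>M)"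
    unfolding error_sum_def by (simp add: nn_integral_add nn_integral_cmult)
  also have "\<dots> \<le> ?C * (2 * 54 ^ 3) + 3 * (?C * (2 * 54 ^ 2 + 4 * 54)) + 2 * (?C * 54)"
    by (intro add_mono mult_left_mono expected_near_sum expected_end_sum expected_point_sum tame_diam) (simp_all)
  also have "\<dots> = ?C * (2 * 54 ^ 3 + 3 * (2 * 54 ^ 2 + 4 * 54) + 2 * 54)"
    by (simp only: distrib_left mult_ac)
  finally show ?thesis .
qed

section \<open>Almost sure properties\<close>

lemma nn_integral_axis: "(\<integral>\<^sup>+x. (if hgt x = 0 then 1 else 0) \<partial>lborel) = (0 :: ennreal)"
proof -
  have "(\<integral>\<^sup>+x. (if hgt x = 0 then 1 else 0 :: ennreal) \<partial>lborel) = (\<integral>\<^sup>+z. (if Im z = 0 then 1 else 0) \<partial>lborel)"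
    by (subst nn_integral_plane_pt) simp_all
  also have "\<dots> = (\<integral>\<^sup>+x. (\<integral>\<^sup>+y. (if y = (0::real) then 1 else 0) \<partial>lborel) \<partial>(lborel :: real measure))"
    by (subst nn_integral_complex) simp_all
  also have "\<dots> = 0"
  proof -
    have eq: "(\<lambda>y. if y = (0::real) then 1 else 0 :: ennreal) = indicator {0}"
      by (simp add: fun_eq_iff indicator_def)
    show ?thesis unfolding eq by simp
  qed
  finally show ?thesis .
qed

lemma AE_off_axis: "AE \<omega> in M. \<forall>x\<in>X \<omega>. hgt x \<noteq> 0"
proof -
  \<comment> \<open>The sum formed with \<open>?f\<close> and balls of radius 0 has a vacuous
    emptiness condition, so it counts the Poisson points on the line.\<close>
  let ?f = "\<lambda>x. if hgt x = 0 then 1 else 0 :: ennreal"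
  have f: "?f \<in> borel_measurable borel" by measurable
  have "(\<integral>\<^sup>+\<omega>. empty_sum1 ?f (\<lambda>_. 0) (\<lambda>_. 0) (X \<omega>) \<partial>M) = ennreal n * (\<integral>\<^sup>+x. ?f x * ennreal (exp (- (n * pi * 0\<^sup>2))) \<partial>lborel)"
    by (rule expected_empty_sum1[OF f]) simp_all
  also have "\<dots> = 0" by (simp add: nn_integral_axis)
  finally have "(\<integral>\<^sup>+\<omega>. empty_sum1 ?f (\<lambda>_. 0) (\<lambda>_. 0) (X \<omega>) \<partial>M) = 0" .
  moreover have "empty_sum1 ?f (\<lambda>_. 0) (\<lambda>_. 0) \<in> borel_measurable config_space"
    by (rule measurable_empty_sum1[OF f]) simp_all
  then have "(\<lambda>\<omega>. empty_sum1 ?f (\<lambda>_. 0) (\<lambda>_. 0) (X \<omega>)) \<in> borel_measurable M"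
    by (rule measurable_compose[OF X_measurable])
  ultimately have "AE \<omega> in M. empty_sum1 ?f (\<lambda>_. 0) (\<lambda>_. 0) (X \<omega>) = 0"
    by (simp add: nn_integral_0_iff_AE)
  moreover have "\<forall>x\<in>\<phi>. hgt x \<noteq> 0" if "empty_sum1 ?f (\<lambda>_. 0) (\<lambda>_. 0) \<phi> = 0" for \<phi>
  proof -
    from that have "(\<integral>\<^sup>+x. ?f x \<partial>count_space \<phi>) = 0" by (simp add: empty_sum1_def cong: if_cong)
    then have "AE x in count_space \<phi>. ?f x = 0" by (subst (asm) nn_integral_0_iff_AE) simp_all
    then show ?thesis by (simp add: AE_count_space split: if_splits)
  qed
  ultimately show ?thesis by (auto elim: eventually_mono)
qed

lemma AE_finite: "AE \<omega> in M. finite (up_triples (X \<omega> \<union> {s, t}))"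
proof -
  have "AE \<omega> in M. empty_sum3 cross_count circumcenter circumradius (X \<omega>) \<noteq> \<infinity>"
    by (rule nn_integral_PInf_AE) (measurable, use expected_cross_count in auto)
  moreover have "AE \<omega> in M. end_sum (\<lambda>_. 1) (X \<omega>) \<noteq> \<infinity>"
  proof (rule nn_integral_PInf_AE)
    have "(\<integral>\<^sup>+\<omega>. end_sum (\<lambda>_. 1) (X \<omega>) \<partial>M) \<le> 1 * (2 * 54 ^ 2 + 4 * 54)"
      by (rule expected_end_sum[OF _ tame_one]) simp
    also have "\<dots> < \<infinity>" by (simp add: ennreal_mult_less_top power_less_top_ennreal)
    finally show "(\<integral>\<^sup>+\<omega>. end_sum (\<lambda>_. 1) (X \<omega>) \<partial>M) \<noteq> \<infinity>" by simp
  qed measurable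
  ultimately show ?thesis
  proof eventually_elim
    case (elim \<omega>)
    then show ?case by (intro finite_up_triples) (simp_all add: top.not_eq_extremum)
  qed
qed

text \<open>The weight \<open>g\<close> is left open to cover both the number of upper triples
  (weight 1) and their total edge length.\<close>

definition up_weight :: "(real^2 \<Rightarrow> real^2 \<Rightarrow> ennreal) \<Rightarrow> real^2 \<Rightarrow> real^2 \<Rightarrow> real^2 \<Rightarrow> ennreal" where
  "up_weight g x y z = (if noncollinear x y z \<and> crosses x y z \<and> 0 \<le> hgt x \<and> 0 \<le> hgt y then g x y else 0)"

lemma up_sum_eq: "empty_sum3 (up_weight g) circumcenter circumradius \<psi> = (\<integral>\<^sup>+q. (case q of (x, y, z) \<Rightarrow> g x y) \<partial>count_space (up_triples \<psi>))"
proof -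
  have eq: "{q \<in> \<psi> \<times> \<psi> \<times> \<psi>. empty_triangle \<psi> q \<and> (case q of (x, y, z) \<Rightarrow> crosses x y z \<and> 0 \<le> hgt x \<and> 0 \<le> hgt y)} = up_triples \<psi>"
    unfolding up_triples_def empty_triangle_def by blast
  show ?thesis
    by (subst empty_sum3_eq[where P = "\<lambda>(x, y, z). crosses x y z \<and> 0 \<le> hgt x \<and> 0 \<le> hgt y" and g = "\<lambda>(x, y, z). g x y"])
      (simp_all add: up_weight_def eq)
qed

lemma up_sum_measurable:
  assumes [measurable]: "(\<lambda>(x, y). g x y) \<in> borel_measurable (borel \<Otimes>\<^sub>M borel)"
  shows "empty_sum3 (up_weight g) circumcenter circumradius \<in> borel_measurable config_space"
proof (rule measurable_circum_sum)
  have *: "up_weight g x y z = (if (noncollinear x y z \<and> crosses x y z) \<and> 0 \<le> hgt x \<and> 0 \<le> hgt y then (\<lambda>(x, y). g x y) (x, y) else 0)" for x y z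
    by (simp add: up_weight_def)
  show "(\<lambda>(x, y, z). up_weight g x y z) \<in> borel_measurable (borel \<Otimes>\<^sub>M borel \<Otimes>\<^sub>M borel)"
    unfolding * by measurable
  show "noncollinear x y z" if "up_weight g x y z \<noteq> 0" for x y z
    using that by (simp add: up_weight_def split: if_splits)
qed

definition with_ends :: "(real^2) set \<Rightarrow> (real^2) set" where
  "with_ends \<phi> = \<phi> \<union> {s, t}"

lemma with_ends_measurable [measurable]: "with_ends \<in> measurable config_space config_space"
  unfolding with_ends_def[abs_def]
proof (rule measurable_into_config)
  fix B :: "(real^2) set" assume B: "B \<in> sets borel"
  have eq: "(\<phi> \<union> {s, t}) \<inter> B = {} \<longleftrightarrow> \<phi> \<inter> B = {} \<and> s \<notin> B \<and> t \<notin> B" for \<phi>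
    by blast
  show "Measurable.pred config_space (\<lambda>\<phi>. (\<phi> \<union> {s, t}) \<inter> B = {})"
    unfolding eq by (intro pred_intros_logic pred_void[OF B] measurable_const) simp_all
qed (auto intro: loc_finite_Un simp del: Un_insert_right)

text \<open>The path is defined by the choice of a list. Here its length and the underlying case
  distinction are written by measurable sums over the configuration, which turns the length into a
  random variable.\<close>

lemma path_length_formula:
  assumes "s \<in> \<psi>" "t \<in> \<psi>"
  shows "path_length (upper_path \<psi> s t u) = (if point_sum (\<lambda>_. 1) s t \<psi> \<noteq> 0 then dist s t
     else if empty_sum3 (up_weight (\<lambda>_ _. 1)) circumcenter circumradius \<psi> < \<infinity>
     then enn2real (empty_sum3 (up_weight (\<lambda>x y. ennreal (dist x y))) circumcenter circumradius \<psi>) / 2 else 0)"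
proof -
  have A: "closed_segment s t \<in> delaunay_edges \<psi> \<longleftrightarrow> point_sum (\<lambda>_. 1) s t \<psi> \<noteq> 0"
  proof -
    define Z where "Z = {z \<in> \<psi>. empty_triangle \<psi> (s, t, z)}"
    have "point_sum (\<lambda>_. 1) s t \<psi> = (\<integral>\<^sup>+z. 1 \<partial>count_space Z)"
      unfolding point_sum_eq Z_def[symmetric] radius_weight_one ..
    then have "point_sum (\<lambda>_. 1) s t \<psi> \<noteq> 0 \<longleftrightarrow> Z \<noteq> {}"
      by (simp only: nn_count_one_eq_0)
    moreover have "z \<in> Z \<longleftrightarrow> z \<in> \<psi> \<and> noncollinear s t z \<and> \<psi> \<inter> ball (circumcenter s t z) (circumradius s t z) = {}" for z
      by (simp only: Z_def mem_Collect_eq empty_triangle_def prod.case)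
    then have "(\<exists>z. z \<in> Z) \<longleftrightarrow> closed_segment s t \<in> delaunay_edges \<psi>"
      by (simp only: segment_delaunay_iff assms Bex_def simp_thms)
    ultimately show ?thesis by (simp only: ex_in_conv)
  qed
  have F: "finite (up_triples \<psi>) \<longleftrightarrow> empty_sum3 (up_weight (\<lambda>_ _. 1)) circumcenter circumradius \<psi> < \<infinity>"
  proof -
    have "empty_sum3 (up_weight (\<lambda>_ _. 1)) circumcenter circumradius \<psi> = (\<integral>\<^sup>+q. 1 \<partial>count_space (up_triples \<psi>))"
      unfolding up_sum_eq case_prod_beta' ..
    then show ?thesis by (simp only: nn_count_one_less_top)
  qed
  have S: "enn2real (empty_sum3 (up_weight (\<lambda>x y. ennreal (dist x y))) circumcenter circumradius \<psi>) = (\<Sum>(x, y, z)\<in>up_triples \<psi>. dist x y)"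
    if fin: "finite (up_triples \<psi>)"
  proof -
    have "empty_sum3 (up_weight (\<lambda>x y. ennreal (dist x y))) circumcenter circumradius \<psi> = (\<Sum>q\<in>up_triples \<psi>. ennreal (case q of (x, y, z) \<Rightarrow> dist x y))"
      unfolding up_sum_eq using fin by (subst nn_integral_count_space_finite) (auto simp: case_prod_beta')
    also have "\<dots> = ennreal (\<Sum>q\<in>up_triples \<psi>. (case q of (x, y, z) \<Rightarrow> dist x y))"
      by (rule sum_ennreal) auto
    finally show ?thesis by (simp add: sum_nonneg case_prod_beta')
  qed
  show ?thesis
    unfolding path_length_eq A[symmetric] F[symmetric] using S by simp
qed

lemma up_length_measurable [measurable]: "(\<lambda>\<omega>. up_length (X \<omega>)) \<in> borel_measurable M"
proof -
  note [measurable] = up_sum_measurable[of "\<lambda>_ _. 1"] up_sum_measurable[of "\<lambda>x y. ennreal (dist x y)"]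
  have eq: "path_length (upper_path (\<phi> \<union> {s, t}) s t u) = (if point_sum (\<lambda>_. 1) s t (with_ends \<phi>) \<noteq> 0 then dist s t
     else if empty_sum3 (up_weight (\<lambda>_ _. 1)) circumcenter circumradius (with_ends \<phi>) < \<infinity>
     then enn2real (empty_sum3 (up_weight (\<lambda>x y. ennreal (dist x y))) circumcenter circumradius (with_ends \<phi>)) / 2 else 0)" for \<phi>
    unfolding with_ends_def by (rule path_length_formula) simp_all
  show ?thesis unfolding eq by measurable
qed

lemma up_length_nonneg: "0 \<le> up_length \<phi>"
  unfolding path_length_eq by (auto intro!: sum_nonneg divide_nonneg_nonneg)

text \<open>The factor 2 stems from the two orientations of each edge. The constant 333180 is 2 *
  54^3 + 3 * (2 * 54^2 + 4 * 54) + 2 * 54 from \<open>expected_error_sum\<close>.\<close>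

lemma up_length_expectation:
  "\<bar>2 * expectation (\<lambda>\<omega>. up_length (X \<omega>)) - 70 / (3 * pi\<^sup>2) * len\<bar> \<le> 2 / sqrt n * 333180"
proof -
  define m where "m = 70 / (3 * pi\<^sup>2) * len"
  define \<epsilon> where "\<epsilon> = 2 / sqrt n * 333180"
  have m0: "m \<ge> 0" and \<epsilon>0: "\<epsilon> \<ge> 0" using len_pos intensity_pos by (simp_all add: m_def \<epsilon>_def)
  have "(\<integral>\<^sup>+\<omega>. error_sum (X \<omega>) \<partial>M) \<le> ennreal (2 / sqrt n) * ennreal 333180"
    using expected_error_sum by simp
  also have "\<dots> = ennreal \<epsilon>" unfolding \<epsilon>_def using intensity_pos by (intro ennreal_mult[symmetric]) simp_all
  finally have E: "(\<integral>\<^sup>+\<omega>. error_sum (X \<omega>) \<partial>M) \<le> ennreal \<epsilon>" .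
  let ?F = "\<integral>\<^sup>+\<omega>. ennreal (2 * up_length (X \<omega>)) \<partial>M"
  have b: "AE \<omega> in M. ennreal (2 * up_length (X \<omega>)) \<le> main_sum (X \<omega>) + error_sum (X \<omega>) \<and>
      main_sum (X \<omega>) \<le> ennreal (2 * up_length (X \<omega>)) + error_sum (X \<omega>)"
    using AE_off_axis AE_finite
  proof eventually_elim
    case (elim \<omega>)
    then show ?case using up_length_bounds[of "X \<omega>"] by blast
  qed
  have "?F \<le> (\<integral>\<^sup>+\<omega>. main_sum (X \<omega>) + error_sum (X \<omega>) \<partial>M)"
    by (rule nn_integral_mono_AE) (use b in \<open>auto elim: eventually_mono\<close>)
  also have "\<dots> = (\<integral>\<^sup>+\<omega>. main_sum (X \<omega>) \<partial>M) + (\<integral>\<^sup>+\<omega>. error_sum (X \<omega>) \<partial>M)"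
    by (rule nn_integral_add) measurable
  also have "\<dots> \<le> ennreal m + ennreal \<epsilon>"
    unfolding expected_main_sum m_def by (intro add_left_mono E)
  finally have 1: "?F \<le> ennreal (m + \<epsilon>)" using m0 \<epsilon>0 by simp
  have "ennreal m = (\<integral>\<^sup>+\<omega>. main_sum (X \<omega>) \<partial>M)" unfolding m_def expected_main_sum ..
  also have "\<dots> \<le> (\<integral>\<^sup>+\<omega>. ennreal (2 * up_length (X \<omega>)) + error_sum (X \<omega>) \<partial>M)"
    by (rule nn_integral_mono_AE) (use b in \<open>auto elim: eventually_mono\<close>)
  also have "\<dots> = ?F + (\<integral>\<^sup>+\<omega>. error_sum (X \<omega>) \<partial>M)"
    by (rule nn_integral_add) measurable
  also have "\<dots> \<le> ?F + ennreal \<epsilon>" by (intro add_left_mono E)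
  finally have 2: "ennreal m \<le> ?F + ennreal \<epsilon>" .
  define L where "L = (\<lambda>\<omega>. up_length (X \<omega>))"
  have L: "up_length (X \<omega>) = L \<omega>" for \<omega> by (simp only: L_def)
  have Lm [measurable]: "L \<in> borel_measurable M" unfolding L_def by (rule up_length_measurable)
  have L0: "0 \<le> L \<omega>" for \<omega> unfolding L_def by (rule up_length_nonneg)
  \<comment> \<open>The finite upper estimate yields integrability, without which the Bochner
    expectation would be 0 by convention and not the value of the nonnegative integral.\<close>
  have int: "integrable M (\<lambda>\<omega>. 2 * L \<omega>)"
    by (rule integrableI_nonneg) (use 1[unfolded L] L0 in \<open>auto intro: le_less_trans\<close>)
  have F: "(\<integral>\<^sup>+\<omega>. ennreal (2 * L \<omega>) \<partial>M) = ennreal (2 * expectation L)"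
    using nn_integral_eq_integral[OF int] L0 by simp
  have e0: "0 \<le> expectation L"
    by (rule Bochner_Integration.integral_nonneg) (rule L0)
  have "2 * expectation L \<le> m + \<epsilon>"
    using 1[unfolded L F] m0 \<epsilon>0 by (subst (asm) ennreal_le_iff) simp_all
  moreover have "ennreal m \<le> ennreal (2 * expectation L + \<epsilon>)"
    using 2[unfolded L F] e0 \<epsilon>0 by simp
  then have "m \<le> 2 * expectation L + \<epsilon>"
    using e0 \<epsilon>0 by (subst (asm) ennreal_le_iff) simp_all
  ultimately show ?thesis unfolding m_def[symmetric] \<epsilon>_def[symmetric] L by linarith
qed

lemma up_length_ratio:
  "\<bar>expectation (\<lambda>\<omega>. up_length (X \<omega>) / norm (s - t)) - 35 / (3 * pi\<^sup>2)\<bar> \<le> 333180 / len * n powr (- 1 / 2)"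
proof -
  let ?e = "expectation (\<lambda>\<omega>. up_length (X \<omega>))"
  have l: "norm (s - t) = len" by (simp add: len_def norm_minus_commute)
  have p: "n powr (- 1 / 2) = 1 / sqrt n"
    using intensity_pos by (simp add: powr_minus_divide powr_half_sqrt)
  have "expectation (\<lambda>\<omega>. up_length (X \<omega>) / norm (s - t)) - 35 / (3 * pi\<^sup>2) =
      (2 * ?e - 70 / (3 * pi\<^sup>2) * len) / (2 * len)"
    using len_pos by (simp add: l diff_divide_distrib)
  then have "\<bar>expectation (\<lambda>\<omega>. up_length (X \<omega>) / norm (s - t)) - 35 / (3 * pi\<^sup>2)\<bar> =
      \<bar>2 * ?e - 70 / (3 * pi\<^sup>2) * len\<bar> / (2 * len)"
    using len_pos by (simp only: abs_divide abs_mult abs_numeral abs_of_pos)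
  also have "\<dots> \<le> (2 / sqrt n * 333180) / (2 * len)"
    using len_pos by (intro divide_right_mono up_length_expectation) simp
  also have "\<dots> = 333180 / len * n powr (- 1 / 2)"
    unfolding p by simp
  finally show ?thesis .
qed

end

theorem proposition7:
  fixes s t u :: "real^2"
    and M :: "real \<Rightarrow> 'w measure"
    and X :: "real \<Rightarrow> 'w \<Rightarrow> (real^2) set"
  assumes "s \<noteq> t"
    and "norm u = 1" and "u \<bullet> (t - s) = 0"
    and "\<And>n. n > 0 \<Longrightarrow> poisson_point_process (M n) n (X n)"
  shows "(\<lambda>n. prob_space.expectation (M n)
                (\<lambda>\<omega>. path_length (upper_path (X n \<omega> \<union> {s, t}) s t u) / norm (s - t))
              - 35 / (3 * pi\<^sup>2)) \<in> O[at_top](\<lambda>n. n powr (- 1 / 2))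
         \<and> \<bar>35 / (3 * pi\<^sup>2) - 1.182\<bar> < 0.0005"
proof
  interpret segment_frame s t u
    using assms(1-3) by unfold_locales
  show "(\<lambda>n. prob_space.expectation (M n)
                (\<lambda>\<omega>. path_length (upper_path (X n \<omega> \<union> {s, t}) s t u) / norm (s - t))
              - 35 / (3 * pi\<^sup>2)) \<in> O[at_top](\<lambda>n. n powr (- 1 / 2))"
  \<comment> \<open>The estimate holds for each n > 0 separately, with a constant that depends only
    on the length of the segment; the spaces \<open>M n\<close> for different n need not be
    related.\<close>
  proof (rule bigoI)
    show "\<forall>\<^sub>F n in at_top. norm (prob_space.expectation (M n)
                (\<lambda>\<omega>. path_length (upper_path (X n \<omega> \<union> {s, t}) s t u) / norm (s - t))
              - 35 / (3 * pi\<^sup>2)) \<le> 333180 / len * norm (n powr (- 1 / 2))"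
      using eventually_gt_at_top[of "0::real"]
    proof eventually_elim
      case (elim n)
      note ppp = assms(4)[OF elim]
      interpret prob_space "M n" using ppp by (simp add: poisson_point_process_def)
      interpret segment_process s t u "M n" n "X n" by unfold_locales (use ppp elim in auto)
      show ?case using up_length_ratio by simp
    qed
  qed
qed (rule constant_bounds)

end
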